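(* Let $G$ be a (finite, simple) triangle-free graph of maximum degree at most three. Then the fractional chromatic number of $G$ satisfies $\chi_f(G) \leq 43/15$.
   Context: For positive integers $a,b$, an $(a:b)$-coloring of a graph $G$ is a function $f$ assigning to each vertex a $b$-element subset of $\{1,\dots,a\}$ such that $f(u)\cap f(v)=\emptyset$ for every pair of adjacent vertices $u,v$. The fractional chromatic number $\chi_f(G)$ is the infimum of $a/b$ over all pairs of positive integers $a,b$ such that $G$ has an $(a:b)$-coloring. *)

theory Defs
  imports Complex_Main "Graph_Theory.Digraph"
begin

text \<open>
  Finite simple graphs are the \<^locale>\<open>graph\<close>s of the library: finite, loop-free symmetric digraphs
  without parallel arcs.  Each undirected edge is represented by two opposite arcs, so the degree of
  a vertex is its \<^const>\<open>out_degree\<close>.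
\<close>

text \<open>In a loop-free graph the three vertices below are automatically distinct.\<close>

definition triangle_free :: "('a, 'b) pre_digraph \<Rightarrow> bool" where
  "triangle_free G \<longleftrightarrow> \<not> (\<exists>u v w. u \<rightarrow>\<^bsub>G\<^esub> v \<and> v \<rightarrow>\<^bsub>G\<^esub> w \<and> w \<rightarrow>\<^bsub>G\<^esub> u)"

definition multicoloring :: "('a, 'b) pre_digraph \<Rightarrow> nat \<Rightarrow> nat \<Rightarrow> ('a \<Rightarrow> nat set) \<Rightarrow> bool" where
  "multicoloring G a b f \<longleftrightarrow>
     (\<forall>v\<in>verts G. f v \<subseteq> {1..a} \<and> card (f v) = b) \<and>
     (\<forall>u v. u \<rightarrow>\<^bsub>G\<^esub> v \<longrightarrow> f u \<inter> f v = {})"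

definition coloring_ratios :: "('a, 'b) pre_digraph \<Rightarrow> real set" where
  "coloring_ratios G = {real a / real b | a b. 0 < a \<and> 0 < b \<and> (\<exists>f. multicoloring G a b f)}"

text \<open>
  The infimum of a set of reals is only meaningful if the set is nonempty and bounded below; the two
  lemmas after the definition establish this for every finite simple graph.
\<close>

definition fractional_chromatic_number :: "('a, 'b) pre_digraph \<Rightarrow> real" where
  "fractional_chromatic_number G = Inf (coloring_ratios G)"

lemma bdd_below_coloring_ratios: "bdd_below (coloring_ratios G)"
  by (rule bdd_belowI[of _ 0]) (auto simp: coloring_ratios_def)

lemma (in graph) coloring_ratios_nonempty: "coloring_ratios G \<noteq> {}"
proof -
  obtain h where h: "bij_betw h (verts G) {0..<card (verts G)}"
    using ex_bij_betw_finite_nat[OF finite_verts] by blast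
  define f where "f v = {Suc (h v)}" for v
  have range: "h v < card (verts G)" if "v \<in> verts G" for v
    using bij_betwE[OF h] that by auto
  have "f u \<inter> f v = {}" if "u \<rightarrow> v" for u v
  proof -
    have "u \<noteq> v" using that adj_not_same by blast
    then have "h u \<noteq> h v"
      using h adj_in_verts[OF that] by (auto simp: bij_betw_def inj_on_def)
    then show ?thesis by (simp add: f_def)
  qed
  then have "multicoloring G (Suc (card (verts G))) 1 f"
    using range by (force simp: multicoloring_def f_def)
  then have "real (Suc (card (verts G))) / real 1 \<in> coloring_ratios G"
    unfolding coloring_ratios_def by blast
  then show ?thesis by blast
qed

end

theory Submission
  imports Defs "HOL-Analysis.Function_Topology"
begin

text \<open>
  Choose a probability distribution on independent sets that minimises the sum over all vertices
  \<open>v\<close> of \<open>(a - x v)\<^sup>2\<close>, taken over those \<open>v\<close> whose coverage probability \<open>x v\<close> is below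
  \<open>a = 15/43\<close>.  If the minimum is \<open>0\<close>, rounding the distribution gives multicolourings with ratios
  tending to \<open>43/15\<close>.  Otherwise put the weight \<open>w v = max 0 (a - x v)\<close> on the vertices; by
  first-order optimality every set in the support of the distribution has maximum weight among all
  independent sets.  For such a set \<open>I\<close>, restricted to the support of \<open>w\<close>, one shows
  \<open>\<Sum>v. w v * (59 * [v \<in> I] + 9 * |N v \<inter> I| - 30) \<ge> 0\<close>.  Averaging over the distribution gives
  \<open>\<Sum>v. w v * (59 * x v + 9 * (\<Sum>u\<in>N v. x u) - 30) \<ge> 0\<close>, which is impossible because \<open>x < a\<close> on
  the support of \<open>w\<close> and \<open>59 * a + 27 * a = 30\<close>.

  The inequality for \<open>I\<close> is a discharging argument: the vertices of \<open>I\<close> pay \<open>12 * w v\<close> to each vertex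
  \<open>v\<close> with two neighbours in \<open>I\<close> and \<open>3 * w v\<close> to each vertex with three, out of a budget of
  \<open>29 * slack u + 8 * w (priv u)\<close>.  All estimates come from exchanging a subset of \<open>I\<close> for an
  independent set all of whose neighbours in \<open>I\<close> lie in that subset.
\<close>

text \<open>Sorted by the number of neighbours in \<open>I\<close>, with \<open>N k\<close> the
  vertices outside \<open>I\<close> having \<open>k\<close> of them, the inequality reads \<open>29
  * sum w I \<ge> 21 * sum w (N 1) + 12 * sum w (N 2) + 3 * sum w (N 3)\<close>. Every vertex of
  \<open>N 1\<close> is private to one \<open>u\<close>, so splitting \<open>w u\<close> into
  \<open>slack u\<close> and private weight leaves the budget, with 8 = 29 - 21. With at most two
  neighbours in \<open>N 2\<close>, \<open>u\<close> owes at most 12 + 12 + 3 = 27 times its slack,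
  so slack alone is harmless there. Two obstacles remain. A vertex of \<open>N 2\<close> can
  outweigh the slack at its two ends; this forces a 5-cycle through private neighbours of the ends,
  and private weight must pay. And a hub, with all three neighbours in \<open>N 2\<close>, has no
  private weight and would owe \<open>36 * w y\<close> out of \<open>29 * w y\<close>; the missing
  \<open>7 * w y\<close> has to come from the far ends of its three neighbours. Exchanges at these
  far ends are simple one by one, but edges between the sets they bring in may make them
  incompatible. The degree bound controls this: most vertices involved have two known neighbours, so
  one unwanted edge saturates them and excludes all others.\<close>

locale max_weight_independent =
  fixes V :: "'a set" and E :: "'a \<Rightarrow> 'a \<Rightarrow> bool" and w :: "'a \<Rightarrow> real" and I :: "'a set"
  assumes finite_V: "finite V"
    and E_in_V: "E x y \<Longrightarrow> x \<in> V"
    and E_sym: "E x y \<Longrightarrow> E y x"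
    and triangle_free: "E x y \<Longrightarrow> E y z \<Longrightarrow> \<not> E x z"
    and subcubic: "card {y. E x y} \<le> 3"
    and w_pos: "x \<in> V \<Longrightarrow> 0 < w x"
    and I_subset: "I \<subseteq> V"
    and I_independent: "x \<in> I \<Longrightarrow> y \<in> I \<Longrightarrow> \<not> E x y"
    and I_max: "J \<subseteq> V \<Longrightarrow> (\<And>x y. x \<in> J \<Longrightarrow> y \<in> J \<Longrightarrow> \<not> E x y) \<Longrightarrow> sum w J \<le> sum w I"
begin

section \<open>Neighbour types relative to the independent set, and the basic exchange\<close>

definition independent :: "'a set \<Rightarrow> bool" where
  "independent S \<longleftrightarrow> (\<forall>x\<in>S. \<forall>y\<in>S. \<not> E x y)"

definition apart :: "'a set \<Rightarrow> 'a set \<Rightarrow> bool" where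
  "apart S T \<longleftrightarrow> (\<forall>x\<in>S. \<forall>y\<in>T. \<not> E x y)"

definition nbI :: "'a \<Rightarrow> 'a set" where
  "nbI x = {u \<in> I. E x u}"

definition priv :: "'a \<Rightarrow> 'a set" where
  "priv u = {x. E u x \<and> nbI x = {u}}"

definition dbl :: "'a \<Rightarrow> 'a set" where
  "dbl u = {x. E u x \<and> card (nbI x) = 2}"

definition trp :: "'a \<Rightarrow> 'a set" where
  "trp u = {x. E u x \<and> card (nbI x) = 3}"

text \<open>The loss when \<open>u\<close> is traded for all its private neighbours at once; hence
  \<open>slack_nonneg\<close>.\<close>

definition slack :: "'a \<Rightarrow> real" where
  "slack u = w u - sum w (priv u)"

text \<open>The three vertices in the triangle condition may coincide, so it also excludes
  loops.\<close>

lemma E_irrefl: "\<not> E x x"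
  using triangle_free by blast

lemma E_in_V2: "E x y \<Longrightarrow> y \<in> V"
  using E_sym E_in_V by blast

lemma finite_N [simp]: "finite {y. E x y}"
  by (rule finite_subset[OF _ finite_V]) (auto dest: E_in_V2)

lemma finite_I [simp]: "finite I"
  using I_subset finite_V finite_subset by blast

lemma finite_nbI [simp]: "finite (nbI x)"
  by (simp add: nbI_def)

text \<open>The form in which the degree bound enters the local arguments: three known neighbours
  saturate a vertex.\<close>

lemma third_nbr:
  assumes "E x a" "E x b" "E x c" "a \<noteq> b" "a \<noteq> c" "b \<noteq> c" "E x d"
  shows "d = a \<or> d = b \<or> d = c"
proof (rule ccontr)
  assume "\<not> ?thesis"
  then have "card {a,b,c,d} = 4" using assms by auto
  moreover have "card {a,b,c,d} \<le> card {y. E x y}"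
    by (rule card_mono) (use assms in auto)
  ultimately show False using subcubic[of x] by simp
qed

lemma finite_subV: "S \<subseteq> V \<Longrightarrow> finite S"
  using finite_V finite_subset by blast

lemma nbI_I: "x \<in> I \<Longrightarrow> nbI x = {}"
  using I_independent by (auto simp: nbI_def)

lemma nbI_sub: "nbI x \<subseteq> I" by (auto simp: nbI_def)

lemma nbI_E: "u \<in> nbI x \<Longrightarrow> E x u \<and> E u x \<and> u \<in> I"
  using E_sym by (auto simp: nbI_def)

text \<open>Otherwise \<open>x\<close> could be added to \<open>I\<close>, gaining the positive
  weight \<open>w x\<close>.\<close>

lemma nbI_nonempty:
  assumes "x \<in> V" "x \<notin> I" shows "nbI x \<noteq> {}"
proof
  assume e: "nbI x = {}"
  have "sum w (insert x I) \<le> sum w I"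
    by (rule I_max) (use assms e I_subset I_independent E_sym E_irrefl in \<open>auto simp: nbI_def\<close>)
  then show False using assms w_pos[of x] by simp
qed

lemma exchange:
  assumes S: "S \<subseteq> V - I" and ind: "independent S" and U: "U \<subseteq> I" and nb: "\<And>x. x \<in> S \<Longrightarrow> nbI x \<subseteq> U"
  shows "sum w S \<le> sum w U"
proof -
  have fS: "finite S" using S finite_subV by blast
  have fU: "finite U" using U finite_I finite_subset by blast
  have "sum w ((I - U) \<union> S) \<le> sum w I"
  proof (rule I_max)
    show "I - U \<union> S \<subseteq> V" using S I_subset by auto
    show "\<not> E x y" if "x \<in> I - U \<union> S" "y \<in> I - U \<union> S" for x y
    proof
      assume "E x y"
      then have "E y x" using E_sym by blast
      with \<open>E x y\<close> that ind nb I_independent[of x y] show False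
        unfolding independent_def nbI_def by blast
    qed
  qed
  moreover have "sum w ((I - U) \<union> S) = sum w (I - U) + sum w S"
    by (rule sum.union_disjoint) (use S fS in auto)
  moreover have "sum w (I - U) = sum w I - sum w U"
    using U by (simp add: sum_diff)
  ultimately show ?thesis by simp
qed

lemma priv_E: "x \<in> priv u \<Longrightarrow> E u x \<and> E x u \<and> nbI x = {u}"
  using E_sym by (auto simp: priv_def)
lemma priv_sub: "priv u \<subseteq> V - I"
  using nbI_I E_in_V2 by (fastforce simp: priv_def)
lemma dbl_sub: "dbl u \<subseteq> V - I"
  using nbI_I E_in_V2 by (fastforce simp: dbl_def)
lemma trp_sub: "trp u \<subseteq> V - I"
  using nbI_I E_in_V2 by (fastforce simp: trp_def)

lemma finite_priv [simp]: "finite (priv u)" and finite_dbl [simp]: "finite (dbl u)" and finite_trp [simp]: "finite (trp u)"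
  using priv_sub dbl_sub trp_sub finite_subV by (metis Diff_subset order_trans)+

text \<open>The main use of triangle-freeness: neighbours of a common vertex never conflict with
  each other.\<close>

lemma common_nb_independent: "(\<And>x. x \<in> S \<Longrightarrow> E u x) \<Longrightarrow> independent S"
  unfolding independent_def using triangle_free E_sym by blast

lemma independent_priv: "independent (priv u)"
  by (rule common_nb_independent[of _ u]) (simp add: priv_def)

lemma priv_nonneg: "0 \<le> sum w (priv u)"
  by (intro sum_nonneg) (use priv_sub w_pos in \<open>force simp: less_imp_le\<close>)

lemma slack_nonneg: assumes "u \<in> I" shows "0 \<le> slack u"
  using exchange[of "priv u" "{u}"] priv_sub independent_priv priv_E assms
  unfolding slack_def by fastforce

lemma card_N: assumes "u \<in> I"
  shows "card (priv u) + card (dbl u) + card (trp u) \<le> 3"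
proof -
  have d1: "priv u \<inter> dbl u = {}" by (auto simp: priv_def dbl_def)
  have d2: "(priv u \<union> dbl u) \<inter> trp u = {}" by (auto simp: priv_def dbl_def trp_def)
  have "card (priv u) + card (dbl u) + card (trp u) = card (priv u \<union> dbl u \<union> trp u)"
    using d1 d2 by (simp add: card_Un_disjoint)
  also have "\<dots> \<le> card {y. E u y}"
    by (rule card_mono) (auto simp: priv_def dbl_def trp_def)
  finally show ?thesis using subcubic[of u] by simp
qed

lemma independent_Un: "independent (A \<union> B) \<longleftrightarrow> independent A \<and> independent B \<and> apart A B"
  using E_sym unfolding independent_def apart_def by blast

definition nonadj :: "'a \<Rightarrow> 'a set \<Rightarrow> bool" where
  "nonadj x A \<longleftrightarrow> (\<forall>y\<in>A. \<not> E x y)"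

lemma E_commute: "E x y \<longleftrightarrow> E y x"
  using E_sym by blast

lemma apart_commute: "apart A B \<longleftrightarrow> apart B A"
  using E_sym unfolding apart_def by blast

lemma independent_insert: "independent (insert x A) \<longleftrightarrow> independent A \<and> nonadj x A"
  using E_sym E_irrefl unfolding independent_def nonadj_def by blast

lemma independent_empty: "independent {}"
  by (simp add: independent_def)

lemma nonadj_simps: "nonadj x {}" "nonadj x (insert y A) \<longleftrightarrow> \<not> E x y \<and> nonadj x A"
  "nonadj x (A \<union> B) \<longleftrightarrow> nonadj x A \<and> nonadj x B"
  by (auto simp: nonadj_def)

lemma apart_simps: "apart {} B" "apart A {}"
  "apart (insert x A) B \<longleftrightarrow> nonadj x B \<and> apart A B"
  "apart A (insert x B) \<longleftrightarrow> nonadj x A \<and> apart A B"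
  "apart (A \<union> B) C \<longleftrightarrow> apart A C \<and> apart B C"
  "apart A (B \<union> C) \<longleftrightarrow> apart A B \<and> apart A C"
  using E_sym by (auto simp: apart_def nonadj_def)

text \<open>Reduces independence of an explicit set to single non-edges; the two commutation rules
  serve as ordered rewriting, so that either orientation of a known non-edge matches.\<close>

lemmas independent_simps = independent_empty independent_insert independent_Un nonadj_simps apart_simps E_commute apart_commute

lemma nonadj_common: "E u x \<Longrightarrow> (\<And>y. y \<in> A \<Longrightarrow> E u y) \<Longrightarrow> nonadj x A"
  unfolding nonadj_def using triangle_free E_sym by blast

text \<open>A total function, so that later definitions can name the far end of \<open>v\<close>
  without a quantifier; meaningful for \<open>u \<in> I\<close> and
  \<open>v \<in> dbl u\<close>.\<close>

definition other :: "'a \<Rightarrow> 'a \<Rightarrow> 'a" where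
  "other u v = the_elem (nbI v - {u})"

lemma other_eq: assumes "nbI v = {u, u'}" "u \<noteq> u'"
  shows "v \<in> dbl u" "other u v = u'" "u \<in> I"
proof -
  have "nbI v - {u} = {u'}" using assms by auto
  then show "other u v = u'" by (simp add: other_def)
  have "u \<in> nbI v" using assms by simp
  then show "v \<in> dbl u" "u \<in> I" using assms nbI_E[of u v] by (auto simp: dbl_def)
qed

lemma dblE: assumes "v \<in> dbl u" "u \<in> I"
  obtains u' where "nbI v = {u, u'}" "u \<noteq> u'" "other u v = u'"
proof -
  have "u \<in> nbI v" using assms E_sym by (auto simp: dbl_def nbI_def)
  moreover have "card (nbI v) = 2" using assms by (simp add: dbl_def)
  ultimately obtain u' where "nbI v = {u,u'}" "u \<noteq> u'"
    by (metis card_2_iff doubleton_eq_iff insertE singletonD)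
  then show ?thesis using that other_eq by blast
qed

lemma other: assumes "v \<in> dbl u" "u \<in> I"
  shows "nbI v = {u, other u v}" "u \<noteq> other u v" "other u v \<in> I" "v \<in> dbl (other u v)" "other (other u v) v = u"
proof -
  obtain u' where u': "nbI v = {u, u'}" "u \<noteq> u'" "other u v = u'" using dblE[OF assms] .
  have *: "nbI v = {u', u}" "u' \<noteq> u" using u' by auto
  show "nbI v = {u, other u v}" "u \<noteq> other u v" "other u v \<in> I" "v \<in> dbl (other u v)" "other (other u v) v = u"
    using u' other_eq[OF *] by simp_all
qed

text \<open>
  A vertex \<open>v\<close> with \<open>nbI v = {u, u'}\<close> is fully paid by \<open>12 * slack u + 12 * slack u'\<close> unless its
  excess is positive; such a vertex is called bad below.
\<close>

definition excess :: "'a \<Rightarrow> real" where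
  "excess v = w v - sum slack (nbI v)"

lemma excess_eq: assumes "nbI v = {u,u'}" "u \<noteq> u'" shows "excess v = w v - slack u - slack u'"
  using assms by (simp add: excess_def)

lemma nbI2_E: assumes "nbI v = {u,u'}" shows "E u v" "E v u" "E u' v" "E v u'" "v \<in> V - I" "u \<in> I" "u' \<in> I"
proof -
  have "u \<in> nbI v" "u' \<in> nbI v" using assms by auto
  then show "E u v" "E v u" "E u' v" "E v u'" "u \<in> I" "u' \<in> I" by (auto dest: nbI_E)
  then show "v \<in> V - I" using E_in_V I_independent by blast
qed

lemma priv_disj: "u \<noteq> u' \<Longrightarrow> priv u \<inter> priv u' = {}"
  by (auto simp: priv_def)

text \<open>Private neighbours of an end of \<open>v\<close> share that end with \<open>v\<close>,
  so only edges between \<open>A\<close> and \<open>B\<close> can interfere. Taking the private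
  neighbours of one end bounds the excess by the private weight of the other; taking those of both
  ends would make the excess nonpositive.\<close>

lemma exchange_edge:
  assumes v: "nbI v = {u,u'}" "u \<noteq> u'" and A: "A \<subseteq> priv u" "B \<subseteq> priv u'" and ap: "apart A B"
  shows "w v + sum w A + sum w B \<le> w u + w u'"
proof -
  note E = nbI2_E[OF v(1)]
  have AB: "A \<inter> B = {}" using A priv_disj[OF v(2)] by auto
  have fin: "finite A" "finite B" using A finite_subset by (meson finite_priv)+
  have vn: "v \<notin> A \<union> B"
  proof
    assume "v \<in> A \<union> B"
    then have "nbI v = {u} \<or> nbI v = {u'}" using A by (auto simp: priv_def)
    then show False using v by auto
  qed
  have EA: "E u x" "nbI x = {u}" if "x \<in> A" for x using that A priv_E by blast+
  have EB: "E u' x" "nbI x = {u'}" if "x \<in> B" for x using that A priv_E by blast+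
  have "sum w (insert v (A \<union> B)) \<le> sum w {u,u'}"
  proof (rule exchange)
    show "insert v (A \<union> B) \<subseteq> V - I" using E A priv_sub by blast
    have "nonadj v A" by (rule nonadj_common[of u]) (use E EA in auto)
    moreover have "nonadj v B" by (rule nonadj_common[of u']) (use E EB in auto)
    moreover have "independent A" by (rule common_nb_independent[OF EA(1)])
    moreover have "independent B" by (rule common_nb_independent[OF EB(1)])
    ultimately show "independent (insert v (A \<union> B))" using ap
      by (simp add: independent_simps)
    show "{u,u'} \<subseteq> I" using E by auto
    show "nbI x \<subseteq> {u,u'}" if "x \<in> insert v (A \<union> B)" for x
      using that v(1) EA EB by auto
  qed
  then show ?thesis using vn fin AB v by (simp add: sum.union_disjoint)
qed

lemma excess_le: assumes v: "nbI v = {u,u'}" "u \<noteq> u'" shows "excess v \<le> sum w (priv u)"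
  using exchange_edge[OF v, of "{}" "priv u'"] excess_eq[OF v] unfolding slack_def by (simp add: apart_simps)

text \<open>The edge found closes the 5-cycle \<open>u\<close>, \<open>v\<close>, \<open>u'\<close>,
  \<open>q'\<close>, \<open>q\<close>.\<close>

lemma excess_pos: assumes v: "nbI v = {u,u'}" "u \<noteq> u'" and "excess v > 0"
  obtains q q' where "q \<in> priv u" "q' \<in> priv u'" "E q q'"
proof -
  have "\<not> apart (priv u) (priv u')"
    using exchange_edge[OF v, of "priv u" "priv u'"] excess_eq[OF v] assms(3) unfolding slack_def by auto
  then show ?thesis using that unfolding apart_def by blast
qed

section \<open>Bad vertices and blocked vertices\<close>

definition bad :: "'a \<Rightarrow> 'a set" where
  "bad u = {v \<in> dbl u. excess v > 0}"

text \<open>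
  A vertex with two bad neighbours can afford both excesses from its private neighbour unless it is
  blocked.  A blocked vertex is rescued by its two partners, which is possible because blocked
  vertices never share a bad vertex.
\<close>

definition blocked :: "'a \<Rightarrow> bool" where
  "blocked u \<longleftrightarrow> card (bad u) = 2 \<and> sum w (priv u) < sum excess (bad u)"

lemma badI: assumes "nbI v = {u, u'}" "u \<noteq> u'" "excess v > 0"
  shows "v \<in> bad u" "v \<in> bad u'"
  using other_eq(1)[of v u u'] other_eq(1)[of v u' u] assms by (auto simp: bad_def insert_commute)

lemma badE: assumes "v \<in> bad u" "u \<in> I"
  obtains u' where "nbI v = {u, u'}" "u \<noteq> u'" "other u v = u'" "v \<in> bad u'" "excess v > 0"
proof -
  have d: "v \<in> dbl u" "excess v > 0" using assms by (auto simp: bad_def)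
  then show ?thesis using dblE[OF d(1) assms(2)] badI(2) that by metis
qed

lemma bad_sub: "bad u \<subseteq> dbl u" by (auto simp: bad_def)

lemma finite_bad [simp]: "finite (bad u)"
  using bad_sub finite_dbl finite_subset by blast

lemma bad_priv: assumes "v \<in> bad u" "u \<in> I" shows "card (priv u) \<ge> 1"
proof -
  obtain u' where "nbI v = {u, u'}" "u \<noteq> u'" "excess v > 0" using badE[OF assms] by metis
  then obtain q where "q \<in> priv u" using excess_pos by metis
  then show ?thesis by (metis card_0_eq empty_iff finite_priv less_one not_le)
qed

text \<open>A bad neighbour forces a private one, which occupies one of the three edges at
  \<open>u\<close>.\<close>

lemma card_bad_le: assumes "u \<in> I" shows "card (bad u) \<le> 2"
proof (cases "bad u = {}")
  case False
  then have "card (priv u) \<ge> 1" using bad_priv assms by blast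
  moreover have "card (bad u) \<le> card (dbl u)" using bad_sub by (simp add: card_mono)
  ultimately show ?thesis using card_N[OF assms] by linarith
qed simp

lemma center: assumes "u \<in> I" "card (bad u) = 2"
  shows "card (priv u) = 1" "dbl u = bad u" "trp u = {}"
proof -
  have "bad u \<noteq> {}" using assms by auto
  then have p: "card (priv u) \<ge> 1" using bad_priv assms by blast
  have b: "card (bad u) \<le> card (dbl u)" using bad_sub by (simp add: card_mono)
  show "card (priv u) = 1" using p b card_N[OF assms(1)] assms by linarith
  have "card (dbl u) \<le> card (bad u)" using p b card_N[OF assms(1)] assms by linarith
  then show "dbl u = bad u" using card_seteq[OF finite_dbl bad_sub] by metis
  have "card (trp u) = 0" using p b card_N[OF assms(1)] assms by linarith
  then show "trp u = {}" by simp
qed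

text \<open>A private neighbour, a bad neighbour and \<open>f\<close> exhaust the degree of
  \<open>u\<close>.\<close>

lemma end_slot: assumes "u \<in> I" "bad u \<noteq> {}" "f \<in> (dbl u - bad u) \<union> trp u"
  shows "card (priv u) = 1" "card (bad u) = 1" "(dbl u - bad u) \<union> trp u = {f}"
proof -
  have p: "card (priv u) \<ge> 1" using bad_priv assms by blast
  have q: "card (bad u) \<ge> 1" using assms(2) by (simp add: Suc_leI card_gt_0_iff)
  let ?X = "(dbl u - bad u) \<union> trp u"
  have d: "(dbl u - bad u) \<inter> trp u = {}" by (auto simp: dbl_def trp_def)
  have "card ?X = card (dbl u) - card (bad u) + card (trp u)"
    using d bad_sub by (simp add: card_Un_disjoint card_Diff_subset)
  moreover have "card (bad u) \<le> card (dbl u)" using bad_sub by (simp add: card_mono)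
  ultimately have s: "card (priv u) + card (bad u) + card ?X \<le> 3" using card_N[OF assms(1)] by linarith
  have f: "card ?X \<ge> 1" using assms(3) by (metis One_nat_def Suc_leI card_gt_0_iff empty_iff finite_Diff finite_Un finite_dbl finite_trp)
  show "card (priv u) = 1" "card (bad u) = 1" using s p q f by linarith+
  have "card ?X = 1" using s p q f by linarith
  then show "?X = {f}" using assms(3) card_1_singletonE by (metis singletonD)
qed

text \<open>
  Here \<open>u\<close> is blocked, \<open>va\<close> and \<open>vb\<close> are its bad neighbours, \<open>a\<close> and \<open>b\<close> are their other ends in \<open>I\<close>,
  and \<open>q\<close>, \<open>qa\<close>, \<open>qb\<close> are private neighbours of \<open>u\<close>, \<open>a\<close>, \<open>b\<close>.  If the last clause failed, exchanging
  \<open>{u, a, b}\<close> for \<open>{va, vb} \<union> priv a \<union> priv b\<close> would show that \<open>u\<close> is not blocked.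
\<close>

definition config :: "'a \<Rightarrow> 'a \<Rightarrow> 'a \<Rightarrow> 'a \<Rightarrow> 'a \<Rightarrow> 'a \<Rightarrow> 'a \<Rightarrow> 'a \<Rightarrow> bool" where
  "config u a b va vb q qa qb \<longleftrightarrow> bad u = {va, vb} \<and> va \<noteq> vb \<and> nbI va = {u, a} \<and> nbI vb = {u, b}
    \<and> u \<noteq> a \<and> u \<noteq> b \<and> a \<noteq> b \<and> priv u = {q} \<and> qa \<in> priv a \<and> qb \<in> priv b \<and> E q qa \<and> E q qb
    \<and> excess va > 0 \<and> excess vb > 0
    \<and> (\<not> nonadj va (priv b) \<or> \<not> nonadj vb (priv a) \<or> \<not> apart (priv a) (priv b))"

lemma config_swap: "config u a b va vb q qa qb \<Longrightarrow> config u b a vb va q qb qa"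
  unfolding config_def using apart_commute[of "priv a" "priv b"] by (auto simp: insert_commute)

lemma blocked_config:
  assumes "u \<in> I" "blocked u" "va \<in> bad u"
  obtains a b vb q qa qb where "config u a b va vb q qa qb"
proof -
  have c2: "card (bad u) = 2" and bl: "sum w (priv u) < sum excess (bad u)"
    using assms by (auto simp: blocked_def)
  from c2 assms(3) obtain vb where vb: "bad u = {va, vb}" "va \<noteq> vb"
    by (metis card_2_iff doubleton_eq_iff insertE singletonD)
  obtain a where a: "nbI va = {u, a}" "u \<noteq> a" "excess va > 0" using badE[OF assms(3,1)] by metis
  have "vb \<in> bad u" using vb by simp
  then obtain b where b: "nbI vb = {u, b}" "u \<noteq> b" "excess vb > 0" using badE[OF _ assms(1)] by metis
  obtain q where q: "priv u = {q}" using center(1)[OF assms(1) c2] card_1_singletonE by metis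
  obtain qa where qa: "qa \<in> priv a" "E q qa" using excess_pos[OF a] q by (metis singletonD)
  obtain qb where qb: "qb \<in> priv b" "E q qb" using excess_pos[OF b] q by (metis singletonD)
  note Ea = nbI2_E[OF a(1)] and Eb = nbI2_E[OF b(1)]
  have W: "sum w (priv u) < excess va + excess vb" using bl vb by simp
  have wu: "w u = slack u + sum w (priv u)" "w a = slack a + sum w (priv a)" "w b = slack b + sum w (priv b)"
    by (simp_all add: slack_def)
  have sn: "slack u \<ge> 0" "slack a \<ge> 0" "slack b \<ge> 0" using slack_nonneg Ea Eb by auto
  have ex: "excess va = w va - slack u - slack a" "excess vb = w vb - slack u - slack b"
    using excess_eq a b by auto
  have uv: "\<not> E va vb" using Ea Eb triangle_free by blast
  have pva: "nonadj va (priv a)" by (rule nonadj_common[of a]) (use Ea priv_E in auto)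
  have pvb: "nonadj vb (priv b)" by (rule nonadj_common[of b]) (use Eb priv_E in auto)
  have notp: "va \<notin> priv x" "vb \<notin> priv x" for x using a b by (auto simp: priv_def)
  \<comment> \<open>If both bad vertices led to \<open>a\<close>, then \<open>va\<close>,
    \<open>vb\<close> and \<open>priv a\<close> would be neighbours of \<open>a\<close>, hence
    independent; trading \<open>{u, a}\<close> for them bounds the two excesses together by the
    private weight of \<open>u\<close>.\<close>
  have ab: "a \<noteq> b"
  proof
    assume ab: "a = b"
    have "sum w ({va, vb} \<union> priv a) \<le> sum w {u, a}"
    proof (rule exchange)
      show "{va, vb} \<union> priv a \<subseteq> V - I" using Ea Eb priv_sub by blast
      show "independent ({va, vb} \<union> priv a)"
        by (rule common_nb_independent[of _ a]) (use Ea Eb ab priv_E in auto)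
      show "{u, a} \<subseteq> I" using Ea by simp
      show "nbI x \<subseteq> {u, a}" if "x \<in> {va, vb} \<union> priv a" for x
        using that a b ab priv_E by auto
    qed
    moreover have "sum w ({va, vb} \<union> priv a) = w va + w vb + sum w (priv a)"
      using vb(2) notp by (simp)
    ultimately show False using W wu sn ex a(2) ab by simp
  qed
  have "\<not> nonadj va (priv b) \<or> \<not> nonadj vb (priv a) \<or> \<not> apart (priv a) (priv b)"
  proof (rule ccontr)
    assume n: "\<not> ?thesis"
    have "sum w ({va, vb} \<union> (priv a \<union> priv b)) \<le> sum w {u, a, b}"
    proof (rule exchange)
      show "{va, vb} \<union> (priv a \<union> priv b) \<subseteq> V - I" using Ea Eb priv_sub by blast
      show "independent ({va, vb} \<union> (priv a \<union> priv b))"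
        using n uv pva pvb independent_priv by (simp add: independent_simps)
      show "{u, a, b} \<subseteq> I" using Ea Eb by simp
      show "nbI x \<subseteq> {u, a, b}" if "x \<in> {va, vb} \<union> (priv a \<union> priv b)" for x
        using that a b priv_E by auto
    qed
    moreover have "sum w ({va, vb} \<union> (priv a \<union> priv b)) = w va + w vb + (sum w (priv a) + sum w (priv b))"
      using vb(2) notp priv_disj[OF ab] by (simp add: sum.union_disjoint)
    ultimately show False using W wu sn ex a(2) b(2) ab by simp
  qed
  then show ?thesis
    using that[of a b vb q qa qb] vb a b ab q qa qb unfolding config_def by blast
qed

text \<open>The decisive facts: \<open>q\<close> is saturated by \<open>u\<close>,
  \<open>qa\<close>, \<open>qb\<close>, and \<open>qa\<close>, \<open>qb\<close> are non-adjacent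
  because both are adjacent to \<open>q\<close>.\<close>

lemma config_facts: assumes "config u a b va vb q qa qb"
  shows "u \<in> I" "a \<in> I" "b \<in> I" "E q z \<Longrightarrow> z = u \<or> z = qa \<or> z = qb" "qa \<noteq> qb" "\<not> E qa qb"
    "E u va" "E u vb" "E a va" "E b vb" "E u q" "E a qa" "E b qb"
    "va \<in> bad a" "vb \<in> bad b" "va \<in> V - I" "vb \<in> V - I"
    "nbI q = {u}" "nbI qa = {a}" "nbI qb = {b}" "nbI u = {}" "nbI a = {}" "nbI b = {}"
proof -
  have c: "nbI va = {u, a}" "nbI vb = {u, b}" "a \<noteq> b" "priv u = {q}" "qa \<in> priv a" "qb \<in> priv b" "E q qa" "E q qb"
    "u \<noteq> a" "u \<noteq> b" "excess va > 0" "excess vb > 0"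
    using assms by (auto simp: config_def)
  note Ea = nbI2_E[OF c(1)] and Eb = nbI2_E[OF c(2)]
  show "u \<in> I" "a \<in> I" "b \<in> I" "E u va" "E u vb" "E a va" "E b vb" "va \<in> V - I" "vb \<in> V - I" using Ea Eb by auto
  show "E a qa" "E b qb" "nbI qa = {a}" "nbI qb = {b}" using priv_E[OF c(5)] priv_E[OF c(6)] by auto
  show "nbI u = {}" "nbI a = {}" "nbI b = {}" using Ea Eb nbI_I by auto
  have q: "E u q" "E q u" "nbI q = {u}" using c(4) priv_E[of q u] by auto
  then show "E u q" "nbI q = {u}" by simp_all
  show "qa \<noteq> qb" using c(3,5,6) priv_disj by blast
  moreover have uq: "u \<noteq> qa" "u \<noteq> qb" using c(5,6) Ea(6) priv_sub by blast+
  ultimately show "E q z \<Longrightarrow> z = u \<or> z = qa \<or> z = qb"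
    using third_nbr[of q u qa qb z] q c(7,8) uq by metis
  show "\<not> E qa qb" using c triangle_free by blast
  show "va \<in> bad a" "vb \<in> bad b" using badI(2)[OF c(1,9,11)] badI(2)[OF c(2,10,12)] by auto
qed

text \<open>Both configurations contain the edge \<open>q qa\<close>, which saturates these two
  vertices. With distinct third ends \<open>b\<close> and \<open>d\<close>, the only conflicts left
  make \<open>v\<close> adjacent to private neighbours of both, giving it degree four; with
  \<open>b = d\<close>, a triangle appears.\<close>

lemma no_adjacent_blocked:
  assumes "nbI v = {u, a}" "u \<noteq> a" "excess v > 0" "blocked u" "blocked a"
  shows False
proof -
  have uI: "u \<in> I" and aI: "a \<in> I" using nbI2_E[OF assms(1)] by auto
  have v: "v \<in> bad u" "v \<in> bad a" using badI[OF assms(1-3)] by auto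
  obtain a' b vb q qa qb where c: "config u a' b v vb q qa qb" using blocked_config[OF uI assms(4) v(1)] .
  have "a' = a" using c assms(1,2) by (auto simp: config_def doubleton_eq_iff)
  note c = c[unfolded this]
  obtain u' d v2 q' p qc where c2: "config a u' d v v2 q' p qc" using blocked_config[OF aI assms(5) v(2)] .
  have "u' = u" using c2 assms(1,2) by (auto simp: config_def doubleton_eq_iff)
  note c2 = c2[unfolded this]
  have "q' = qa" "p = q" using c c2 by (auto simp: config_def)
  note c2 = c2[unfolded this]
  note f = config_facts[OF c] and f2 = config_facts[OF c2]
  have pu: "priv u = {q}" and pa: "priv a = {qa}" using c c2 by (auto simp: config_def)
  have bd: "b = d"
  proof (rule ccontr)
    assume ne: "b \<noteq> d"
    have nb: "nbI vb = {u, b}" "nbI v2 = {a, d}" "qb \<in> priv b" "qc \<in> priv d" "a \<noteq> b" "u \<noteq> d" "u \<noteq> b" "a \<noteq> d"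
      using c c2 by (auto simp: config_def)
    have cq: "nbI q = {u}" "nbI qa = {a}" "nbI qb = {b}" "nbI qc = {d}"
      using pu pa nb(3,4) priv_E[of q u] priv_E[of qa a] priv_E[of qb b] priv_E[of qc d] by auto
    have nv: "vb \<noteq> q" "v2 \<noteq> qa" "vb \<noteq> qc" "v2 \<noteq> qb" "vb \<notin> I" "v2 \<notin> I"
      using nb cq f(16,17) f2(16,17) by (auto simp: doubleton_eq_iff)
    have "nonadj vb (priv a)" unfolding pa nonadj_def using f2(4)[of vb] nv f2(1) E_commute[of vb] by auto
    moreover have "apart (priv a) (priv b)"
    proof -
      have "x \<noteq> a \<and> x \<noteq> q \<and> x \<noteq> qc" if "x \<in> priv b" for x
        using that cq priv_E[OF that] nb(5,7) ne f2(1) nbI_I[of a] by auto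
      then show ?thesis unfolding pa using f2(4) by (auto simp: apart_def)
    qed
    ultimately have A: "\<not> nonadj v (priv b)" using c unfolding config_def by blast
    have "nonadj v2 (priv u)" unfolding pu nonadj_def using f(4)[of v2] nv f(1) E_commute[of v2] by auto
    moreover have "apart (priv u) (priv d)"
    proof -
      have "x \<noteq> u \<and> x \<noteq> qa \<and> x \<noteq> qb" if "x \<in> priv d" for x
        using that cq priv_E[OF that] nb(6,8) ne f(1) nbI_I[of u] by auto
      then show ?thesis unfolding pu using f(4) by (auto simp: apart_def)
    qed
    ultimately have B: "\<not> nonadj v (priv d)" using c2 unfolding config_def by blast
    obtain x y where xy: "x \<in> priv b" "y \<in> priv d" "E v x" "E v y" using A B unfolding nonadj_def by blast
    have "x \<noteq> y" using xy priv_disj[OF ne] by blast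
    moreover have "x \<notin> I" "y \<notin> I" using xy priv_sub by blast+
    moreover have "E v u" "E v a" using f(7,9) E_sym by auto
    ultimately show False
      using third_nbr[of v u a x y] xy(3,4) uI aI assms(2) by metis
  qed
  \<comment> \<open>Now \<open>b\<close> has two bad neighbours, so only one private neighbour,
    which is then adjacent to both \<open>q\<close> and \<open>qa\<close>.\<close>
  have ne: "vb \<noteq> v2" using c c2 by (auto simp: config_def doubleton_eq_iff)
  have "vb \<in> bad b" "v2 \<in> bad b" using f(15) f2(15) bd by auto
  then have "{vb, v2} \<subseteq> bad b" by simp
  then have "card {vb, v2} \<le> card (bad b)" by (intro card_mono) auto
  then have "card (bad b) = 2" using ne card_bad_le[OF f(3)] by simp
  then have "card (priv b) = 1" using center f(3) by blast
  then have "qb = qc" using c c2 bd by (auto simp: config_def card_1_singleton_iff)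
  then show False using c c2 triangle_free[of q qa qb] by (auto simp: config_def)
qed

section \<open>Local exchanges\<close>

definition hub :: "'a \<Rightarrow> bool" where
  "hub u \<longleftrightarrow> card (dbl u) = 3"

lemma hub: assumes "u \<in> I" "hub u"
  shows "priv u = {}" "trp u = {}" "bad u = {}" "slack u = w u"
proof -
  have "card (priv u) = 0" "card (trp u) = 0" using card_N[OF assms(1)] assms(2) by (auto simp: hub_def)
  then show p: "priv u = {}" and "trp u = {}" by simp_all
  show "bad u = {}" using bad_priv[OF _ assms(1)] p by fastforce
  show "slack u = w u" by (simp add: slack_def p)
qed

text \<open>
  The part of the cost \<open>12 * excess v\<close> of a bad vertex \<open>v\<close> borne by its end \<open>u\<close>.  The factors are
  chosen so that the two ends together bear at least \<open>12\<close> and no vertex bears more than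
  \<open>8 * sum w (priv u)\<close>; what is left of the latter is the bonus.
\<close>

definition share :: "'a \<Rightarrow> 'a \<Rightarrow> real" where
  "share u v = (if card (bad u) = 2 then if blocked u then 4 else 8
     else if card (bad (other u v)) = 2 then if blocked (other u v) then 8 else 4 else 6) * excess v"

text \<open>The amount that each neighbour in \<open>dbl u\<close> (not bad) or \<open>trp u\<close>
  may claim. A bad neighbour and the private one it forces leave room for one claimant; without bad
  neighbours a private one leaves room for two, so the 8 is halved.\<close>

definition bonus :: "'a \<Rightarrow> real" where
  "bonus u = (if bad u = {} then 4 * sum w (priv u) else 8 * sum w (priv u) - sum (share u) (bad u))"

text \<open>The factors at the two ends add up to at least 12 except for 4 + 4, which would need two
  blocked vertices with a common bad neighbour.\<close>

lemma share_pair: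
  assumes "nbI v = {u, u'}" "u \<noteq> u'" "excess v > 0"
  shows "12 * excess v \<le> share u v + share u' v"
proof -
  have o: "other u v = u'" "other u' v = u"
    using other_eq(2)[of v u u'] other_eq(2)[of v u' u] assms by (auto simp: insert_commute)
  have "\<not> (blocked u \<and> blocked u')" using no_adjacent_blocked assms by blast
  moreover have "card (bad u) = 2" if "blocked u" for u using that by (simp add: blocked_def)
  ultimately show ?thesis using assms(3) unfolding share_def o
    by (auto simp: ring_distribs(2)[symmetric])
qed

lemma excess_bad_le: assumes "v \<in> bad u" "u \<in> I" shows "excess v \<le> sum w (priv u)"
  using badE[OF assms] excess_le by metis

text \<open>With two bad neighbours, an unblocked \<open>u\<close> has its excesses jointly below
  the private weight, so factor 8 is affordable; a blocked \<open>u\<close> has only each of them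
  below it, which affords 4 + 4.\<close>

lemma share_sum: assumes "u \<in> I" shows "sum (share u) (bad u) \<le> 8 * sum w (priv u)"
proof -
  consider "bad u = {}" | v where "bad u = {v}" | v v' where "bad u = {v, v'}" "v \<noteq> v'"
  proof -
    have "card (bad u) = 0 \<or> card (bad u) = 1 \<or> card (bad u) = 2" using card_bad_le[OF assms] by linarith
    then show ?thesis using that card_1_singletonE card_2_iff by (metis card_0_eq finite_bad)
  qed
  then show ?thesis
  proof cases
    case 1 then show ?thesis using priv_nonneg by simp
  next
    case 2
    have "excess v \<le> sum w (priv u)" "excess v > 0" using excess_bad_le[OF _ assms] 2 by (auto simp: bad_def)
    moreover have "share u v \<le> 8 * excess v" using \<open>excess v > 0\<close> by (auto simp: share_def 2)
    ultimately show ?thesis using 2 by simp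
  next
    case 3
    have "excess v \<le> sum w (priv u)" "excess v' \<le> sum w (priv u)" using excess_bad_le[OF _ assms] 3 by auto
    moreover have "sum (share u) (bad u) = (if blocked u then 4 else 8) * (excess v + excess v')"
      using 3 by (simp add: share_def)
    moreover have "excess v + excess v' \<le> sum w (priv u)" if "\<not> blocked u"
      using that 3 by (simp add: blocked_def)
    ultimately show ?thesis by auto
  qed
qed

lemma bonus_nonneg: "u \<in> I \<Longrightarrow> 0 \<le> bonus u"
  using share_sum[of u] priv_nonneg[of u] by (simp add: bonus_def)

section \<open>Exchanges as pairs of sets, and their losses\<close>

definition swappable :: "'a set \<Rightarrow> 'a set \<Rightarrow> bool" where
  "swappable U S \<longleftrightarrow> U \<subseteq> I \<and> S \<subseteq> V - I \<and> independent S \<and> (\<forall>x\<in>S. nbI x \<subseteq> U)"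

lemma swappable_le: "swappable U S \<Longrightarrow> sum w S \<le> sum w U"
  unfolding swappable_def using exchange by blast

lemma swappable_finite: assumes "swappable U S" shows "finite U" "finite S"
proof -
  have "U \<subseteq> I" "S \<subseteq> V" using assms by (auto simp: swappable_def)
  then show "finite U" "finite S" using finite_subset[OF _ finite_I] finite_subV by auto
qed

text \<open>Losses are subadditive: the intersections form an exchange too, and its loss is
  nonnegative by maximality. So overlapping exchanges may be combined without discussing the
  overlap.\<close>

lemma swappable_Un:
  assumes "swappable U S" "swappable U' S'" "apart S S'"
  shows "swappable (U \<union> U') (S \<union> S')"
    and "sum w (U \<union> U') - sum w (S \<union> S') \<le> (sum w U - sum w S) + (sum w U' - sum w S')"
proof -
  show "swappable (U \<union> U') (S \<union> S')" using assms by (auto simp: swappable_def independent_Un)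
  have "swappable (U \<inter> U') (S \<inter> S')" using assms by (auto simp: swappable_def independent_def)
  then have "sum w (S \<inter> S') \<le> sum w (U \<inter> U')" by (rule swappable_le)
  moreover have fin: "finite U" "finite U'" "finite S" "finite S'"
    using swappable_finite assms by blast+
  ultimately show "sum w (U \<union> U') - sum w (S \<union> S') \<le> (sum w U - sum w S) + (sum w U' - sum w S')"
    using sum.union_inter[OF fin(1,2), of w] sum.union_inter[OF fin(3,4), of w] by linarith
qed

lemma swappable_single: "nbI z = insert u A \<Longrightarrow> swappable (nbI z) {z}"
proof -
  assume "nbI z = insert u A"
  then have "u \<in> nbI z" by simp
  then have "E z u" "u \<in> I" by (auto dest: nbI_E)
  then have "z \<in> V - I" using E_in_V I_independent by blast
  then show ?thesis using nbI_sub by (auto simp: swappable_def independent_simps)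
qed

text \<open>The loss when \<open>y\<close> and the far end of \<open>f\<close> are traded for
  \<open>f\<close> and the private neighbours of that far end.\<close>

definition gap :: "'a \<Rightarrow> 'a \<Rightarrow> real" where
  "gap y f = w y + slack (other y f) - w f"

lemma star:
  assumes y: "y \<in> I" and F: "F \<subseteq> dbl y" and U: "swappable U S" "y \<notin> U" and o: "\<And>f. f \<in> F \<Longrightarrow> other y f \<in> U"
    and FS: "apart F S"
  shows "sum w F \<le> w y + (sum w U - sum w S)"
proof -
  have *: "nbI f = {y, other y f}" if "f \<in> F" for f using other(1) F y that by blast
  have fF: "finite F" using F finite_subset[OF F] by simp
  have fS: "finite S" "finite U" using swappable_finite U(1) by blast+
  have "F \<inter> S = {}" using * U unfolding swappable_def by blast
  then have 1: "sum w (F \<union> S) = sum w F + sum w S" using fF fS by (simp add: sum.union_disjoint)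
  have "sum w (F \<union> S) \<le> sum w (insert y U)"
  proof (rule exchange)
    show "F \<union> S \<subseteq> V - I" using U F dbl_sub by (auto simp: swappable_def)
    have "independent F" by (rule common_nb_independent[of _ y]) (use F in \<open>auto simp: dbl_def\<close>)
    then show "independent (F \<union> S)" using U FS by (simp add: independent_Un swappable_def)
    show "insert y U \<subseteq> I" using U y by (auto simp: swappable_def)
    show "nbI x \<subseteq> insert y U" if "x \<in> F \<union> S" for x
      using that * o U by (auto simp: swappable_def)
  qed
  then show ?thesis using 1 U(2) fS by simp
qed

text \<open>
  An exchange of \<open>U\<close> for \<open>S\<close> that sets \<open>b\<close> free and loses at most \<open>c\<close> compared with the exchange of
  \<open>{b}\<close> for \<open>priv b\<close>.
\<close>

definition opt :: "'a \<Rightarrow> 'a set \<Rightarrow> 'a set \<Rightarrow> real \<Rightarrow> bool" where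
  "opt b U S c \<longleftrightarrow> b \<in> U \<and> swappable U S \<and> sum w U - sum w S \<le> slack b + c"

lemma opt_mono: "opt b U S c \<Longrightarrow> c \<le> d \<Longrightarrow> opt b U S d"
  by (auto simp: opt_def)

lemma opt_keep: "b \<in> I \<Longrightarrow> opt b {b} (priv b) 0"
  using priv_sub[of b] independent_priv[of b] priv_E[of _ b] by (simp add: opt_def swappable_def slack_def)

lemma opt_drop: "b \<in> I \<Longrightarrow> opt b {b} {} (sum w (priv b))"
  by (auto simp: opt_def swappable_def slack_def independent_simps)

text \<open>The private neighbours of \<open>b\<close> give way to \<open>v\<close>, while those of
  \<open>b'\<close> stay; the weight of \<open>v\<close> beyond the two slacks is what reduces the
  loss.\<close>

lemma opt_swap: assumes "nbI v = {b, b'}" "b \<noteq> b'"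
  shows "opt b {b, b'} (insert v (priv b')) (sum w (priv b) - excess v)"
proof -
  note E = nbI2_E[OF assms(1)]
  have "v \<notin> priv b'" using assms by (auto simp: priv_def)
  then have "sum w {b, b'} - sum w (insert v (priv b')) \<le> slack b + (sum w (priv b) - excess v)"
    using excess_eq[OF assms] slack_nonneg[OF E(6)] assms(2) by (simp add: slack_def)
  moreover have "swappable {b, b'} (insert v (priv b'))"
    using assms E priv_sub[of b'] independent_priv[of b'] nonadj_common[of b' v "priv b'"] priv_E[of _ b']
    by (simp add: swappable_def independent_insert)
  ultimately show ?thesis by (simp add: opt_def)
qed

text \<open>Each gap counts the removal of \<open>y\<close>, but \<open>y\<close> is removed only
  once; the surplus is \<open>w y\<close> for two gaps and, in \<open>star3\<close>,
  \<open>2 * w y\<close> for three.\<close>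

lemma star2:
  assumes "y \<in> I" "f1 \<in> dbl y" "f2 \<in> dbl y" "f1 \<noteq> f2"
    and o: "opt (other y f1) U1 S1 c1" "opt (other y f2) U2 S2 c2" and "y \<notin> U1" "y \<notin> U2"
    and S: "apart S1 S2" "apart {f1, f2} S1" "apart {f1, f2} S2"
  shows "w y \<le> gap y f1 + gap y f2 + c1 + c2"
proof -
  have s: "swappable U1 S1" "swappable U2 S2" using o by (auto simp: opt_def)
  have "sum w {f1, f2} \<le> w y + (sum w (U1 \<union> U2) - sum w (S1 \<union> S2))"
    by (rule star) (use assms swappable_Un(1)[OF s S(1)] in \<open>auto simp: opt_def apart_simps(5,6)\<close>)
  then show ?thesis using assms swappable_Un(2)[OF s S(1)] by (simp add: opt_def gap_def)
qed

lemma star3: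
  assumes y: "y \<in> I" and f: "f1 \<in> dbl y" "f2 \<in> dbl y" "f3 \<in> dbl y" "f1 \<noteq> f2" "f1 \<noteq> f3" "f2 \<noteq> f3"
    and o: "opt (other y f1) U1 S1 c1" "opt (other y f2) U2 S2 c2" "opt (other y f3) U3 S3 c3"
    and yU: "y \<notin> U1" "y \<notin> U2" "y \<notin> U3"
    and S: "apart S1 S2" "apart S1 S3" "apart S2 S3" "apart {f1, f2, f3} S1" "apart {f1, f2, f3} S2" "apart {f1, f2, f3} S3"
  shows "2 * w y \<le> gap y f1 + gap y f2 + gap y f3 + c1 + c2 + c3"
proof -
  have s: "swappable U1 S1" "swappable U2 S2" "swappable U3 S3" using o by (auto simp: opt_def)
  note s2 = swappable_Un[OF s(1,2) S(1)]
  have a: "apart (S1 \<union> S2) S3" using S by (simp add: apart_simps(5))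
  note s3 = swappable_Un[OF s2(1) s(3) a]
  have "sum w {f1, f2, f3} \<le> w y + (sum w (U1 \<union> U2 \<union> U3) - sum w (S1 \<union> S2 \<union> S3))"
    by (rule star) (use f y yU o S s3(1) in \<open>auto simp: opt_def apart_simps(5,6)\<close>)
  moreover have "sum w {f1, f2, f3} = w f1 + w f2 + w f3" using f by simp
  ultimately show ?thesis using o s2(2) s3(2) by (simp add: opt_def gap_def)
qed

text \<open>
  For an end that is not hard there is an exchange whose cost is covered by a fraction of the bonus
  and whose set \<open>S\<close> cannot interfere with other exchanges: its neighbours outside \<open>I\<close> are confined to
  the zone of \<open>b\<close>.
\<close>

definition hard :: "'a \<Rightarrow> bool" where
  "hard b \<longleftrightarrow> (\<exists>v b'. bad b = {v} \<and> nbI v = {b, b'} \<and> b \<noteq> b' \<and> card (bad b') = 1)"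

definition surround :: "'a \<Rightarrow> 'a set" where
  "surround u = bad u \<union> priv u \<union> (\<Union>v\<in>bad u. priv (other u v))"

definition zone :: "'a \<Rightarrow> 'a set" where
  "zone b = (\<Union>v\<in>bad b. if blocked (other b v) then surround (other b v) else {})"

definition slots :: "'a \<Rightarrow> 'a set" where
  "slots b = (dbl b - bad b) \<union> trp b"

lemma config_surround: assumes "config u a b va vb q qa qb"
  shows "surround u = {va, vb, q} \<union> priv a \<union> priv b"
proof -
  have "other u va = a" "other u vb = b"
    using assms other_eq(2)[of va u a] other_eq(2)[of vb u b] by (auto simp: config_def)
  then show ?thesis using assms by (auto simp: config_def surround_def)
qed

text \<open>Contains everything that \<open>opt_keep\<close>, \<open>opt_drop\<close> or
  \<open>opt_swap\<close> along a bad vertex can bring in at \<open>b\<close>.\<close>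

definition core :: "'a \<Rightarrow> 'a set" where
  "core b = priv b \<union> (\<Union>v\<in>bad b. insert v (priv (other b v)))"

text \<open>Factor 4 is chosen for \<open>star3\<close>: three such ends yield
  \<open>8 * w y\<close>, and \<open>7 * w y\<close> is needed. The condition on \<open>U\<close>
  keeps hubs out of it, since hubs have no bad neighbours.\<close>

definition safe_opt :: "'a \<Rightarrow> 'a set \<Rightarrow> 'a set \<Rightarrow> real \<Rightarrow> bool" where
  "safe_opt b U S c \<longleftrightarrow> opt b U S c \<and> 0 \<le> c \<and> 4 * c \<le> bonus b \<and> U \<subseteq> insert b {u. bad u \<noteq> {}}
    \<and> S \<subseteq> core b \<and> (\<forall>x\<in>S. \<forall>y. E x y \<longrightarrow> y \<in> I \<union> zone b)
    \<and> (S = {} \<and> zone b = {} \<and> c = sum w (priv b) \<or> 8 * c \<le> bonus b \<and> zone b \<noteq> {})"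

lemma safe_optI:
  assumes "opt b U S c" "0 \<le> c" "4 * c \<le> bonus b" "U \<subseteq> insert b {u. bad u \<noteq> {}}" "S \<subseteq> core b"
    "\<And>x y. x \<in> S \<Longrightarrow> E x y \<Longrightarrow> y \<in> I \<union> zone b"
    "S = {} \<and> zone b = {} \<and> c = sum w (priv b) \<or> 8 * c \<le> bonus b \<and> zone b \<noteq> {}"
  shows "\<exists>U S c. safe_opt b U S c"
  using assms unfolding safe_opt_def by blast

text \<open>Unless \<open>b\<close> is an end of a blocked \<open>u\<close>, its bonus pays for
  dropping all private neighbours, and \<open>S\<close> is empty. Under a blocked \<open>u\<close>
  only \<open>sum w (priv b) - excess v\<close> is affordable; then the conflict built into
  \<open>config\<close> saturates either \<open>q'\<close>, which makes keeping it safe, or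
  \<open>v\<close>, which makes swapping safe.\<close>

lemma soft_option:
  assumes b: "b \<in> I" "\<not> hard b" "slots b \<noteq> {}"
  shows "\<exists>U S c. safe_opt b U S c"
proof (cases "bad b = {}")
  case True
  then show ?thesis by (intro safe_optI[OF opt_drop[OF b(1)] priv_nonneg]) (simp_all add: bonus_def zone_def)
next
  case False
  have e: "card (priv b) = 1" "card (bad b) = 1" using end_slot[OF b(1) False] b(3) by (auto simp: slots_def)
  obtain v where v: "bad b = {v}" using e(2) card_1_singletonE by metis
  then have vb: "v \<in> bad b" by simp
  obtain u where u: "nbI v = {b, u}" "b \<noteq> u" "other b v = u" "v \<in> bad u" "excess v > 0" using badE[OF vb b(1)] .
  have uI: "u \<in> I" using nbI2_E(7)[OF u(1)] .
  have "card (bad u) \<noteq> 1" using b(2) v u unfolding hard_def by blast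
  moreover have "card (bad u) \<noteq> 0" using u(4) by auto
  ultimately have c2: "card (bad u) = 2" using card_bad_le[OF uI] by linarith
  \<comment> \<open>The other end of \<open>v\<close> has two bad neighbours: it bears 8 if
    unblocked, leaving 4 to \<open>b\<close>, and 4 if blocked, leaving 8.\<close>
  have sh: "sum (share b) (bad b) = (if blocked u then 8 else 4) * excess v"
    using v e(2) c2 u by (simp add: share_def)
  have ele: "excess v \<le> sum w (priv b)" using excess_le[OF u(1,2)] .
  show ?thesis
  proof (cases "blocked u")
    case False
    then show ?thesis using v u sh ele by (intro safe_optI[OF opt_drop[OF b(1)] priv_nonneg]) (simp_all add: bonus_def zone_def)
  next
    case True
    obtain b' a va q q' qa where c: "config u b' a v va q q' qa" using blocked_config[OF uI True u(4)] .
    have "b' = b" using c u(1,2) by (auto simp: config_def doubleton_eq_iff)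
    note c = config_swap[OF c[unfolded this]]
    have pb: "priv b = {q'}" using c e(1) by (auto simp: config_def card_1_singleton_iff)
    note f = config_facts[OF c]
    have D: "zone b = {va, v, q} \<union> priv a \<union> priv b" using v u(3) True config_surround[OF c] by (simp add: zone_def)
    have cost: "0 \<le> sum w (priv b) - excess v" using ele by simp
    have bon: "8 * (sum w (priv b) - excess v) \<le> bonus b" using v sh True by (simp add: bonus_def)
    have bon4: "4 * (sum w (priv b) - excess v) \<le> bonus b"
      by (rule order_trans[OF _ bon]) (use cost in simp)
    have "\<not> nonadj va (priv b) \<or> \<not> nonadj v (priv a) \<or> \<not> apart (priv a) (priv b)"
      using c by (simp add: config_def)
    then consider t where "E q' t" "t \<in> insert va (priv a)" | x where "E v x" "x \<in> priv a"
      unfolding pb nonadj_def apart_def using E_sym by auto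
    then show ?thesis
    proof cases
      case 1
      have t: "nbI t = {u, a} \<or> nbI t = {a}" using 1 priv_E[of t a] c by (auto simp: config_def)
      have "b \<noteq> q" "b \<noteq> t" using t f(18,23) by auto
      moreover have "q \<noteq> t" using t f(18) c by (auto simp: config_def)
      moreover note calculation
      moreover have "E q' b" "E q' q" using c E_sym f by (auto simp: config_def)
      ultimately have "y = b \<or> y = q \<or> y = t" if "E q' y" for y using third_nbr[of q' b q t y] that 1 by blast
      then have N: "y = b \<or> y = q \<or> y = t" if "E q' y" for y using that by blast
      show ?thesis
      proof (rule safe_optI[OF opt_mono[OF opt_keep[OF b(1)] cost] cost])
        show "4 * (sum w (priv b) - excess v) \<le> bonus b" using bon4 .
        show "{b} \<subseteq> insert b {u. bad u \<noteq> {}}" by auto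
        show "priv b \<subseteq> core b" by (simp add: core_def)
        show "priv b = {} \<and> zone b = {} \<and> sum w (priv b) - excess v = sum w (priv b) \<or>
          8 * (sum w (priv b) - excess v) \<le> bonus b \<and> zone b \<noteq> {}" using bon by (simp add: D)
        show "y \<in> I \<union> zone b" if "x \<in> priv b" "E x y" for x y
          using N[of y] that 1(2) pb b(1) unfolding D by auto
      qed
    next
      case 2
      have pu: "priv u = {q}" using c by (simp add: config_def)
      have "u \<noteq> x" "b \<noteq> x" using priv_E[OF 2(2)] f(21,23) by auto
      moreover have "E v u" "E v b" using f E_sym by auto
      ultimately have Nv: "y = u \<or> y = b \<or> y = x" if "E v y" for y using third_nbr[of v u b x y] that 2 u(2) by blast
      show ?thesis
      proof (rule safe_optI[OF opt_swap[OF u(1,2)] cost])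
        show "4 * (sum w (priv b) - excess v) \<le> bonus b" using bon4 .
        show "{b, u} \<subseteq> insert b {u. bad u \<noteq> {}}" using u(4) by auto
        show "insert v (priv u) \<subseteq> core b" using v u(3) by (auto simp: core_def)
        show "insert v (priv u) = {} \<and> zone b = {} \<and> sum w (priv b) - excess v = sum w (priv b) \<or>
          8 * (sum w (priv b) - excess v) \<le> bonus b \<and> zone b \<noteq> {}" using bon by (simp add: D)
        show "y \<in> I \<union> zone b" if "x' \<in> insert v (priv u)" "E x' y" for x' y
        proof -
          have "x' = v \<or> x' = q" using that(1) pu by simp
          then show ?thesis
          proof
            assume "x' = v" then show ?thesis using Nv that 2 f D by auto
          next
            assume "x' = q" then show ?thesis using f(4)[of y] that c D f by (auto simp: config_def)
          qed
        qed
      qed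
    qed
  qed
qed

section \<open>Interaction of exchanges\<close>

definition twins :: "'a \<Rightarrow> 'a \<Rightarrow> bool" where
  "twins b b' \<longleftrightarrow> (\<exists>v\<in>bad b. \<exists>v'\<in>bad b'. other b v = other b' v' \<and> blocked (other b v))"

lemma blocked_end:
  assumes b: "b \<in> I" "slots b \<noteq> {}" and v: "v \<in> bad b" "blocked (other b v)"
  obtains a va q qa qb where "config (other b v) a b va v q qa qb" "bad b = {v}" "priv b = {qb}"
    "zone b = {va, v, q} \<union> priv a \<union> {qb}" "core b = {v, q, qb}" "bonus b = 8 * (w qb - excess v)"
proof -
  have e: "card (priv b) = 1" "card (bad b) = 1" using end_slot[OF b(1)] v(1) b(2) by (auto simp: slots_def)
  have bv: "bad b = {v}" using e(2) v(1) by (metis card_1_singletonE singletonD)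
  obtain u where u: "nbI v = {b, u}" "b \<noteq> u" "other b v = u" "v \<in> bad u" using badE[OF v(1) b(1)] .
  have uI: "u \<in> I" using nbI2_E(7)[OF u(1)] .
  have bu: "blocked u" using v(2) u(3) by simp
  obtain b' a va q q' qa where c: "config u b' a v va q q' qa" using blocked_config[OF uI bu u(4)] .
  have "b' = b" using c u(1,2) by (auto simp: config_def doubleton_eq_iff)
  note c = config_swap[OF c[unfolded this]]
  have pb: "priv b = {q'}" using c e(1) by (auto simp: config_def card_1_singleton_iff)
  have D: "zone b = {va, v, q} \<union> priv a \<union> {q'}" using bv u(3) bu config_surround[OF c] pb by (simp add: zone_def)
  have C: "core b = {v, q, q'}" using bv u(3) pb c by (auto simp: core_def config_def)
  have "share b v = 8 * excess v" using e(2) u(3) bu by (simp add: share_def blocked_def)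
  then have "bonus b = 8 * (w q' - excess v)" using bv pb by (simp add: bonus_def)
  then show ?thesis using that[of a va q qa q'] c bv pb D C u(3) by simp
qed

lemma zone_nonempty: assumes "zone b \<noteq> {}" obtains v where "v \<in> bad b" "blocked (other b v)"
  using assms that unfolding zone_def by (auto split: if_splits)

lemma center_slots: assumes "u \<in> I" "card (bad u) = 2" shows "slots u = {}"
  using center[OF assms] by (simp add: slots_def)

lemma end_card: assumes "b \<in> I" "slots b \<noteq> {}" shows "card (bad b) \<noteq> 2"
  using center_slots assms by blast

lemma blocked_card: "blocked u \<Longrightarrow> card (bad u) = 2"
  by (simp add: blocked_def)

text \<open>The zone of \<open>b\<close> consists of private neighbours of \<open>u\<close>,
  \<open>a\<close>, \<open>b\<close> and of bad vertices, where \<open>u\<close> is the blocked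
  centre and \<open>a\<close> its other end. Having a slot, \<open>b'\<close> is not
  \<open>u\<close>; it is not \<open>b\<close>; and \<open>b' = a\<close> would make it a
  twin.\<close>

lemma priv_zone:
  assumes b: "b \<in> I" "slots b \<noteq> {}" and b': "b' \<in> I" "slots b' \<noteq> {}" "b \<noteq> b'" "\<not> twins b b'"
  shows "priv b' \<inter> zone b = {}"
proof (rule ccontr)
  assume "\<not> ?thesis"
  then obtain x where x: "x \<in> priv b'" "x \<in> zone b" by blast
  then obtain v where v: "v \<in> bad b" "blocked (other b v)" using zone_nonempty by blast
  define u where "u = other b v"
  obtain a va q qa qb where c: "config u a b va v q qa qb" "zone b = {va, v, q} \<union> priv a \<union> {qb}"
    using blocked_end[OF b v] unfolding u_def by metis
  note f = config_facts[OF c(1)]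
  have nx: "nbI x = {b'}" using priv_E x(1) by blast
  have nv: "nbI va = {u, a}" "nbI v = {u, b}" "u \<noteq> a" "u \<noteq> b" using c(1) by (auto simp: config_def)
  have "x \<noteq> va" "x \<noteq> v" "x \<noteq> qb" using nx nv f(20) b'(3) by auto
  moreover have "x \<noteq> q"
  proof
    assume "x = q"
    then have "b' = u" using nx f(18) by auto
    then show False using end_card[OF b'(1,2)] blocked_card v(2) u_def by simp
  qed
  ultimately have "x \<in> priv a" using x(2) c(2) by auto
  then have "b' = a" using nx priv_E by force
  have "va \<in> bad b'" using f(14) \<open>b' = a\<close> by simp
  moreover have "nbI va = {b', u}" "b' \<noteq> u" using nv \<open>b' = a\<close> by auto
  then have "other b' va = u" using other_eq(2) by blast
  ultimately have "twins b b'" using v u_def unfolding twins_def by metis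
  then show False using b' by simp
qed

lemma core_zone:
  assumes b: "b \<in> I" "slots b \<noteq> {}" and b': "b' \<in> I" "slots b' \<noteq> {}" "b \<noteq> b'" "\<not> twins b b'" and d: "zone b' \<noteq> {}"
  shows "core b' \<inter> zone b = {}"
proof (rule ccontr)
  assume "\<not> ?thesis"
  then obtain x where x: "x \<in> core b'" "x \<in> zone b" by blast
  then obtain v where v: "v \<in> bad b" "blocked (other b v)" using zone_nonempty by blast
  define u where "u = other b v"
  obtain a va q qa qb where c: "config u a b va v q qa qb" "zone b = {va, v, q} \<union> priv a \<union> {qb}"
    using blocked_end[OF b v] unfolding u_def by metis
  obtain v' where v': "v' \<in> bad b'" "blocked (other b' v')" using zone_nonempty[OF d] .
  define u' where "u' = other b' v'"
  obtain a' va' q' qa' qb' where c': "config u' a' b' va' v' q' qa' qb'" "core b' = {v', q', qb'}" "priv b' = {qb'}"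
    using blocked_end[OF b'(1,2) v'] unfolding u'_def by metis
  note f = config_facts[OF c(1)] and f' = config_facts[OF c'(1)]
  have bl: "blocked u" "blocked u'" using v v' u_def u'_def by auto
  have uu: "u \<noteq> u'" using b'(4) v v' u_def u'_def unfolding twins_def by metis
  have bu: "b \<noteq> u'" "b' \<noteq> u" using bl blocked_card end_card b b' by metis+
  have nv: "nbI va = {u, a}" "nbI v = {u, b}" "u \<noteq> a" "excess va > 0" using c(1) by (auto simp: config_def)
  have nv': "nbI v' = {u', b'}" "u' \<noteq> b'" using c'(1) by (auto simp: config_def)
  consider "x = v'" | "x = q'" | "x \<in> priv b'" using x(1) c'(2,3) by auto
  then show False
  proof cases
    case 1
    have "x \<noteq> q" "x \<noteq> qb" "x \<notin> priv a" using 1 nv' f(18,20) priv_E[of x a] by auto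
    moreover have "x \<noteq> va" "x \<noteq> v" using 1 nv nv' uu bu by (auto simp: doubleton_eq_iff)
    ultimately show False using x(2) c(2) by auto
  next
    \<comment> \<open>A private neighbour of the second centre \<open>u'\<close> inside the zone
      would force \<open>a = u'\<close>, so two blocked vertices would share
      \<open>va\<close>.\<close>
    case 2
    have nx: "nbI x = {u'}" using f'(18) 2 by simp
    have "x \<noteq> q" "x \<noteq> qb" using nx f(18,20) uu bu by auto
    moreover have "x \<noteq> va" "x \<noteq> v" using nx nv uu by auto
    ultimately have "x \<in> priv a" using x(2) c(2) by auto
    then have "a = u'" using nx priv_E[of x a] by auto
    then show False using no_adjacent_blocked[OF nv(1,3,4)] bl by simp
  next
    case 3
    then show False using priv_zone[OF b b'] x(2) by blast
  qed
qed

text \<open>\<open>safe_opt\<close> stripped of its cost conditions, so that the empty set qualifies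
  at a hard end as well.\<close>

definition secure :: "'a \<Rightarrow> 'a set \<Rightarrow> bool" where
  "secure b S \<longleftrightarrow> S \<subseteq> core b - I \<and> (\<forall>x\<in>S. \<forall>y. E x y \<longrightarrow> y \<in> I \<union> zone b) \<and> (S = {} \<or> zone b \<noteq> {})"

lemma safe_opt_secure: "safe_opt b U S c \<Longrightarrow> secure b S"
  by (auto simp: safe_opt_def secure_def opt_def swappable_def)

lemma secure_apart:
  assumes "b \<in> I" "slots b \<noteq> {}" "b' \<in> I" "slots b' \<noteq> {}" "b \<noteq> b' \<or> zone b = {}" "\<not> twins b b'"
    and o: "secure b S"
  shows "apart S (priv b')" "secure b' S' \<Longrightarrow> apart S S'"
proof -
  have *: "apart S T" if "T \<inter> I = {}" "T \<inter> zone b = {}" for T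
    using that o unfolding secure_def apart_def by blast
  show "apart S (priv b')"
  proof (cases "zone b = {}")
    case True then show ?thesis using * priv_sub[of b'] by blast
  next
    case False
    then show ?thesis using priv_zone[of b b'] priv_sub[of b'] assms by (intro *) auto
  qed
  show "apart S S'" if o': "secure b' S'"
  proof (cases "zone b = {} \<or> zone b' = {}")
    case True
    then have "S' \<inter> zone b = {}" "S' \<inter> I = {}" using o' by (auto simp: secure_def)
    then show ?thesis using * by blast
  next
    case False
    then have "core b' \<inter> zone b = {}" using core_zone assms by blast
    then show ?thesis using o' by (intro *) (auto simp: secure_def)
  qed
qed

text \<open>
  The hub \<open>y\<close> is joined to \<open>b \<in> I\<close> through the common neighbour \<open>f\<close>.
\<close>

definition spoke :: "'a \<Rightarrow> 'a \<Rightarrow> 'a \<Rightarrow> bool" where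
  "spoke y f b \<longleftrightarrow> y \<in> I \<and> hub y \<and> f \<in> dbl y \<and> other y f = b"

lemma spoke: assumes "spoke y f b"
  shows "nbI f = {y, b}" "y \<noteq> b" "b \<in> I" "y \<in> I" "f \<in> slots b" "excess f \<le> 0" "E y f" "E f y" "E b f" "E f b" "f \<notin> I"
    "other b f = y" "bad y = {}" "f \<in> V" "f \<in> dbl b" "f \<in> dbl y" "other y f = b" "priv y = {}" "slack y = w y"
proof -
  have a: "y \<in> I" "hub y" "f \<in> dbl y" "other y f = b" using assms by (auto simp: spoke_def)
  note o = other[OF a(3,1), unfolded a(4)]
  note E = nbI2_E[OF o(1)]
  show "nbI f = {y, b}" "y \<noteq> b" "b \<in> I" "y \<in> I" "E y f" "E f y" "E b f" "E f b" "f \<notin> I" "other b f = y" "f \<in> V" "f \<in> dbl b"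
     "f \<in> dbl y" "other y f = b" "priv y = {}" "slack y = w y"
    using o E a hub by auto
  show bady: "bad y = {}" using hub a by blast
  show ex: "excess f \<le> 0"
  proof (rule ccontr)
    assume "\<not> ?thesis"
    then have "f \<in> bad y" using badI(1)[OF o(1,2)] by simp
    then show False using bady by simp
  qed
  then show "f \<in> slots b" using o(4) by (auto simp: slots_def bad_def)
qed

text \<open>Keeps out of every zone both the vertices \<open>f\<close> of a spoke, which have no
  positive excess, and the vertices with three neighbours in \<open>I\<close>.\<close>

lemma zone_cases: assumes "b \<in> I" "slots b \<noteq> {}" "x \<in> zone b" shows "excess x > 0 \<and> card (nbI x) = 2 \<or> card (nbI x) = 1"
proof -
  obtain v where v: "v \<in> bad b" "blocked (other b v)" using zone_nonempty assms(3) by blast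
  obtain a va q qa qb where c: "config (other b v) a b va v q qa qb" "zone b = {va, v, q} \<union> priv a \<union> {qb}"
    using blocked_end[OF assms(1,2) v] by metis
  note f = config_facts[OF c(1)]
  have "va \<in> bad (other b v)" "v \<in> bad (other b v)" using c(1) by (auto simp: config_def)
  then show ?thesis using assms(3) c(2) f(18,20) priv_E[of x a] by (auto simp: bad_def dbl_def)
qed

lemma spoke_soft: assumes "spoke y f b" "safe_opt b' U S c" "b' \<in> I" "slots b' \<noteq> {}"
  shows "nonadj f S"
proof -
  have "f \<notin> I \<union> zone b'" using zone_cases[OF assms(3,4), of f] spoke[OF assms(1)] by auto
  then show ?thesis using assms(2) E_sym unfolding safe_opt_def nonadj_def by blast
qed

text \<open>By \<open>end_slot\<close>, a bad neighbour of \<open>b\<close> leaves room for only one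
  of \<open>f\<close>, \<open>f'\<close>.\<close>

lemma spoke_inj: assumes "spoke y f b" "spoke y' f' b" "f \<noteq> f'" shows "bad b = {}" "zone b = {}" "\<not> hard b"
proof -
  show "bad b = {}"
  proof (rule ccontr)
    assume "bad b \<noteq> {}"
    then have "slots b = {f}" "slots b = {f'}"
      using end_slot(3)[of b f] end_slot(3)[of b f'] spoke(3,5)[OF assms(1)] spoke(5)[OF assms(2)] by (auto simp: slots_def)
    then show False using assms(3) by simp
  qed
  then show "zone b = {}" "\<not> hard b" by (simp_all add: zone_def hard_def)
qed

lemma spokes_soft_apart:
  assumes i: "spoke y f b" "spoke y' f' b'" "f \<noteq> f'" "\<not> twins b b'" and o: "safe_opt b U S c"
  shows "apart S (priv b')" "safe_opt b' U' S' c' \<Longrightarrow> apart S S'"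
proof -
  have "b \<noteq> b' \<or> zone b = {}" using spoke_inj(2)[OF i(1) _ i(3), of y'] i(2) by blast
  moreover have "slots b \<noteq> {}" "slots b' \<noteq> {}" "b \<in> I" "b' \<in> I" using spoke i by blast+
  ultimately show "apart S (priv b')" "safe_opt b' U' S' c' \<Longrightarrow> apart S S'"
    using secure_apart[of b b' S] safe_opt_secure i(4) o by blast+
qed

lemma spoke_U: assumes "spoke y f b" "safe_opt b U S c" shows "y \<notin> U"
  using spoke[OF assms(1)] assms(2) by (auto simp: safe_opt_def)

lemma gap_nonneg: assumes "spoke y f b" shows "0 \<le> gap y f"
proof -
  note i = spoke[OF assms]
  have o: "opt b {b} (priv b) 0" by (rule opt_keep[OF i(3)])
  have "sum w {f} \<le> w y + (sum w {b} - sum w (priv b))"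
    by (rule star[OF i(4)]) (use i o nonadj_common[of b f "priv b"] priv_E[of _ b] in \<open>auto simp: opt_def apart_simps\<close>)
  then show ?thesis by (simp add: gap_def i slack_def)
qed

definition hard_end :: "'a \<Rightarrow> 'a \<Rightarrow> 'a \<Rightarrow> 'a \<Rightarrow> 'a \<Rightarrow> bool" where
  "hard_end b v b' q q' \<longleftrightarrow> b \<in> I \<and> bad b = {v} \<and> nbI v = {b, b'} \<and> b \<noteq> b' \<and> card (bad b') = 1 \<and> priv b = {q} \<and> q' \<in> priv b' \<and> E q q'
     \<and> bonus b = 8 * w q - 6 * excess v \<and> 0 < excess v \<and> excess v \<le> w q"

lemma hardE: assumes "b \<in> I" "hard b" "slots b \<noteq> {}"
  obtains v b' q q' where "hard_end b v b' q q'"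
proof -
  obtain v b' where v: "bad b = {v}" "nbI v = {b, b'}" "b \<noteq> b'" "card (bad b') = 1"
    using assms(2) unfolding hard_def by blast
  have "card (priv b) = 1" using end_slot(1)[OF assms(1)] v(1) assms(3) by (auto simp: slots_def)
  then obtain q where q: "priv b = {q}" using card_1_singletonE by metis
  have ex: "excess v > 0" using v(1) by (auto simp: bad_def)
  obtain q' where q': "q' \<in> priv b'" "E q q'" using excess_pos[OF v(2,3) ex] q by (metis singletonD)
  have "other b v = b'" using other_eq v by blast
  then have "share b v = 6 * excess v" using v by (simp add: share_def)
  then have "bonus b = 8 * w q - 6 * excess v" using v(1) q by (simp add: bonus_def)
  then show ?thesis using that[of v b' q q'] assms v q q' ex excess_le[OF v(2,3)] by (simp add: hard_end_def)
qed

text \<open>Two neighbours of \<open>q\<close> are known, \<open>b\<close> and \<open>q'\<close>, so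
  at most one further vertex can conflict with it. Since the excess is at most \<open>w q\<close>,
  the bonus pays twice for dropping \<open>q\<close> and eight times for swapping it against
  \<open>v\<close>.\<close>

lemma hard_end: assumes "hard_end b v b' q q'"
  shows "nbI q = {b}" "nbI q' = {b'}" "E b q" "E q b" "b' \<in> I" "E b v" "E b' v" "v \<in> V - I" "q \<in> V - I"
    "E q x \<Longrightarrow> E q z \<Longrightarrow> x \<notin> {b, q'} \<Longrightarrow> z \<notin> {b, q'} \<Longrightarrow> x = z"
    "2 * w q \<le> bonus b" "8 * (w q - excess v) \<le> bonus b" "v \<in> bad b'" "bad b' = {v}"
proof -
  have h: "b \<in> I" "bad b = {v}" "nbI v = {b, b'}" "b \<noteq> b'" "priv b = {q}" "q' \<in> priv b'" "E q q'"
     "bonus b = 8 * w q - 6 * excess v" "0 < excess v" "excess v \<le> w q" "card (bad b') = 1"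
    using assms by (auto simp: hard_end_def)
  note E = nbI2_E[OF h(3)]
  show "E b v" "E b' v" "v \<in> V - I" "b' \<in> I" using E by auto
  show q: "nbI q = {b}" "E b q" "E q b" using priv_E[of q b] h(5) by auto
  show q': "nbI q' = {b'}" using priv_E[of q' b'] h(6) by auto
  show "q \<in> V - I" using priv_sub h(5) by blast
  show "2 * w q \<le> bonus b" "8 * (w q - excess v) \<le> bonus b" using h by auto
  show vb: "v \<in> bad b'" using badI(2) h by blast
  then show "bad b' = {v}" using h(11) by (metis card_1_singletonE singletonD)
  have "b \<noteq> q'" using nbI_I[OF h(1)] q' by auto
  then show "E q x \<Longrightarrow> E q z \<Longrightarrow> x \<notin> {b, q'} \<Longrightarrow> z \<notin> {b, q'} \<Longrightarrow> x = z"
    using third_nbr[of q b q' x z] q h(7) by blast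
qed

lemma spoke_sat: assumes "spoke y f b" "E f x" "E f z" "x \<notin> I" "z \<notin> I" shows "z = x"
  using third_nbr[of f y b x z] spoke[OF assms(1)] assms by blast

section \<open>Credit at a hub\<close>

lemma spoke_star2:
  assumes i: "spoke y f1 b1" "spoke y f2 b2" and ne: "f1 \<noteq> f2"
    and o: "opt b1 U1 S1 c1" "opt b2 U2 S2 c2" and U: "y \<notin> U1" "y \<notin> U2"
    and S: "apart S1 S2" "nonadj f1 S1" "nonadj f2 S1" "nonadj f1 S2" "nonadj f2 S2"
  shows "w y \<le> gap y f1 + gap y f2 + c1 + c2"
proof -
  note j = spoke(4,16,17)[OF i(1)] spoke(16,17)[OF i(2)]
  show ?thesis
    by (rule star2[OF j(1,2,4) ne _ _ U S(1)]) (use j(3,5) o S in \<open>simp_all add: apart_simps\<close>)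
qed

lemma spoke_star3:
  assumes i: "spoke y f1 b1" "spoke y f2 b2" "spoke y f3 b3" and ne: "f1 \<noteq> f2" "f1 \<noteq> f3" "f2 \<noteq> f3"
    and o: "opt b1 U1 S1 c1" "opt b2 U2 S2 c2" "opt b3 U3 S3 c3" and U: "y \<notin> U1" "y \<notin> U2" "y \<notin> U3"
    and S: "apart S1 S2" "apart S1 S3" "apart S2 S3" "nonadj f1 S1" "nonadj f2 S1" "nonadj f3 S1"
      "nonadj f1 S2" "nonadj f2 S2" "nonadj f3 S2" "nonadj f1 S3" "nonadj f2 S3" "nonadj f3 S3"
  shows "2 * w y \<le> gap y f1 + gap y f2 + gap y f3 + c1 + c2 + c3"
proof -
  note j = spoke(4,16,17)[OF i(1)] spoke(16,17)[OF i(2)] spoke(16,17)[OF i(3)]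
  show ?thesis
    by (rule star3[OF j(1,2,4,6) ne _ _ _ U S(1-3)]) (use j(3,5,7) o S in \<open>simp_all add: apart_simps\<close>)
qed

text \<open>
  A hub pays \<open>12 * w y - credit y f\<close> to \<open>f\<close> and has no private neighbours, so it stays within its
  budget iff its three credits sum to at least \<open>7 * w y\<close>.
\<close>

definition base_credit :: "'a \<Rightarrow> 'a \<Rightarrow> real" where
  "base_credit y f = (if hub (other y f) then 5 * gap y f else 12 * gap y f + bonus (other y f))"

text \<open>A far end that is not a hub leaves all of \<open>12 * gap y f\<close> and its bonus to
  \<open>y\<close>. Two hubs must share \<open>12 * gap y f\<close>: 5 is guaranteed to each, so
  that one of them may rise to 7.\<close>

lemma base_credit_ge: assumes "spoke y f b" shows "5 * gap y f \<le> base_credit y f" "0 \<le> gap y f"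
  using gap_nonneg[OF assms] bonus_nonneg[OF spoke(3)[OF assms]] spoke(17)[OF assms] by (auto simp: base_credit_def)

lemma base_credit_soft: assumes "spoke y f b" "safe_opt b U S c" shows "5 * gap y f + 4 * c \<le> base_credit y f" "0 \<le> c" "0 \<le> gap y f"
proof -
  have "4 * c \<le> bonus b" "0 \<le> gap y f" "other y f = b" using assms gap_nonneg spoke by (auto simp: safe_opt_def)
  moreover have "bonus b = 0" if "hub b" using hub[OF spoke(3)[OF assms(1)] that] by (simp add: bonus_def)
  ultimately show "5 * gap y f + 4 * c \<le> base_credit y f" by (auto simp: base_credit_def)
  show "0 \<le> c" "0 \<le> gap y f" using assms gap_nonneg by (auto simp: safe_opt_def)
qed

lemma base_credit_hard: assumes "spoke y f b" "hard_end b v b' q q'" shows "base_credit y f = 12 * gap y f + bonus b"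
proof -
  have "bad b \<noteq> {}" using assms by (auto simp: hard_end_def)
  then have "\<not> hub b" using hub[OF spoke(3)[OF assms(1)]] by blast
  then show ?thesis using spoke(17)[OF assms(1)] by (simp add: base_credit_def)
qed

lemma base_credit_hard_ge: assumes "spoke y f b" "hard_end b v b' q q'"
  shows "12 * gap y f + 2 * w q \<le> base_credit y f" "12 * gap y f + 8 * w q - 8 * excess v \<le> base_credit y f" "0 \<le> w q" "0 \<le> gap y f" "0 \<le> w q - excess v"
  using base_credit_hard[OF assms] hard_end(11,12)[OF assms(2)] assms(2) gap_nonneg[OF assms(1)] by (auto simp: hard_end_def)

lemma hard_end_opts: assumes "spoke y f b" "hard_end b v b' q q'"
  shows "opt b {b} {q} 0" "opt b {b} {} (w q)" "opt b {b, b'} (insert v (priv b')) (w q - excess v)" "y \<notin> {b}" "y \<notin> {b, b'}" "nonadj f {q}"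
proof -
  have h: "b \<in> I" "priv b = {q}" "nbI v = {b, b'}" "b \<noteq> b'" using assms by (auto simp: hard_end_def)
  show "opt b {b} {q} 0" "opt b {b} {} (w q)" "opt b {b, b'} (insert v (priv b')) (w q - excess v)"
    using opt_keep[OF h(1)] opt_drop[OF h(1)] opt_swap[OF h(3,4)] h(2) by simp_all
  show "y \<notin> {b}" using spoke(2)[OF assms(1)] by simp
  then show "y \<notin> {b, b'}" using spoke(13)[OF assms(1)] hard_end(13)[OF assms(2)] by auto
  show "nonadj f {q}" by (rule nonadj_common[of b]) (use spoke[OF assms(1)] hard_end[OF assms(2)] in auto)
qed

lemma keep_opts: assumes "spoke y f b"
  shows "opt b {b} (priv b) 0" "y \<notin> {b}" "nonadj f (priv b)"
  using opt_keep spoke[OF assms] nonadj_common[of b f "priv b"] priv_E by auto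

lemma spoke_sat_priv: assumes "spoke y f b" "E f x" "x \<in> priv d" "d \<noteq> b'" shows "nonadj f (priv b')"
  unfolding nonadj_def using spoke_sat[OF assms(1,2)] assms(3,4) priv_sub priv_disj by blast

lemma hard_end_sat_priv: assumes "hard_end b v b' q q'" "E q z" "z \<notin> {b, q'}" "d \<noteq> b'" "z \<notin> priv d" shows "nonadj q (priv d)"
proof -
  have "q' \<notin> priv d" using hard_end(2)[OF assms(1)] assms(4) by (auto simp: priv_def)
  moreover have "b \<notin> priv d" using assms(1) priv_sub by (auto simp: hard_end_def)
  ultimately show ?thesis unfolding nonadj_def using hard_end(10)[OF assms(1,2)] assms(3,5) by blast
qed

lemma spoke_hard_end_ne: assumes "spoke y f b" "hard_end d v d' q q'" shows "f \<notin> {d, q'}" "f \<noteq> q" "f \<noteq> v"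
    "f \<notin> priv e"
proof -
  note i = spoke[OF assms(1)]
  have "card (nbI f) = 2" using i by simp
  then show "f \<notin> {d, q'}" "f \<noteq> q" using hard_end[OF assms(2)] i(11) assms(2) by (auto simp: hard_end_def)
  show "f \<noteq> v" using i(6) assms(2) by (auto simp: hard_end_def)
  show "f \<notin> priv e" using i by (auto simp: priv_def)
qed

lemma hard_end_unique: assumes "spoke y f b" "spoke y f' b'" "hard_end d v d' q q'" "E q f" "f \<noteq> f'" shows "\<not> E q f'"
  using hard_end(10)[OF assms(3,4)] spoke_hard_end_ne(1)[OF _ assms(3)] assms by blast

lemma hard_end_not_twins: assumes "hard_end b v b' q q'" shows "\<not> twins b d" "\<not> twins d b"
proof -
  have "other b v = b'" using assms other_eq(2) by (auto simp: hard_end_def)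
  then have "\<not> blocked (other b x)" if "x \<in> bad b" for x
    using that assms blocked_card[of b'] by (auto simp: hard_end_def)
  then show "\<not> twins b d" "\<not> twins d b" unfolding twins_def by metis+
qed

lemma twins_sym: "twins b b' \<Longrightarrow> twins b' b"
  unfolding twins_def by metis

lemma soft_not_partner: assumes "\<not> hard d" "hard_end b v b' q q'" shows "d \<noteq> b'"
proof
  assume "d = b'"
  have "bad b' = {v}" "nbI v = {b', b}" "b' \<noteq> b" "card (bad b) = 1"
    using hard_end(14)[OF assms(2)] assms(2) by (auto simp: hard_end_def)
  then have "hard b'" unfolding hard_def by blast
  then show False using assms \<open>d = b'\<close> by simp
qed

lemma spoke_hard_end_ne_b: assumes "spoke y f b" "spoke y f' b'" "f \<noteq> f'" "hard_end b' v d q q'" shows "b \<noteq> b'"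
  using spoke_inj(1)[of y f b y f'] assms by (auto simp: hard_end_def)

lemma spoke_safe_opt: assumes "spoke y f b" "spoke y' f' b'" "safe_opt b' U S c"
  shows "nonadj f S"
  using spoke_soft[OF assms(1,3)] spoke(3,5)[OF assms(2)] by blast

context
  fixes y f1 f2 f3 b1 b2 b3
  assumes i1: "spoke y f1 b1" and i2: "spoke y f2 b2" and i3: "spoke y f3 b3"
    and ne: "f1 \<noteq> f2" "f1 \<noteq> f3" "f2 \<noteq> f3"
begin

lemma hub_credit_soft3:
  assumes s: "safe_opt b1 U1 S1 c1" "safe_opt b2 U2 S2 c2" "safe_opt b3 U3 S3 c3"
    and K: "\<not> twins b1 b2" "\<not> twins b1 b3" "\<not> twins b2 b3"
  shows "7 * w y \<le> base_credit y f1 + base_credit y f2 + base_credit y f3"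
proof -
  have o: "opt b1 U1 S1 c1" "opt b2 U2 S2 c2" "opt b3 U3 S3 c3" using s by (auto simp: safe_opt_def)
  note S = spoke_safe_opt[OF _ i1 s(1)] spoke_safe_opt[OF _ i2 s(2)] spoke_safe_opt[OF _ i3 s(3)]
  have "2 * w y \<le> gap y f1 + gap y f2 + gap y f3 + c1 + c2 + c3"
    by (rule spoke_star3[OF i1 i2 i3 ne o]) (intro spoke_U[OF i1 s(1)] spoke_U[OF i2 s(2)] spoke_U[OF i3 s(3)]
      spokes_soft_apart(2)[OF i1 i2 ne(1) K(1) s(1,2)] spokes_soft_apart(2)[OF i1 i3 ne(2) K(2) s(1,3)]
      spokes_soft_apart(2)[OF i2 i3 ne(3) K(3) s(2,3)] S[OF i1] S[OF i2] S[OF i3])+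
  \<comment> \<open>Four times the inequality: \<open>8 * w y\<close> against credits of at least
    \<open>4 * (gap + c)\<close> each.\<close>
  then show ?thesis using base_credit_soft[OF i1 s(1)] base_credit_soft[OF i2 s(2)] base_credit_soft[OF i3 s(3)]
      gap_nonneg[OF i1] gap_nonneg[OF i2] gap_nonneg[OF i3] by linarith
qed

end

lemma hard_end_two_keep:
  assumes i1: "spoke y f1 b1" and i2: "spoke y f2 b2" and ne: "f1 \<noteq> f2"
    and h1: "hard_end b1 v1 d1 q1 p1" and h2: "hard_end b2 v2 d2 q2 p2"
    and n: "\<not> E q1 f2" "\<not> E q2 f1" "\<not> E q1 q2"
  shows "7 * w y \<le> base_credit y f1 + base_credit y f2"
proof -
  note o1 = hard_end_opts[OF i1 h1] and o2 = hard_end_opts[OF i2 h2]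
  have "w y \<le> gap y f1 + gap y f2 + 0 + 0"
    by (rule spoke_star2[OF i1 i2 ne o1(1) o2(1)]) (use o1 o2 n in \<open>simp_all add: independent_simps\<close>)
  then show ?thesis using base_credit_hard_ge[OF i1 h1] base_credit_hard_ge[OF i2 h2] by linarith
qed

lemma hard_end_sat2:
  assumes "spoke y f b" "hard_end d v d' q q'" "E q f" "b' \<noteq> d"
  shows "nonadj f (priv b')"
  by (rule spoke_sat_priv[OF assms(1), of q d]) (use assms E_sym in \<open>auto simp: hard_end_def\<close>)

context
  fixes y f1 f2 f3 b1 b2 b3
  assumes i1: "spoke y f1 b1" and i2: "spoke y f2 b2" and i3: "spoke y f3 b3"
    and ne: "f1 \<noteq> f2" "f1 \<noteq> f3" "f2 \<noteq> f3"
begin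

lemma hub_credit_hard1_free:
  assumes s: "safe_opt b1 U1 S1 c1" "safe_opt b2 U2 S2 c2" and h: "hard_end b3 v3 d3 q3 p3"
    and K: "\<not> twins b1 b2" and n: "\<not> E q3 f1" "\<not> E q3 f2"
  shows "7 * w y \<le> base_credit y f1 + base_credit y f2 + base_credit y f3"
proof -
  have o: "opt b1 U1 S1 c1" "opt b2 U2 S2 c2" using s by (auto simp: safe_opt_def)
  note o3 = hard_end_opts[OF i3 h]
  have p3: "priv b3 = {q3}" using h by (simp add: hard_end_def)
  note S = spoke_safe_opt[OF _ i1 s(1)] spoke_safe_opt[OF _ i2 s(2)]
  have "2 * w y \<le> gap y f1 + gap y f2 + gap y f3 + c1 + c2 + 0"
    by (rule spoke_star3[OF i1 i2 i3 ne o o3(1)])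
     (use spoke_U[OF i1 s(1)] spoke_U[OF i2 s(2)] o3 n
      spokes_soft_apart(2)[OF i1 i2 ne(1) K(1) s(1,2)] spokes_soft_apart(1)[OF i1 i3 ne(2) hard_end_not_twins(2)[OF h] s(1)]
      spokes_soft_apart(1)[OF i2 i3 ne(3) hard_end_not_twins(2)[OF h] s(2)] S[OF i1] S[OF i2] S[OF i3] p3 in \<open>simp_all add: independent_simps\<close>)
  then show ?thesis using base_credit_soft[OF i1 s(1)] base_credit_soft[OF i2 s(2)] base_credit_hard_ge[OF i3 h] by linarith
qed

text \<open>Since \<open>q3\<close> is adjacent to \<open>f1\<close>, it must be dropped when all
  three neighbours enter. In return the edge saturates \<open>f1\<close> and uses up the free edge
  of \<open>q3\<close>, so the pairs \<open>f1\<close>, \<open>f2\<close> and \<open>f2\<close>,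
  \<open>f3\<close> allow cheaper exchanges.\<close>

lemma hub_credit_hard1_adj:
  assumes s: "safe_opt b1 U1 S1 c1" "safe_opt b2 U2 S2 c2" and h: "hard_end b3 v3 d3 q3 p3"
    and K: "\<not> twins b1 b2" and n: "E q3 f1"
  shows "7 * w y \<le> base_credit y f1 + base_credit y f2 + base_credit y f3"
proof -
  have o: "opt b1 U1 S1 c1" "opt b2 U2 S2 c2" using s by (auto simp: safe_opt_def)
  note o3 = hard_end_opts[OF i3 h] and k2 = keep_opts[OF i2]
  have p3: "priv b3 = {q3}" using h by (simp add: hard_end_def)
  have n2: "\<not> E q3 f2" by (rule hard_end_unique[OF i1 i2 h n ne(1)])
  have sat: "nonadj f1 (priv b2)" by (rule hard_end_sat2[OF i1 h n spoke_hard_end_ne_b[OF i2 i3 ne(3) h]])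
  note S = spoke_safe_opt[OF _ i1 s(1)] spoke_safe_opt[OF _ i2 s(2)]
  note Un = spoke_U[OF i1 s(1)] spoke_U[OF i2 s(2)]
  note A = spokes_soft_apart(2)[OF i1 i2 ne(1) K(1) s(1,2)] spokes_soft_apart(1)[OF i1 i2 ne(1) K(1) s(1)]
     spokes_soft_apart(1)[OF i1 i3 ne(2) hard_end_not_twins(2)[OF h] s(1)]
      spokes_soft_apart(1)[OF i2 i3 ne(3) hard_end_not_twins(2)[OF h] s(2)]
  have "2 * w y \<le> gap y f1 + gap y f2 + gap y f3 + c1 + c2 + w q3"
    by (rule spoke_star3[OF i1 i2 i3 ne o o3(2)]) (use A Un o3 S[OF i1] S[OF i2] S[OF i3] in \<open>simp_all add: independent_simps\<close>)
  moreover have "w y \<le> gap y f1 + gap y f2 + c1 + 0"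
    by (rule spoke_star2[OF i1 i2 ne(1) o(1) k2(1)]) (use A Un k2 sat S[OF i1] S[OF i2] in \<open>simp_all add: independent_simps\<close>)
  moreover have "w y \<le> gap y f2 + gap y f3 + c2 + 0"
    by (rule spoke_star2[OF i2 i3 ne(3) o(2) o3(1)]) (use A Un o3 n2 p3 S[OF i2] S[OF i3] in \<open>simp_all add: independent_simps\<close>)
  \<comment> \<open>The three inequalities are combined with weights 2, 2, 1; the coefficient 5 of
    \<open>gap y f2\<close> is attained.\<close>
  ultimately show ?thesis using base_credit_soft[OF i1 s(1)] base_credit_soft[OF i2 s(2)] base_credit_hard_ge[OF i3 h] by linarith
qed

text \<open>The edge uses up the free edge of both \<open>q2\<close> and \<open>q3\<close>, so no
  spoke meets them: keep one, drop the other, in both ways, each with weight 2.\<close>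

lemma hub_credit_hard2_qq:
  assumes s: "safe_opt b1 U1 S1 c1" and h2: "hard_end b2 v2 d2 q2 p2" and h3: "hard_end b3 v3 d3 q3 p3"
    and d: "d2 \<noteq> b3" "d3 \<noteq> b2" and n: "E q2 q3"
  shows "7 * w y \<le> base_credit y f1 + base_credit y f2 + base_credit y f3"
proof -
  have o: "opt b1 U1 S1 c1" using s by (auto simp: safe_opt_def)
  note o2 = hard_end_opts[OF i2 h2] and o3 = hard_end_opts[OF i3 h3]
  have p: "priv b2 = {q2}" "priv b3 = {q3}" using h2 h3 by (simp_all add: hard_end_def)
  have q: "q3 \<notin> {b2, p2}" "q2 \<notin> {b3, p3}" "E q3 q2"
    using hard_end(1,2,9)[OF h2] hard_end(1,2,9)[OF h3] spoke(3)[OF i2] spoke(3)[OF i3] d E_sym[OF n] by auto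
  have nf: "\<not> E q2 f" "\<not> E q3 f" if "spoke y f b" for f b
    using hard_end(10)[OF h2 n _ q(1)] hard_end(10)[OF h3 q(3) _ q(2)]
      spoke_hard_end_ne[OF that h2] spoke_hard_end_ne[OF that h3] by blast+
  note S = spoke_safe_opt[OF _ i1 s(1)]
  note A = spokes_soft_apart(1)[OF i1 i2 ne(1) hard_end_not_twins(2)[OF h2] s(1)] spokes_soft_apart(1)[OF i1 i3 ne(2) hard_end_not_twins(2)[OF h3] s(1)]
  have "2 * w y \<le> gap y f1 + gap y f2 + gap y f3 + c1 + 0 + w q3"
    by (rule spoke_star3[OF i1 i2 i3 ne o o2(1) o3(2)])
      (use A spoke_U[OF i1 s(1)] o2 o3 S[OF i1] S[OF i2] S[OF i3] nf[OF i1] nf[OF i2] nf[OF i3] p in \<open>simp_all add: independent_simps\<close>)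
  moreover have "2 * w y \<le> gap y f1 + gap y f2 + gap y f3 + c1 + w q2 + 0"
    by (rule spoke_star3[OF i1 i2 i3 ne o o2(2) o3(1)])
      (use A spoke_U[OF i1 s(1)] o2 o3 S[OF i1] S[OF i2] S[OF i3] nf[OF i1] nf[OF i2] nf[OF i3] p in \<open>simp_all add: independent_simps\<close>)
  ultimately show ?thesis using base_credit_soft[OF i1 s(1)] base_credit_hard_ge[OF i2 h2] base_credit_hard_ge[OF i3 h3] by linarith
qed

text \<open>The crossing edges saturate \<open>f2\<close>, \<open>f3\<close>, \<open>q2\<close>,
  \<open>q3\<close>, so the private neighbours of \<open>b1\<close> can be kept. Weights 2, 2, 1
  give the bound.\<close>

lemma hub_credit_hard2_both:
  assumes s: "b1 \<noteq> d2" "b1 \<noteq> d3" and h2: "hard_end b2 v2 d2 q2 p2" and h3: "hard_end b3 v3 d3 q3 p3"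
    and n: "E q2 f3" "E q3 f2"
  shows "7 * w y \<le> base_credit y f1 + base_credit y f2 + base_credit y f3"
proof -
  note o2 = hard_end_opts[OF i2 h2] and o3 = hard_end_opts[OF i3 h3] and k1 = keep_opts[OF i1]
  have n1: "\<not> E q2 f1" "\<not> E q3 f1" using hard_end_unique[OF i3 i1 h2 n(1)] hard_end_unique[OF i2 i1 h3 n(2)] ne by auto
  have b: "b1 \<noteq> b2" "b1 \<noteq> b3" using spoke_hard_end_ne_b[OF i1 i2 ne(1) h2] spoke_hard_end_ne_b[OF i1 i3 ne(2) h3] by auto
  have sat: "nonadj f3 (priv b1)" "nonadj f2 (priv b1)"
    using hard_end_sat2[OF i3 h2 n(1) b(1)] hard_end_sat2[OF i2 h3 n(2) b(2)] by auto
  have sq: "nonadj q2 (priv b1)" "nonadj q3 (priv b1)"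
    using hard_end_sat_priv[OF h2 n(1) spoke_hard_end_ne(1)[OF i3 h2] s(1) spoke_hard_end_ne(4)[OF i3 h2]]
     hard_end_sat_priv[OF h3 n(2) spoke_hard_end_ne(1)[OF i2 h3] s(2) spoke_hard_end_ne(4)[OF i2 h3]] by auto
  have "2 * w y \<le> gap y f1 + gap y f2 + gap y f3 + 0 + w q2 + w q3"
    by (rule spoke_star3[OF i1 i2 i3 ne k1(1) o2(2) o3(2)]) (use k1 o2 o3 sat in \<open>simp_all add: independent_simps\<close>)
  moreover have "w y \<le> gap y f1 + gap y f2 + 0 + 0"
    by (rule spoke_star2[OF i1 i2 ne(1) k1(1) o2(1)]) (use k1 o2 sat n1 sq in \<open>simp_all add: independent_simps\<close>)
  moreover have "w y \<le> gap y f1 + gap y f3 + 0 + 0"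
    by (rule spoke_star2[OF i1 i3 ne(2) k1(1) o3(1)]) (use k1 o3 sat n1 sq in \<open>simp_all add: independent_simps\<close>)
  ultimately show ?thesis using base_credit_ge[OF i1] base_credit_hard_ge[OF i2 h2] base_credit_hard_ge[OF i3 h3] by linarith
qed

lemma hub_credit_hard2_path:
  assumes s: "safe_opt b1 U1 S1 c1" and h2: "hard_end b2 v2 d2 q2 p2" and h3: "hard_end b3 v3 d3 q3 p3"
    and n: "E q2 f3" "\<not> E q3 f2"
  shows "7 * w y \<le> base_credit y f1 + base_credit y f2 + base_credit y f3"
proof -
  have o: "opt b1 U1 S1 c1" using s by (auto simp: safe_opt_def)
  note o2 = hard_end_opts[OF i2 h2] and o3 = hard_end_opts[OF i3 h3] and k1 = keep_opts[OF i1]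
  have p: "priv b2 = {q2}" "priv b3 = {q3}" using h2 h3 by (simp_all add: hard_end_def)
  have n1: "\<not> E q2 f1" using hard_end_unique[OF i3 i1 h2 n(1)] ne by auto
  have b: "b1 \<noteq> b2" using spoke_hard_end_ne_b[OF i1 i2 ne(1) h2] by auto
  have sat: "nonadj f3 (priv b1)" using hard_end_sat2[OF i3 h2 n(1) b(1)] by auto
  note S = spoke_safe_opt[OF _ i1 s(1)]
  note A = spokes_soft_apart(1)[OF i1 i2 ne(1) hard_end_not_twins(2)[OF h2] s(1)] spokes_soft_apart(1)[OF i1 i3 ne(2) hard_end_not_twins(2)[OF h3] s(1)]
   spoke_U[OF i1 s(1)] S[OF i1] S[OF i2] S[OF i3]
  have 1: "w y \<le> gap y f1 + gap y f2 + c1 + 0"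
    by (rule spoke_star2[OF i1 i2 ne(1) o(1) o2(1)]) (use A o2 n1 p in \<open>simp_all add: independent_simps\<close>)
  have 2: "w y \<le> gap y f1 + gap y f3 + 0 + w q3"
    by (rule spoke_star2[OF i1 i3 ne(2) k1(1) o3(2)]) (use k1 o3 sat in \<open>simp_all add: independent_simps\<close>)
  note fin = base_credit_soft[OF i1 s(1)] base_credit_hard_ge[OF i2 h2] base_credit_hard_ge[OF i3 h3]
  show ?thesis
  proof (cases "E q3 f1")
    case True
    have "w y \<le> gap y f2 + gap y f3 + w q2 + 0"
      by (rule spoke_star2[OF i2 i3 ne(3) o2(2) o3(1)]) (use o2 o3 n in \<open>simp_all add: independent_simps\<close>)
    moreover have "2 * w y \<le> gap y f1 + gap y f2 + gap y f3 + c1 + w q2 + w q3"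
      by (rule spoke_star3[OF i1 i2 i3 ne o o2(2) o3(2)]) (use A o2 o3 in \<open>simp_all add: independent_simps\<close>)
    \<comment> \<open>Weights 3 and 1 for facts \<open>1\<close> and \<open>2\<close>, and 1 for
      each of the two new inequalities.\<close>
    ultimately show ?thesis using 1 2 fin by linarith
  next
    case False
    have "2 * w y \<le> gap y f1 + gap y f2 + gap y f3 + c1 + w q2 + 0"
      by (rule spoke_star3[OF i1 i2 i3 ne o o2(2) o3(1)]) (use A o2 o3 p n False in \<open>simp_all add: independent_simps\<close>)
    \<comment> \<open>Weights 2 and 1 for facts \<open>1\<close> and \<open>2\<close>, and 2 for the
      new inequality.\<close>
    then show ?thesis using 1 2 fin by linarith
  qed
qed

text \<open>The cyclic edges saturate \<open>f1\<close>, \<open>f2\<close> and \<open>q2\<close>;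
  hence at \<open>b1\<close> one can swap \<open>q1\<close> for \<open>v1\<close> and
  \<open>priv d1\<close> without meeting them. Eight times the resulting inequality is covered by
  the bonus.\<close>

lemma hub_credit_hard3_cycle:
  assumes h1: "hard_end b1 v1 d1 q1 p1" and h2: "hard_end b2 v2 d2 q2 p2" and h3: "hard_end b3 v3 d3 q3 p3"
    and n: "E q1 f2" "E q2 f3" "E q3 f1" and d: "d1 \<noteq> b2" "d1 \<noteq> b3"
  shows "7 * w y \<le> base_credit y f1 + base_credit y f2 + base_credit y f3"
proof -
  note o1 = hard_end_opts[OF i1 h1] and o2 = hard_end_opts[OF i2 h2]
  have e: "b1 \<noteq> b2" using spoke_hard_end_ne_b[OF i1 i2 ne(1) h2] .
  have dd: "d1 \<noteq> d2"
  proof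
    assume "d1 = d2"
    then have "v1 = v2" using hard_end(14)[OF h1] hard_end(14)[OF h2] by simp
    then show False using h1 h2 \<open>d1 = d2\<close> e d by (auto simp: hard_end_def doubleton_eq_iff)
  qed
  have db: "d1 \<noteq> b1" using h1 by (auto simp: hard_end_def)
  have v1: "nbI v1 = {b1, d1}" using h1 by (simp add: hard_end_def)
  have I: "b1 \<in> I" "b2 \<in> I" "d1 \<in> I" using spoke(3)[OF i1] spoke(3)[OF i2] hard_end(5)[OF h1] by auto
  have a: "nonadj f1 (priv d1)" "nonadj f2 (priv d1)"
    using hard_end_sat2[OF i1 h3 n(3) d(2)] hard_end_sat2[OF i2 h1 n(1) db] by auto
  have b: "nonadj q2 (priv d1)"
    by (rule hard_end_sat_priv[OF h2 n(2) spoke_hard_end_ne(1)[OF i3 h2] dd spoke_hard_end_ne(4)[OF i3 h2]])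
  have qv: "q1 \<noteq> v1" "q2 \<noteq> v1" "q3 \<noteq> v1" using v1 hard_end(1)[OF h1] hard_end(1)[OF h2] hard_end(1)[OF h3] db by auto
  have qI: "q1 \<notin> I" "q3 \<notin> I" "v1 \<notin> I" using hard_end(9)[OF h1] hard_end(9)[OF h3] hard_end(8)[OF h1] by auto
  have "\<not> E f1 v1" using spoke_sat[OF i1, of q3 v1] n(3) E_sym qI qv by blast
  moreover have "\<not> E f2 v1" using spoke_sat[OF i2, of q1 v1] n(1) E_sym qI qv by blast
  moreover have "v1 \<notin> {b2, p2}" using v1 nbI_I[OF I(2)] hard_end(2)[OF h2] db by auto
  then have "\<not> E q2 v1" using hard_end(10)[OF h2 n(2)] spoke_hard_end_ne(1)[OF i3 h2] spoke_hard_end_ne(3)[OF i3 h1] by blast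
  moreover have "\<not> E q2 f1" using hard_end_unique[OF i3 i1 h2 n(2)] ne by auto
  ultimately have "w y \<le> gap y f1 + gap y f2 + (w q1 - excess v1) + 0"
    by (intro spoke_star2[OF i1 i2 ne(1) o1(3) o2(1)]) (use o1 o2 a b in \<open>simp_all add: independent_simps\<close>)
  then show ?thesis using base_credit_hard_ge(2,4,5)[OF i1 h1] base_credit_ge[OF i2] base_credit_ge[OF i3] base_credit_hard_ge(1,3)[OF i2 h2] by linarith
qed

text \<open>The two hard ends share the bad vertex \<open>v\<close>. A joint exchange brings in
  \<open>v\<close> and keeps \<open>q2\<close>, giving up only \<open>q3\<close>, at a loss of
  \<open>w q3 - excess v\<close>.\<close>

lemma hub_credit_mates_direct:
  assumes h2: "hard_end b2 v b3 q2 q3" and h3: "hard_end b3 v b2 q3 q2" and n: "\<not> E q2 f3"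
  shows "7 * w y \<le> base_credit y f2 + base_credit y f3"
proof -
  have v: "nbI v = {b2, b3}" "b2 \<noteq> b3" using h2 by (auto simp: hard_end_def)
  have E: "E b2 v" "E b3 v" "v \<in> V - I" "E b2 q2" "q2 \<in> V - I" "nbI q2 = {b2}" using hard_end[OF h2] by auto
  have vq: "v \<noteq> q2" using v E by auto
  have "sum w {f2, f3} \<le> w y + (sum w {b2, b3} - sum w {v, q2})"
  proof (rule star)
    show "y \<in> I" "y \<notin> {b2, b3}" "{f2, f3} \<subseteq> dbl y" using spoke[OF i2] spoke[OF i3] by auto
    have "\<not> E v q2" "\<not> E f2 v" "\<not> E f2 q2" "\<not> E f3 v" using E spoke[OF i2] spoke[OF i3] triangle_free E_sym by meson+
    then show "swappable {b2, b3} {v, q2}" "apart {f2, f3} {v, q2}"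
      using E v n spoke[OF i2] spoke[OF i3] by (simp_all add: swappable_def independent_simps)
    show "other y f \<in> {b2, b3}" if "f \<in> {f2, f3}" for f using that spoke(17)[OF i2] spoke(17)[OF i3] by auto
  qed
  moreover have "w b2 = slack b2 + w q2" "w b3 = slack b3 + w q3" using h2 h3 by (auto simp: slack_def hard_end_def)
  moreover have "excess v = w v - slack b2 - slack b3" using excess_eq v by blast
  moreover have "0 \<le> slack b2" "0 \<le> slack b3" using slack_nonneg spoke(3)[OF i2] spoke(3)[OF i3] by auto
  ultimately have "w y \<le> gap y f2 + gap y f3 + (w q3 - excess v)"
    using ne(3) vq v(2) spoke(17)[OF i2] spoke(17)[OF i3] by (simp add: gap_def)
  then show ?thesis using base_credit_hard_ge(1,3,4)[OF i2 h2] base_credit_hard_ge(2,4,5)[OF i3 h3] by linarith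
qed

end

section \<open>Hubs joined to both ends of a blocked vertex\<close>

definition twin_config :: "'a \<Rightarrow> 'a \<Rightarrow> 'a \<Rightarrow> 'a \<Rightarrow> 'a \<Rightarrow> 'a \<Rightarrow> 'a \<Rightarrow> 'a \<Rightarrow> bool" where
  "twin_config a b u va vb q qa qb \<longleftrightarrow> config u a b va vb q qa qb \<and> blocked u \<and> priv a = {qa} \<and> priv b = {qb}
     \<and> bad a = {va} \<and> bad b = {vb} \<and> bonus a = 8 * w qa - 8 * excess va \<and> bonus b = 8 * w qb - 8 * excess vb"

lemma twin_config_sym: "twin_config a b u va vb q qa qb \<Longrightarrow> twin_config b a u vb va q qb qa"
  by (simp add: twin_config_def config_swap)

text \<open>The only other conflict allowed by \<open>config\<close>, the edge \<open>qa qb\<close>,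
  would form a triangle with \<open>q\<close>.\<close>

lemma twin_config_conflict: assumes "twin_config a b u va vb q qa qb" shows "E va qb \<or> E vb qa"
proof -
  have c: "config u a b va vb q qa qb" "priv a = {qa}" "priv b = {qb}" using assms by (auto simp: twin_config_def)
  then show ?thesis using config_facts(6)[OF c(1)] by (auto simp: config_def apart_def nonadj_def)
qed

lemma twins_twin_config:
  assumes a: "a \<in> I" "slots a \<noteq> {}" and b: "b \<in> I" "slots b \<noteq> {}" and ab: "a \<noteq> b" "twins a b"
  obtains u va vb q qa qb where "twin_config a b u va vb q qa qb"
proof -
  obtain va v' where v: "va \<in> bad a" "v' \<in> bad b" "other a va = other b v'" "blocked (other a va)"
    using ab(2) unfolding twins_def by blast
  define u where "u = other a va"
  obtain b' vb q qb qa where A: "config u b' a vb va q qb qa" "bad a = {va}" "priv a = {qa}" "bonus a = 8 * (w qa - excess va)"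
    using blocked_end[OF a v(1,4)] unfolding u_def by metis
  have "blocked (other b v')" using v by simp
  from blocked_end[OF b v(2) this] obtain qb' where B: "bad b = {v'}" "priv b = {qb'}" "bonus b = 8 * (w qb' - excess v')"
    by metis
  have nv': "nbI v' = {b, u}" "b \<noteq> u" "v' \<in> bad u"
    using badE[OF v(2) b(1)] v(3) u_def by metis+
  have "nbI va = {u, a}" using A(1) by (simp add: config_def)
  then have "v' \<noteq> va" using nv' ab(1) by (auto simp: doubleton_eq_iff)
  then have "v' = vb" using nv'(3) A(1) by (auto simp: config_def)
  then have "b' = b" using A(1) nv' by (auto simp: config_def doubleton_eq_iff)
  have "qb' = qb" using A(1) B(2) \<open>b' = b\<close> by (auto simp: config_def)
  have "twin_config a b u va vb q qa qb"
    using config_swap[OF A(1)] A B v(4) u_def \<open>v' = vb\<close> \<open>b' = b\<close> \<open>qb' = qb\<close> by (simp add: twin_config_def)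
  then show ?thesis by (rule that)
qed

lemma twin_config_nbrs: assumes "twin_config a b u va vb q qa qb" "E va qb"
  shows "E qb x \<Longrightarrow> x = b \<or> x = q \<or> x = va" "E va x \<Longrightarrow> x = u \<or> x = a \<or> x = qb"
proof -
  have c: "config u a b va vb q qa qb" using assms by (simp add: twin_config_def)
  note f = config_facts[OF c]
  have n: "nbI va = {u, a}" "u \<noteq> a" "a \<noteq> b" "E q qb" using c by (auto simp: config_def)
  have "b \<noteq> q" "b \<noteq> va" "q \<noteq> va" using f(18,23) n(1,2) by auto
  then show "E qb x \<Longrightarrow> x = b \<or> x = q \<or> x = va"
    using third_nbr[of qb b q va x] E_sym[OF f(13)] E_sym[OF n(4)] E_sym[OF assms(2)] by blast
  have "u \<noteq> qb" "a \<noteq> qb" using f(20,21,22) by auto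
  then show "E va x \<Longrightarrow> x = u \<or> x = a \<or> x = qb"
    using third_nbr[of va u a qb x] E_sym[OF f(7)] E_sym[OF f(9)] assms(2) n(2) by blast
qed

text \<open>
  The only situation in which base credits do not suffice: the hub \<open>y\<close> then needs up to
  \<open>7 * gap y f\<close> instead of \<open>5 * gap y f\<close> from the spoke \<open>f\<close>, whose other end is a hub too.
  The closure conditions on \<open>f'\<close> and \<open>q\<close> ensure that the exchanges of two weird hubs joined by \<open>f\<close> are
  compatible.
\<close>

definition weird :: "'a \<Rightarrow> 'a \<Rightarrow> 'a \<Rightarrow> 'a \<Rightarrow> 'a \<Rightarrow> bool" where
  "weird y f f' b q \<longleftrightarrow> spoke y f' b \<and> f' \<noteq> f \<and> priv b = {q} \<and> bad b \<noteq> {}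
    \<and> (\<forall>x. E f' x \<longrightarrow> x \<in> I \<or> card (nbI x) = 1)
    \<and> (\<forall>x. E q x \<longrightarrow> x \<in> I \<or> excess x > 0 \<and> card (nbI x) = 2 \<or> (\<exists>u. x \<in> priv u \<and> card (bad u) = 2))
    \<and> w y \<le> gap y f' + gap y f"

text \<open>Both hubs and both ends \<open>b\<close>, \<open>b'\<close> leave, while
  \<open>f\<close>, \<open>g\<close>, \<open>g'\<close>, \<open>q\<close>, \<open>q'\<close> enter;
  the closure conditions leave no edge among the latter.\<close>

lemma weird_edge:
  assumes f: "spoke y f y'" "spoke y' f y" and W: "weird y f g b q" and W': "weird y' f g' b' q'"
  shows "w y + w y' \<le> gap y f + gap y g + gap y' g'"
proof -
  have W: "spoke y g b" "g \<noteq> f" "priv b = {q}" "bad b \<noteq> {}" "\<And>x. E g x \<Longrightarrow> x \<in> I \<or> card (nbI x) = 1"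
    "\<And>x. E q x \<Longrightarrow> x \<in> I \<or> excess x > 0 \<and> card (nbI x) = 2 \<or> (\<exists>u. x \<in> priv u \<and> card (bad u) = 2)"
    using W unfolding weird_def by blast+
  have W': "spoke y' g' b'" "g' \<noteq> f" "priv b' = {q'}" "bad b' \<noteq> {}" "\<And>x. E g' x \<Longrightarrow> x \<in> I \<or> card (nbI x) = 1"
    "\<And>x. E q' x \<Longrightarrow> x \<in> I \<or> excess x > 0 \<and> card (nbI x) = 2 \<or> (\<exists>u. x \<in> priv u \<and> card (bad u) = 2)"
    using W' unfolding weird_def by blast+
  note i = spoke[OF W(1)] and i' = spoke[OF W'(1)] and j = spoke[OF f(1)] and j' = spoke[OF f(2)]
  have yb: "y \<noteq> b" "y' \<noteq> b'" "y \<noteq> b'" "y' \<noteq> b" "y \<noteq> y'" using i(2,13) i'(2,13) W(4) W'(4) j(2) by auto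
  have gg: "g \<noteq> g'" using i(1) i'(1) yb by (auto simp: doubleton_eq_iff)
  have bb: "b \<noteq> b'"
  proof
    assume "b = b'"
    then have "slots b = {g}" "slots b = {g'}"
      using end_slot(3)[of b g] end_slot(3)[of b g'] i(3,5) i'(5) W(4) by (auto simp: slots_def)
    then show False using gg by simp
  qed
  have q: "nbI q = {b}" "E b q" "E q b" "q \<in> V - I" using priv_E[of q b] W(3) priv_sub[of b] by auto
  have q': "nbI q' = {b'}" "E b' q'" "E q' b'" "q' \<in> V - I" using priv_E[of q' b'] W'(3) priv_sub[of b'] by auto
  have c: "card (nbI f) = 2" "card (nbI g) = 2" "card (nbI g') = 2" using j(1,2) i(1,2) i'(1,2) by auto
  have np: "x \<notin> priv u" if "card (nbI x) = 2" for x u using that by (auto simp: priv_def)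
  have nqf: "\<not> E q f" "\<not> E q g'" using W(6)[of f] W(6)[of g'] np c j(6,11) i'(6,11) by auto
  have nqf': "\<not> E q' f" "\<not> E q' g" using W'(6)[of f] W'(6)[of g] np c j(6,11) i(6,11) by auto
  have ngg: "\<not> E g g'" using W(5)[of g'] c i'(11) by auto
  have ngq: "\<not> E g q" "\<not> E g' q'" "\<not> E f g" "\<not> E f g'"
    using triangle_free[of g b q] triangle_free[of g' b' q'] triangle_free[of f y g] triangle_free[of f y' g']
      i(7,10) i'(7,10) q(2) q'(2) j(8) j'(8) by auto
  \<comment> \<open>A private vertex adjacent to \<open>q\<close> belongs to a vertex with two bad
    neighbours, which has no slot left, whereas \<open>b'\<close> has the slot
    \<open>g'\<close>.\<close>
  have nqq: "\<not> E q q'"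
  proof
    assume e: "E q q'"
    obtain u where u: "q' \<in> priv u" "card (bad u) = 2" using W(6)[OF e] q'(1,4) by auto
    then have "u = b'" using priv_E[OF u(1)] q'(1) by auto
    then show False using u(2) end_card[of b'] i'(3,5) by auto
  qed
  have "sum w {f, g, g', q, q'} \<le> sum w {y, y', b, b'}"
  proof (rule exchange)
    show "{f, g, g', q, q'} \<subseteq> V - I" "{y, y', b, b'} \<subseteq> I"
      using q q' j(3,4,11,14) i(3,11,14) i'(3,11,14) by auto
    show "independent {f, g, g', q, q'}" using nqf nqf' ngg ngq nqq by (simp add: independent_simps)
    show "nbI x \<subseteq> {y, y', b, b'}" if "x \<in> {f, g, g', q, q'}" for x
      using that j(1) i(1) i'(1) q(1) q'(1) by auto
  qed
  moreover have "q \<noteq> q'" "f \<noteq> q" "g \<noteq> q" "g' \<noteq> q" "f \<noteq> q'" "g \<noteq> q'" "g' \<noteq> q'" using bb q(1) q'(1) c by auto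
  ultimately have "w f + w g + w g' + w q + w q' \<le> w y + w y' + w b + w b'"
    using W(2) W'(2) gg yb bb by simp
  moreover have "w b = slack b + w q" "w b' = slack b' + w q'" using W(3) W'(3) by (simp_all add: slack_def)
  ultimately show ?thesis by (simp add: gap_def j(17) i(17) i'(17) j'(19))
qed

context
  fixes y fa fb fk a b k u va vb q qa qb
  assumes ia: "spoke y fa a" and ib: "spoke y fb b" and ik: "spoke y fk k"
    and ne: "fa \<noteq> fb" "fa \<noteq> fk" "fb \<noteq> fk"
    and K: "twin_config a b u va vb q qa qb" "E va qb"
begin

lemma hub_credit_sameK1: assumes "\<not> E qa fb" shows "7 * w y \<le> base_credit y fa + base_credit y fb"
proof -
  have c: "config u a b va vb q qa qb" and p: "priv a = {qa}" "priv b = {qb}" using K by (auto simp: twin_config_def)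
  note f = config_facts[OF c]
  have "fa \<noteq> b" "fa \<noteq> q" "fa \<noteq> va" using spoke[OF ia] f(3,18) spoke(6)[OF ia] c by (auto simp: config_def)
  then have "\<not> E qb fa" using twin_config_nbrs(1)[OF K, of fa] by blast
  then have "w y \<le> gap y fa + gap y fb + 0 + 0"
    by (intro spoke_star2[OF ia ib ne(1) keep_opts(1)[OF ia] keep_opts(1)[OF ib]])
      (use keep_opts[OF ia] keep_opts[OF ib] p assms f(6) in \<open>simp_all add: independent_simps\<close>)
  moreover have "\<not> hub a" "\<not> hub b" using K(1) hub(3) spoke(3)[OF ia] spoke(3)[OF ib] by (auto simp: twin_config_def)
  then have "12 * gap y fa \<le> base_credit y fa" "12 * gap y fb \<le> base_credit y fb"
    using bonus_nonneg spoke(3,17)[OF ia] spoke(3,17)[OF ib] by (simp_all add: base_credit_def)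
  ultimately show ?thesis using base_credit_ge[OF ia] base_credit_ge[OF ib] by linarith
qed

lemma hub_credit_sameK2: assumes "\<not> E vb fa" shows "7 * w y \<le> base_credit y fa + base_credit y fb"
proof -
  have c: "config u a b va vb q qa qb" and p: "priv a = {qa}" "priv b = {qb}" using K by (auto simp: twin_config_def)
  note f = config_facts[OF c]
  have cc: "nbI va = {u, a}" "nbI vb = {u, b}" "va \<noteq> vb" "u \<noteq> a" "u \<noteq> b" "a \<noteq> b" "priv u = {q}" "excess va > 0" "excess vb > 0"
    using c by (auto simp: config_def)
  have fne: "x \<noteq> y'" if "spoke y x z" "y' \<in> {u, a, qb, qa}" for x z y'
  proof -
    have "card (nbI x) = 2" "x \<notin> I" using spoke[OF that(1)] by auto
    then show ?thesis using that(2) f(1,2,19,20) by auto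
  qed
  have n: "\<not> E va fb" using twin_config_nbrs(2)[OF K, of fb] fne[OF ib] by auto
  have n2: "\<not> E q fa" "\<not> E q fb" using f(4)[of fa] f(4)[of fb] fne[OF ia] fne[OF ib] by auto
  have n3: "\<not> E fa va" "\<not> E fb vb" "\<not> E va q" "\<not> E vb q" "\<not> E va vb"
    using triangle_free[of fa a va] triangle_free[of fb b vb] triangle_free[of va u q] triangle_free[of vb u q] triangle_free[of va u vb]
      spoke(10)[OF ia] spoke(10)[OF ib] f(7,8,9,10,11) E_sym[OF f(7)] E_sym[OF f(8)] by auto
  have uy: "y \<noteq> u" "y \<noteq> a" "y \<noteq> b" using spoke(2,13)[OF ia] spoke(2)[OF ib] K(1) by (auto simp: twin_config_def blocked_def)
  have "sum w {fa, fb} \<le> w y + (sum w {u, a, b} - sum w {va, vb, q})"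
  proof (rule star)
    show "y \<in> I" "{fa, fb} \<subseteq> dbl y" "y \<notin> {u, a, b}" using spoke(4,16)[OF ia] spoke(16)[OF ib] uy by auto
    show "other y g \<in> {u, a, b}" if "g \<in> {fa, fb}" for g using that spoke(17)[OF ia] spoke(17)[OF ib] by auto
    show "apart {fa, fb} {va, vb, q}" using assms n n2 n3 by (simp add: independent_simps)
    have "q \<in> V - I" using cc(7) priv_sub[of u] by blast
    then show "swappable {u, a, b} {va, vb, q}"
      using n3 cc(1,2) f(1,2,3,16,17,18) by (simp add: swappable_def independent_simps)
  qed
  moreover have "q \<noteq> va" "q \<noteq> vb" using f(18) cc by auto
  ultimately have "w fa + w fb \<le> w y + w u + w a + w b - w va - w vb - w q" using cc ne by simp
  moreover have "w u = slack u + w q" "w a = slack a + w qa" "w b = slack b + w qb" using p cc(7) by (simp_all add: slack_def)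
  moreover have "excess va = w va - slack u - slack a" "excess vb = w vb - slack u - slack b"
    using excess_eq[OF cc(1,4)] excess_eq[OF cc(2,5)] by auto
  moreover have "0 \<le> slack u" "0 \<le> slack a" "0 \<le> slack b" using slack_nonneg f by auto
  ultimately have "w y \<le> gap y fa + gap y fb + (w qa - excess va) + (w qb - excess vb)"
    using spoke(17)[OF ia] spoke(17)[OF ib] by (simp add: gap_def)
  moreover have "bonus a = 8 * w qa - 8 * excess va" "bonus b = 8 * w qb - 8 * excess vb" using K(1) by (auto simp: twin_config_def)
  moreover have "\<not> hub a" "\<not> hub b" using K(1) hub(3) spoke(3)[OF ia] spoke(3)[OF ib] by (auto simp: twin_config_def)
  then have "base_credit y fa = 12 * gap y fa + bonus a" "base_credit y fb = 12 * gap y fb + bonus b"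
    using spoke(17)[OF ia] spoke(17)[OF ib] by (simp_all add: base_credit_def)
  moreover have "0 \<le> bonus a" "0 \<le> bonus b" using bonus_nonneg f by auto
  ultimately show ?thesis using base_credit_ge(2)[OF ia] base_credit_ge(2)[OF ib] by linarith
qed

text \<open>The edge \<open>qa fb\<close> saturates \<open>fb\<close>, and \<open>qb\<close> is
  saturated by \<open>b\<close>, \<open>q\<close>, \<open>va\<close>; thus keeping the private
  neighbours at \<open>b\<close> and at \<open>k\<close> is compatible.\<close>

lemma hub_credit_sameK3: assumes "E qa fb"
  shows "weird y fk fb b qb" "12 * gap y fb \<le> base_credit y fb"
proof -
  have c: "config u a b va vb q qa qb" and p: "priv a = {qa}" "priv b = {qb}" using K by (auto simp: twin_config_def)
  note f = config_facts[OF c]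
  have cc: "nbI va = {u, a}" "u \<noteq> a" "priv u = {q}" "excess va > 0" "card (bad u) = 2"
    using c K by (auto simp: config_def twin_config_def blocked_def)
  have ak: "a \<noteq> k" using spoke_inj(1)[OF ia _ ne(2), of y] ik K(1) by (auto simp: twin_config_def)
  have uk: "k \<noteq> u" using end_card[of k] spoke(3,5)[OF ik] cc(5) by auto
  have "fk \<noteq> b" "fk \<noteq> q" "fk \<noteq> va" using spoke[OF ik] f(3,18) spoke(6)[OF ik] cc by auto
  then have n: "\<not> E qb fk" using twin_config_nbrs(1)[OF K, of fk] by blast
  have Nb: "x \<in> I \<or> x = qa" if "E fb x" for x
    using spoke_sat[OF ib, of qa x] E_sym[OF assms] that priv_sub[of a] p(1) by blast
  have "nonadj fb (priv k)" by (rule spoke_sat_priv[OF ib E_sym[OF assms] _ ak]) (simp add: p)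
  moreover have "nonadj qb (priv k)"
  proof -
    have "b \<notin> priv k" "q \<notin> priv k" "va \<notin> priv k" using f(18,23) uk cc(1,2) by (auto simp: priv_def)
    then show ?thesis unfolding nonadj_def using twin_config_nbrs(1)[OF K] by blast
  qed
  ultimately have T: "w y \<le> gap y fb + gap y fk + 0 + 0"
    by (intro spoke_star2[OF ib ik ne(3) keep_opts(1)[OF ib] keep_opts(1)[OF ik]])
      (use keep_opts[OF ib] keep_opts[OF ik] p n in \<open>simp_all add: independent_simps\<close>)
  show "weird y fk fb b qb" unfolding weird_def
  proof (intro conjI allI impI)
    show "spoke y fb b" "fb \<noteq> fk" "priv b = {qb}" "bad b \<noteq> {}" using ib ne p K(1) by (auto simp: twin_config_def)
    show "x \<in> I \<or> card (nbI x) = 1" if "E fb x" for x using Nb[OF that] f(19) by auto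
    show "x \<in> I \<or> excess x > 0 \<and> card (nbI x) = 2 \<or> (\<exists>u. x \<in> priv u \<and> card (bad u) = 2)" if "E qb x" for x
      using twin_config_nbrs(1)[OF K that] f(3) cc(1-5) by auto
    show "w y \<le> gap y fb + gap y fk" using T by simp
  qed
  have "\<not> hub b" using K(1) hub(3) spoke(3)[OF ib] by (auto simp: twin_config_def)
  then show "12 * gap y fb \<le> base_credit y fb" using bonus_nonneg spoke(3,17)[OF ib] by (simp add: base_credit_def)
qed

end

text \<open>Exactly one far end is a hub, so the shortfall can be charged to that single
  \<open>f\<close>.\<close>

definition exceptional :: "'a \<Rightarrow> 'a \<Rightarrow> 'a \<Rightarrow> 'a \<Rightarrow> bool" where
  "exceptional y f f1 f2 \<longleftrightarrow> hub (other y f) \<and> \<not> hub (other y f1) \<and> \<not> hub (other y f2)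
     \<and> (\<exists>g b q. weird y f g b q \<and> g \<in> {f1, f2} \<and> 12 * gap y g \<le> base_credit y g)"

lemma hub_credit_twins_ord:
  assumes i: "spoke y f1 b1" "spoke y f2 b2" "spoke y f3 b3" and ne: "f1 \<noteq> f2" "f1 \<noteq> f3" "f2 \<noteq> f3"
    and K: "twin_config b1 b2 u v1 v2 q q1 q2" "E v1 q2"
  shows "7 * w y \<le> base_credit y f1 + base_credit y f2 + base_credit y f3 \<or> exceptional y f3 f1 f2"
proof -
  note k = hub_credit_sameK1[OF i ne K] hub_credit_sameK2[OF i ne K] hub_credit_sameK3[OF i ne K]
  have n: "\<not> hub b1" "\<not> hub b2" using K(1) hub(3) spoke(3)[OF i(1)] spoke(3)[OF i(2)] by (auto simp: twin_config_def)
  show ?thesis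
  proof (cases "E q1 f2")
    case False then show ?thesis using k(1) base_credit_ge[OF i(3)] by linarith
  next
    case True
    note W = k(3,4)[OF True]
    show ?thesis
    proof (cases "hub b3")
      case True
      then show ?thesis using W n spoke(17)[OF i(1)] spoke(17)[OF i(2)] spoke(17)[OF i(3)] unfolding exceptional_def by blast
    next
      case False
      \<comment> \<open>Without a hub at \<open>b3\<close>, both gaps count twelvefold and
        \<open>w y\<close> is at most their sum.\<close>
      then have "12 * gap y f3 \<le> base_credit y f3" using bonus_nonneg spoke(3,17)[OF i(3)] by (simp add: base_credit_def)
      moreover have "w y \<le> gap y f2 + gap y f3" using W by (simp add: weird_def)
      ultimately show ?thesis using W(2) base_credit_ge[OF i(1)] base_credit_ge[OF i(2)] base_credit_ge[OF i(3)] by linarith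
    qed
  qed
qed

lemma exceptional_sym: "exceptional y f f1 f2 \<longleftrightarrow> exceptional y f f2 f1"
  by (auto simp: exceptional_def)

lemma hub_credit_twins:
  assumes i: "spoke y f1 b1" "spoke y f2 b2" "spoke y f3 b3" and ne: "f1 \<noteq> f2" "f1 \<noteq> f3" "f2 \<noteq> f3"
    and K: "twins b1 b2"
  shows "7 * w y \<le> base_credit y f1 + base_credit y f2 + base_credit y f3 \<or> exceptional y f3 f1 f2"
proof -
  have "bad b1 \<noteq> {}" using K by (auto simp: twins_def)
  then have "b1 \<noteq> b2" using spoke_inj(1)[OF i(1) _ ne(1)] i(2) by blast
  moreover have "slots b1 \<noteq> {}" "slots b2 \<noteq> {}" using spoke(5)[OF i(1)] spoke(5)[OF i(2)] by auto
  ultimately obtain u va vb q qa qb where k: "twin_config b1 b2 u va vb q qa qb"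
    using twins_twin_config[OF spoke(3)[OF i(1)] _ spoke(3)[OF i(2)] _ _ K] by metis
  show ?thesis
  proof (cases "E va qb")
    case True show ?thesis by (rule hub_credit_twins_ord[OF i ne k True])
  next
    case False
    then have "E vb qa" using twin_config_conflict[OF k] by simp
    then have "7 * w y \<le> base_credit y f2 + base_credit y f1 + base_credit y f3 \<or> exceptional y f3 f2 f1"
      by (rule hub_credit_twins_ord[OF i(2,1,3) ne(1)[symmetric] ne(3,2) twin_config_sym[OF k]])
    then show ?thesis using exceptional_sym by (simp add: algebra_simps)
  qed
qed

section \<open>Assembling the cases at one hub\<close>

lemma hard_end_mates: assumes h: "hard_end b2 v2 b3 q2 p2" "hard_end b3 v3 d3 q3 p3"
  shows "v3 = v2" "d3 = b2" "p2 = q3" "p3 = q2"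
proof -
  show v: "v3 = v2" using hard_end(14)[OF h(1)] h(2) by (simp add: hard_end_def)
  show d: "d3 = b2" using h v by (auto simp: hard_end_def doubleton_eq_iff)
  show "p2 = q3" "p3 = q2" using h d by (auto simp: hard_end_def)
qed

lemma hub_credit_mates:
  assumes i: "spoke y f1 b1" "spoke y f2 b2" "spoke y f3 b3" and ne: "f1 \<noteq> f2" "f1 \<noteq> f3" "f2 \<noteq> f3"
    and h: "hard_end b2 v2 d2 q2 p2" "hard_end b3 v3 d3 q3 p3" "d2 = b3"
  shows "7 * w y \<le> base_credit y f1 + base_credit y f2 + base_credit y f3"
proof -
  have h2: "hard_end b2 v2 b3 q2 p2" using h by simp
  note e = hard_end_mates[OF h2 h(2)]
  have H: "hard_end b2 v2 b3 q2 q3" "hard_end b3 v2 b2 q3 q2" using h2 h(2) e by auto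
  consider "\<not> E q2 f3" | "\<not> E q3 f2" | "E q2 f3" "E q3 f2" by blast
  then show ?thesis
  proof cases
    case 1
    then show ?thesis using hub_credit_mates_direct[OF i ne H 1] base_credit_ge[OF i(1)] by linarith
  next
    case 2
    then show ?thesis using hub_credit_mates_direct[OF i(1,3,2) ne(2,1) ne(3)[symmetric] H(2,1) 2] base_credit_ge[OF i(1)] by linarith
  next
    case 3
    show ?thesis
      by (rule hub_credit_hard2_both[OF i ne _ _ H 3])
        (rule spoke_hard_end_ne_b[OF i(1,3) ne(2) H(2)] spoke_hard_end_ne_b[OF i(1,2) ne(1) H(1)])+
  qed
qed

lemma hub_credit_hard1:
  assumes i: "spoke y f1 b1" "spoke y f2 b2" "spoke y f3 b3" and ne: "f1 \<noteq> f2" "f1 \<noteq> f3" "f2 \<noteq> f3"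
    and K: "\<not> twins b1 b2" and h: "\<not> hard b1" "\<not> hard b2" "hard b3"
  shows "7 * w y \<le> base_credit y f1 + base_credit y f2 + base_credit y f3"
proof -
  have sl: "slots b1 \<noteq> {}" "slots b2 \<noteq> {}" "slots b3 \<noteq> {}" using spoke(5) i by blast+
  obtain U1 S1 c1 U2 S2 c2 where s: "safe_opt b1 U1 S1 c1" "safe_opt b2 U2 S2 c2"
    using soft_option[OF spoke(3)[OF i(1)] h(1) sl(1)] soft_option[OF spoke(3)[OF i(2)] h(2) sl(2)] by blast
  obtain v d q p where H: "hard_end b3 v d q p" using hardE[OF spoke(3)[OF i(3)] h(3) sl(3)] .
  consider "\<not> E q f1" "\<not> E q f2" | "E q f1" | "E q f2" by blast
  then show ?thesis
  proof cases
    case 1 show ?thesis by (rule hub_credit_hard1_free[OF i ne s H K 1])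
  next
    case 2 show ?thesis by (rule hub_credit_hard1_adj[OF i ne s H K 2])
  next
    case 3
    have "\<not> twins b2 b1" using K twins_sym by blast
    from hub_credit_hard1_adj[OF i(2,1,3) ne(1)[symmetric] ne(3,2) s(2,1) H this 3] show ?thesis by simp
  qed
qed

lemma hub_credit_hard2:
  assumes i: "spoke y f1 b1" "spoke y f2 b2" "spoke y f3 b3" and ne: "f1 \<noteq> f2" "f1 \<noteq> f3" "f2 \<noteq> f3"
    and h: "\<not> hard b1" "hard b2" "hard b3"
  shows "7 * w y \<le> base_credit y f1 + base_credit y f2 + base_credit y f3"
proof -
  have sl: "slots b1 \<noteq> {}" "slots b2 \<noteq> {}" "slots b3 \<noteq> {}" using spoke(5) i by blast+
  obtain U1 S1 c1 where s: "safe_opt b1 U1 S1 c1"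
    using soft_option[OF spoke(3)[OF i(1)] h(1) sl(1)] by blast
  obtain v2 d2 q2 p2 where H2: "hard_end b2 v2 d2 q2 p2" using hardE[OF spoke(3)[OF i(2)] h(2) sl(2)] .
  obtain v3 d3 q3 p3 where H3: "hard_end b3 v3 d3 q3 p3" using hardE[OF spoke(3)[OF i(3)] h(3) sl(3)] .
  note n32 = ne(3)[symmetric]
  show ?thesis
  proof (cases "d2 = b3 \<or> d3 = b2")
    case True
    then show ?thesis using hub_credit_mates[OF i ne H2 H3] hub_credit_mates[OF i(1,3,2) ne(2,1) n32 H3 H2] by auto
  next
    case False
    have d: "b1 \<noteq> d2" "b1 \<noteq> d3" using soft_not_partner h(1) H2 H3 by blast+
    consider "E q2 q3" | "E q2 f3" "E q3 f2" | "E q2 f3" "\<not> E q3 f2" | "E q3 f2" "\<not> E q2 f3"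
      | "\<not> E q2 f3" "\<not> E q3 f2" "\<not> E q2 q3" by blast
    then show ?thesis
    proof cases
      case 1 show ?thesis by (rule hub_credit_hard2_qq[OF i ne s H2 H3 _ _ 1]) (use False in auto)
    next
      case 2 show ?thesis by (rule hub_credit_hard2_both[OF i ne d H2 H3 2])
    next
      case 3 show ?thesis by (rule hub_credit_hard2_path[OF i ne s H2 H3 3])
    next
      case 4
      from hub_credit_hard2_path[OF i(1,3,2) ne(2,1) n32 s H3 H2 4] show ?thesis by simp
    next
      case 5
      from hard_end_two_keep[OF i(2,3) ne(3) H2 H3 5] show ?thesis using base_credit_ge[OF i(1)] by linarith
    qed
  qed
qed

lemma hub_credit_hard3:
  assumes i: "spoke y f1 b1" "spoke y f2 b2" "spoke y f3 b3" and ne: "f1 \<noteq> f2" "f1 \<noteq> f3" "f2 \<noteq> f3"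
    and h: "hard b1" "hard b2" "hard b3"
  shows "7 * w y \<le> base_credit y f1 + base_credit y f2 + base_credit y f3"
proof -
  have sl: "slots b1 \<noteq> {}" "slots b2 \<noteq> {}" "slots b3 \<noteq> {}" using spoke(5) i by blast+
  obtain v1 d1 q1 p1 where H1: "hard_end b1 v1 d1 q1 p1" using hardE[OF spoke(3)[OF i(1)] h(1) sl(1)] .
  obtain v2 d2 q2 p2 where H2: "hard_end b2 v2 d2 q2 p2" using hardE[OF spoke(3)[OF i(2)] h(2) sl(2)] .
  obtain v3 d3 q3 p3 where H3: "hard_end b3 v3 d3 q3 p3" using hardE[OF spoke(3)[OF i(3)] h(3) sl(3)] .
  note sy = ne[symmetric]
  have C: ?thesis if "d1 = b2 \<or> d2 = b1 \<or> d1 = b3 \<or> d3 = b1 \<or> d2 = b3 \<or> d3 = b2"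
    using that hub_credit_mates[OF i ne H2 H3] hub_credit_mates[OF i(1,3,2) ne(2,1) sy(3) H3 H2]
      hub_credit_mates[OF i(2,1,3) sy(1) ne(3,2) H1 H3] hub_credit_mates[OF i(2,3,1) ne(3) sy(1,2) H3 H1]
      hub_credit_mates[OF i(3,1,2) sy(2,3) ne(1) H1 H2] hub_credit_mates[OF i(3,2,1) sy(3,2,1) H2 H1] by auto
  show ?thesis
  proof (cases "d1 = b2 \<or> d2 = b1 \<or> d1 = b3 \<or> d3 = b1 \<or> d2 = b3 \<or> d3 = b2")
    case True then show ?thesis by (rule C)
  next
    case False
    then have d: "d1 \<noteq> b2" "d2 \<noteq> b1" "d1 \<noteq> b3" "d3 \<noteq> b1" "d2 \<noteq> b3" "d3 \<noteq> b2" by auto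
    have I: "b1 \<in> I" "b2 \<in> I" "b3 \<in> I" using spoke(3) i by blast+
    have q: "nbI q1 = {b1}" "nbI q2 = {b2}" "nbI q3 = {b3}" "nbI p1 = {d1}" "nbI p2 = {d2}" "nbI p3 = {d3}"
      "q1 \<notin> I" "q2 \<notin> I" "q3 \<notin> I"
      using hard_end(1,2,9)[OF H1] hard_end(1,2,9)[OF H2] hard_end(1,2,9)[OF H3] by auto
    have X: "q2 \<notin> {b1, p1}" "q3 \<notin> {b1, p1}" "q1 \<notin> {b2, p2}" "q3 \<notin> {b2, p2}" "q1 \<notin> {b3, p3}" "q2 \<notin> {b3, p3}"
      using q I d by auto
    note F1 = spoke_hard_end_ne(1)[OF _ H1] and F2 = spoke_hard_end_ne(1)[OF _ H2] and F3 = spoke_hard_end_ne(1)[OF _ H3]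
    note Q = spoke_hard_end_ne(2)[OF i(1)] spoke_hard_end_ne(2)[OF i(2)] spoke_hard_end_ne(2)[OF i(3)]
    have "b1 \<noteq> b2" "b1 \<noteq> b3" "b2 \<noteq> b3"
      using spoke_hard_end_ne_b[OF i(1,2) ne(1) H2] spoke_hard_end_ne_b[OF i(1,3) ne(2) H3] spoke_hard_end_ne_b[OF i(2,3) ne(3) H3] by auto
    then have qq: "q1 \<noteq> q2" "q1 \<noteq> q3" "q2 \<noteq> q3" using q by auto
    have u1: "\<not> (E q1 f2 \<and> E q1 f3)" "\<not> (E q1 f2 \<and> E q1 q2)" "\<not> (E q1 f2 \<and> E q1 q3)"
      "\<not> (E q1 f3 \<and> E q1 q2)" "\<not> (E q1 f3 \<and> E q1 q3)" "\<not> (E q1 q2 \<and> E q1 q3)"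
      using hard_end(10)[OF H1, of f2 f3] hard_end(10)[OF H1, of f2 q2] hard_end(10)[OF H1, of f2 q3] hard_end(10)[OF H1, of f3 q2]
       hard_end(10)[OF H1, of f3 q3] hard_end(10)[OF H1, of q2 q3] F1[OF i(2)] F1[OF i(3)] X ne qq Q(2,3)[OF H2] Q(2,3)[OF H3] by blast+
    have u2: "\<not> (E q2 f1 \<and> E q2 f3)" "\<not> (E q2 f1 \<and> E q2 q1)" "\<not> (E q2 f1 \<and> E q2 q3)"
      "\<not> (E q2 f3 \<and> E q2 q1)" "\<not> (E q2 f3 \<and> E q2 q3)" "\<not> (E q2 q1 \<and> E q2 q3)"
      using hard_end(10)[OF H2, of f1 f3] hard_end(10)[OF H2, of f1 q1] hard_end(10)[OF H2, of f1 q3] hard_end(10)[OF H2, of f3 q1]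
       hard_end(10)[OF H2, of f3 q3] hard_end(10)[OF H2, of q1 q3] F2[OF i(1)] F2[OF i(3)] X ne qq Q(1,3)[OF H1] Q(1,3)[OF H3] by blast+
    have u3: "\<not> (E q3 f1 \<and> E q3 f2)" "\<not> (E q3 f1 \<and> E q3 q1)" "\<not> (E q3 f1 \<and> E q3 q2)"
      "\<not> (E q3 f2 \<and> E q3 q1)" "\<not> (E q3 f2 \<and> E q3 q2)" "\<not> (E q3 q1 \<and> E q3 q2)"
      using hard_end(10)[OF H3, of f1 f2] hard_end(10)[OF H3, of f1 q1] hard_end(10)[OF H3, of f1 q2] hard_end(10)[OF H3, of f2 q1]
       hard_end(10)[OF H3, of f2 q2] hard_end(10)[OF H3, of q1 q2] F3[OF i(1)] F3[OF i(2)] X ne qq Q(1,2)[OF H1] Q(1,2)[OF H2] by blast+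
    have sym: "E q1 q2 = E q2 q1" "E q1 q3 = E q3 q1" "E q2 q3 = E q3 q2" using E_commute by auto
    \<comment> \<open>Each \<open>qi\<close> has at most one conflict. If all three pairs are in
      conflict, each \<open>qi\<close> causes exactly one and no edge \<open>qi qj\<close> occurs,
      so the conflicts run around a 3-cycle in one of two directions.\<close>
    consider "\<not> E q1 f2" "\<not> E q2 f1" "\<not> E q1 q2" | "\<not> E q1 f3" "\<not> E q3 f1" "\<not> E q1 q3"
      | "\<not> E q2 f3" "\<not> E q3 f2" "\<not> E q2 q3" | "E q1 f2" "E q2 f3" "E q3 f1" | "E q1 f3" "E q3 f2" "E q2 f1"
      using u1 u2 u3 sym by satx
    then show ?thesis
    proof cases
      case 1 from hard_end_two_keep[OF i(1,2) ne(1) H1 H2 1] show ?thesis using base_credit_ge[OF i(3)] by linarith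
    next
      case 2 from hard_end_two_keep[OF i(1,3) ne(2) H1 H3 2] show ?thesis using base_credit_ge[OF i(2)] by linarith
    next
      case 3 from hard_end_two_keep[OF i(2,3) ne(3) H2 H3 3] show ?thesis using base_credit_ge[OF i(1)] by linarith
    next
      case 4 show ?thesis by (rule hub_credit_hard3_cycle[OF i ne H1 H2 H3 4 d(1,3)])
    next
      case 5 from hub_credit_hard3_cycle[OF i(1,3,2) ne(2,1) sy(3) H1 H3 H2 5 d(3,1)] show ?thesis by simp
    qed
  qed
qed

lemma hub_credit:
  assumes i: "spoke y f1 b1" "spoke y f2 b2" "spoke y f3 b3" and ne: "f1 \<noteq> f2" "f1 \<noteq> f3" "f2 \<noteq> f3"
  shows "7 * w y \<le> base_credit y f1 + base_credit y f2 + base_credit y f3 \<or> exceptional y f3 f1 f2 \<or> exceptional y f1 f2 f3 \<or> exceptional y f2 f1 f3"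
proof -
  note sy = ne[symmetric]
  consider "twins b1 b2" | "twins b1 b3" | "twins b2 b3" | "\<not> twins b1 b2" "\<not> twins b1 b3" "\<not> twins b2 b3" by blast
  then show ?thesis
  proof cases
    case 1 then show ?thesis using hub_credit_twins[OF i ne 1] by blast
  next
    case 2 then show ?thesis using hub_credit_twins[OF i(1,3,2) ne(2,1) sy(3) 2] by (auto simp: algebra_simps)
  next
    case 3 then show ?thesis using hub_credit_twins[OF i(2,3,1) ne(3) sy(1,2) 3] by (auto simp: algebra_simps)
  next
    case 4
    have K: "\<not> twins b2 b1" "\<not> twins b3 b1" "\<not> twins b3 b2" using 4 twins_sym by blast+
    have sl: "slots b1 \<noteq> {}" "slots b2 \<noteq> {}" "slots b3 \<noteq> {}" using spoke(5) i by blast+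
    have "7 * w y \<le> base_credit y f1 + base_credit y f2 + base_credit y f3"
    proof (cases "hard b1"; cases "hard b2"; cases "hard b3")
      assume h: "\<not> hard b1" "\<not> hard b2" "\<not> hard b3"
      obtain U1 S1 c1 U2 S2 c2 U3 S3 c3 where s: "safe_opt b1 U1 S1 c1" "safe_opt b2 U2 S2 c2" "safe_opt b3 U3 S3 c3"
        using soft_option[OF spoke(3)[OF i(1)] h(1) sl(1)] soft_option[OF spoke(3)[OF i(2)] h(2) sl(2)]
          soft_option[OF spoke(3)[OF i(3)] h(3) sl(3)] by blast
      show ?thesis by (rule hub_credit_soft3[OF i ne s 4])
    next
      assume "\<not> hard b1" "\<not> hard b2" "hard b3" then show ?thesis by (rule hub_credit_hard1[OF i ne 4(1)])
    next
      assume h: "\<not> hard b1" "hard b2" "\<not> hard b3"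
      from hub_credit_hard1[OF i(1,3,2) ne(2,1) sy(3) 4(2) h(1,3,2)] show ?thesis by simp
    next
      assume h: "hard b1" "\<not> hard b2" "\<not> hard b3"
      from hub_credit_hard1[OF i(2,3,1) ne(3) sy(1,2) 4(3) h(2,3,1)] show ?thesis by simp
    next
      assume "\<not> hard b1" "hard b2" "hard b3" then show ?thesis by (rule hub_credit_hard2[OF i ne])
    next
      assume h: "hard b1" "\<not> hard b2" "hard b3"
      from hub_credit_hard2[OF i(2,1,3) sy(1) ne(3,2) h(2,1,3)] show ?thesis by simp
    next
      assume h: "hard b1" "hard b2" "\<not> hard b3"
      from hub_credit_hard2[OF i(3,1,2) sy(2,3) ne(1) h(3,1,2)] show ?thesis by simp
    next
      assume "hard b1" "hard b2" "hard b3" then show ?thesis by (rule hub_credit_hard3[OF i ne])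
    qed
    then show ?thesis ..
  qed
qed

section \<open>Vertices with three neighbours in the independent set\<close>

lemma core_card: assumes "b \<in> I" "x \<in> core b" shows "card (nbI x) \<noteq> 3"
  using assms priv_E[of x] unfolding core_def bad_def dbl_def by fastforce

lemma triple_star:
  assumes U: "swappable U S" "nbI z \<subseteq> U" and z: "z \<in> V - I" "z \<notin> S" "nonadj z S"
  shows "w z + sum w S \<le> sum w U"
proof -
  have "swappable U (insert z S)" using U z by (simp add: swappable_def independent_insert)
  then have "sum w (insert z S) \<le> sum w U" by (rule swappable_le)
  then show ?thesis using z(2) swappable_finite[OF U(1)] by simp
qed

lemma triple_star3:
  assumes z: "nbI z = {u1, u2, u3}"
    and o: "opt u1 U1 S1 c1" "opt u2 U2 S2 c2" "opt u3 U3 S3 c3"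
    and S: "apart S1 S2" "apart S1 S3" "apart S2 S3" "nonadj z S1" "nonadj z S2" "nonadj z S3"
      "z \<notin> S1" "z \<notin> S2" "z \<notin> S3"
  shows "w z \<le> slack u1 + slack u2 + slack u3 + (c1 + c2 + c3)"
proof -
  have s: "swappable U1 S1" "swappable U2 S2" "swappable U3 S3" using o by (auto simp: opt_def)
  note s2 = swappable_Un[OF s(1,2) S(1)]
  have a: "apart (S1 \<union> S2) S3" using S by (simp add: apart_simps(5))
  note s3 = swappable_Un[OF s2(1) s(3) a]
  have "z \<in> V - I" using swappable_single[OF z] by (auto simp: swappable_def)
  then have "w z + sum w (S1 \<union> S2 \<union> S3) \<le> sum w (U1 \<union> U2 \<union> U3)"
    by (intro triple_star[OF s3(1)]) (use o S z in \<open>auto simp: opt_def nonadj_simps\<close>)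
  then show ?thesis using o s2(2) s3(2) by (simp add: opt_def)
qed

text \<open>Of the three exchanges in \<open>triple_free\<close>, each end uses the unprimed option
  twice and the primed one once; hence the cost \<open>2 * c + c'\<close>. At a hard end these are
  dropping and keeping.\<close>

definition triple_opts :: "'a \<Rightarrow> 'a set \<Rightarrow> 'a set \<Rightarrow> real \<Rightarrow> 'a set \<Rightarrow> 'a set \<Rightarrow> real \<Rightarrow> bool" where
  "triple_opts b U S c U' S' c' \<longleftrightarrow> opt b U S c \<and> secure b S \<and> opt b U' S' c' \<and> (S' = S \<or> S' = priv b) \<and> 2 * c + c' \<le> bonus b"

lemma triple_opts_exists: assumes b: "b \<in> I" "slots b \<noteq> {}"
  obtains U S c U' S' c' where "triple_opts b U S c U' S' c'"
proof (cases "hard b")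
  case True
  then obtain v b' q q' where h: "hard_end b v b' q q'" using hardE b by blast
  have "secure b {}" by (simp add: secure_def)
  moreover have "2 * w q \<le> bonus b" "priv b = {q}" using hard_end(11)[OF h] h by (auto simp: hard_end_def)
  ultimately show ?thesis using that opt_drop[OF b(1)] opt_keep[OF b(1)] unfolding triple_opts_def by fastforce
next
  case False
  obtain U S c where s: "safe_opt b U S c" using soft_option[OF b(1) False b(2)] by blast
  have o: "opt b U S c" "secure b S" "0 \<le> c" "4 * c \<le> bonus b" using s safe_opt_secure[OF s] by (auto simp: safe_opt_def)
  then have "triple_opts b U S c U S c" by (simp add: triple_opts_def)
  then show ?thesis by (rule that)
qed

lemma secure_z: assumes "b \<in> I" "slots b \<noteq> {}" "card (nbI z) = 3" "z \<notin> I" "secure b S"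
  shows "nonadj z S" "z \<notin> S"
proof -
  have "z \<notin> zone b" using zone_cases[OF assms(1,2), of z] assms(3) by auto
  then show "nonadj z S" using assms(4,5) E_sym unfolding secure_def nonadj_def by blast
  show "z \<notin> S" using assms core_card unfolding secure_def by blast
qed

text \<open>Adds three exchanges, each using the primed option at only one end. Two hard ends
  therefore never keep their private neighbours simultaneously.\<close>

lemma triple_free:
  assumes z: "nbI z = {u1, u2, u3}" "u1 \<noteq> u2" "u1 \<noteq> u3" "u2 \<noteq> u3"
    and K: "\<not> twins u1 u2" "\<not> twins u1 u3" "\<not> twins u2 u3"
  shows "3 * w z \<le> (3 * slack u1 + bonus u1) + (3 * slack u2 + bonus u2) + (3 * slack u3 + bonus u3)"
proof -
  have c3: "card (nbI z) = 3" using z by simp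
  have zI: "z \<notin> I" using c3 nbI_I by fastforce
  have uI: "u \<in> I \<and> E u z \<and> slots u \<noteq> {}" if "u \<in> {u1, u2, u3}" for u
  proof -
    have "u \<in> nbI z" using that z by simp
    then have "E u z" "u \<in> I" using nbI_E by auto
    then show ?thesis using c3 by (auto simp: slots_def trp_def)
  qed
  have I: "u1 \<in> I" "u2 \<in> I" "u3 \<in> I" "slots u1 \<noteq> {}" "slots u2 \<noteq> {}" "slots u3 \<noteq> {}" using uI by auto
  obtain U1 S1 c1 U1' S1' c1' where p1: "triple_opts u1 U1 S1 c1 U1' S1' c1'" using triple_opts_exists[OF I(1,4)] .
  obtain U2 S2 c2 U2' S2' c2' where p2: "triple_opts u2 U2 S2 c2 U2' S2' c2'" using triple_opts_exists[OF I(2,5)] .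
  obtain U3 S3 c3 U3' S3' c3' where p3: "triple_opts u3 U3 S3 c3 U3' S3' c3'" using triple_opts_exists[OF I(3,6)] .
  have se: "secure u1 S1" "secure u2 S2" "secure u3 S3" using p1 p2 p3 by (auto simp: triple_opts_def)
  have o: "opt u1 U1 S1 c1" "opt u2 U2 S2 c2" "opt u3 U3 S3 c3" "opt u1 U1' S1' c1'" "opt u2 U2' S2' c2'" "opt u3 U3' S3' c3'"
    using p1 p2 p3 by (auto simp: triple_opts_def)
  have K': "\<not> twins u2 u1" "\<not> twins u3 u1" "\<not> twins u3 u2" using K twins_sym by blast+
  have ap: "apart S (priv b')" "secure b' S' \<Longrightarrow> apart S S'"
    if "secure b S" "b \<in> {u1, u2, u3}" "b' \<in> {u1, u2, u3}" "b \<noteq> b'" for b b' S S'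
  proof -
    have "\<not> twins b b'" using that K K' by auto
    then show "apart S (priv b')" "secure b' S' \<Longrightarrow> apart S S'"
      using secure_apart[of b b' S] uI[OF that(2)] uI[OF that(3)] that by blast+
  qed
  have A: "apart S1 S2" "apart S1 S3" "apart S2 S3" using ap(2) se z by blast+
  have A': "apart S1 S2'" "apart S1 S3'" "apart S2 S3'" "apart S2 S1'" "apart S3 S1'" "apart S3 S2'"
    using ap se z p1 p2 p3 unfolding triple_opts_def by blast+
  have A'': "apart S1' S2" "apart S1' S3" "apart S2' S3" using A' apart_commute by blast+
  have N: "nonadj z S1" "nonadj z S2" "nonadj z S3" "z \<notin> S1" "z \<notin> S2" "z \<notin> S3"
    using secure_z[OF _ _ c3 zI] I se by blast+
  have P: "nonadj z (priv u)" "z \<notin> priv u" if "u \<in> {u1, u2, u3}" for u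
    using nonadj_common[of u z "priv u"] priv_E[of _ u] uI[OF that] c3 by auto
  have N': "nonadj z S1'" "nonadj z S2'" "nonadj z S3'" "z \<notin> S1'" "z \<notin> S2'" "z \<notin> S3'"
    using N P p1 p2 p3 unfolding triple_opts_def by blast+
  have "w z \<le> slack u1 + slack u2 + slack u3 + (c1' + c2 + c3)"
    by (rule triple_star3[OF z(1) o(4,2,3)]) (rule A A'' A' N N')+
  moreover have "w z \<le> slack u1 + slack u2 + slack u3 + (c1 + c2' + c3)"
    by (rule triple_star3[OF z(1) o(1,5,3)]) (rule A A'' A' N N')+
  moreover have "w z \<le> slack u1 + slack u2 + slack u3 + (c1 + c2 + c3')"
    by (rule triple_star3[OF z(1) o(1,2,6)]) (rule A A'' A' N N')+
  moreover have "2 * c1 + c1' \<le> bonus u1" "2 * c2 + c2' \<le> bonus u2" "2 * c3 + c3' \<le> bonus u3"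
    using p1 p2 p3 by (auto simp: triple_opts_def)
  ultimately show ?thesis by linarith
qed

text \<open>The private neighbours of \<open>a\<close> and \<open>b\<close> can both be kept. If
  \<open>k\<close> is hard and its \<open>q3\<close> cannot be kept too, then \<open>q3\<close> is
  adjacent to \<open>qa\<close> and thereby saturated, and the blocked centre joins the
  exchange.\<close>

lemma triple_twin_config:
  assumes z: "nbI z = {a, b, k}" "a \<noteq> b" "a \<noteq> k" "b \<noteq> k"
    and K: "twin_config a b u va vb q qa qb" "E va qb"
  shows "3 * w z \<le> (3 * slack a + bonus a) + (3 * slack b + bonus b) + (3 * slack k + bonus k)"
proof -
  have c: "config u a b va vb q qa qb" and p: "priv a = {qa}" "priv b = {qb}" using K by (auto simp: twin_config_def)
  note f = config_facts[OF c]
  have cc: "nbI va = {u, a}" "nbI vb = {u, b}" "va \<noteq> vb" "u \<noteq> a" "u \<noteq> b" "priv u = {q}" "bad u = {va, vb}" "blocked u" "bad a = {va}" "bad b = {vb}" "E q qa"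
    using c K by (auto simp: config_def twin_config_def)
  have c3: "card (nbI z) = 3" using z by simp
  have zI: "z \<notin> I" using c3 nbI_I by fastforce
  have zV: "z \<in> V - I" using swappable_single[OF z(1)] by (auto simp: swappable_def)
  have uI: "u \<in> I \<and> E u z \<and> slots u \<noteq> {}" if "u \<in> {a, b, k}" for u
  proof -
    have "u \<in> nbI z" using that z by simp
    then have "E u z" "u \<in> I" using nbI_E by auto
    then show ?thesis using c3 by (auto simp: slots_def trp_def)
  qed
  then have I: "a \<in> I" "b \<in> I" "k \<in> I" "slots a \<noteq> {}" "slots b \<noteq> {}" "slots k \<noteq> {}" and Ez: "E a z" "E b z" "E k z" by auto
  have uk: "k \<noteq> u" using end_card[OF I(3,6)] cc(8) by (auto simp: blocked_def)
  have nz: "z \<noteq> q" "z \<noteq> qa" "z \<noteq> qb" "z \<noteq> va" "z \<noteq> vb" using c3 f(18,19,20) cc by auto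
  have P: "nonadj z (priv u)" "z \<notin> priv u" if "u \<in> {a, b, k}" for u
    using nonadj_common[of u z "priv u"] priv_E[of _ u] uI[OF that] c3 by auto
  have bn: "0 \<le> bonus a" "0 \<le> bonus b" "0 \<le> bonus k" "0 \<le> slack u" "0 \<le> slack a" "0 \<le> slack b" using bonus_nonneg slack_nonneg I f(1) by auto
  show ?thesis
  proof (cases "hard k")
    case False
    obtain U S d where s: "safe_opt k U S d" using soft_option[OF I(3) False I(6)] by blast
    have nk: "\<not> twins k a" "\<not> twins k b"
    proof -
      have o: "other a va = u" "other b vb = u" using other_eq(2)[of va a u] other_eq(2)[of vb b u] cc by (auto simp: insert_commute)
      have "other k v \<noteq> u" if "v \<in> bad k" for v
      proof
        assume "other k v = u"
        then have "v \<in> bad u" "nbI v = {k, u}" using badE[OF that I(3)] by metis+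
        then show False using cc z by (auto simp: doubleton_eq_iff)
      qed
      then show "\<not> twins k a" "\<not> twins k b" using o cc(9,10) by (auto simp: twins_def)
    qed
    have "w z \<le> slack a + slack b + slack k + (0 + 0 + d)"
    proof (rule triple_star3[OF z(1) opt_keep[OF I(1)] opt_keep[OF I(2)]])
      show "opt k U S d" using s by (simp add: safe_opt_def)
      show "apart (priv a) (priv b)" using p f(6) by (simp add: independent_simps)
      have "apart S (priv a)" "apart S (priv b)"
        using secure_apart(1)[OF I(3,6) _ _ _ _ safe_opt_secure[OF s]] I nk z by blast+
      then show "apart (priv a) S" "apart (priv b) S" using apart_commute by blast+
      show "nonadj z S" "z \<notin> S" using secure_z[OF I(3,6) c3 zI safe_opt_secure[OF s]] by auto
    qed (use P in auto)
    moreover have "4 * d \<le> bonus k" "0 \<le> d" using s by (auto simp: safe_opt_def)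
    ultimately show ?thesis using bn by linarith
  next
    case True
    obtain v d q3 p3 where h: "hard_end k v d q3 p3" using hardE[OF I(3) True I(6)] .
    have p3: "priv k = {q3}" using h by (simp add: hard_end_def)
    note hf = hard_end[OF h]
    have n3: "q3 \<noteq> q" "q3 \<noteq> va" "q3 \<noteq> vb" "q3 \<noteq> qa" "q3 \<noteq> qb" "q3 \<notin> I" "z \<noteq> q3" using hf(1,9) f(18,19,20) cc(1,2,4,5) uk z c3 by auto
    have nqb: "\<not> E qb q3" using twin_config_nbrs(1)[OF K, of q3] n3 f(3) by blast
    show ?thesis
    proof (cases "E qa q3")
      case False
      have "w z \<le> slack a + slack b + slack k + (0 + 0 + 0)"
        by (rule triple_star3[OF z(1) opt_keep[OF I(1)] opt_keep[OF I(2)] opt_keep[OF I(3)]])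
          (use P[of a] P[of b] P[of k] p p3 False nqb f(6) in \<open>simp_all add: independent_simps\<close>)
      then show ?thesis using bn by linarith
    next
      case True
      have "d \<noteq> a"
      proof
        assume "d = a"
        then have "v = va" "nbI v = {k, a}" using hf(14) cc(9) h by (auto simp: hard_end_def)
        then show False using cc(1) uk z(3) by (auto simp: doubleton_eq_iff)
      qed
      then have "qa \<notin> {k, p3}" using f(19) hf(2) nbI_I[OF I(3)] by auto
      then have Q: "x \<in> {k, p3, qa}" if "E q3 x" for x
        using hf(10)[of qa x] that E_sym[OF True] by blast
      have px: "x \<notin> {k, p3, qa}" if "x \<in> {va, vb}" for x
      proof -
        have "card (nbI x) = 2" using that cc by auto
        then show ?thesis using hf(2) f(19) nbI_I[OF I(3)] by auto
      qed
      have n1: "\<not> E va q3" "\<not> E vb q3" using Q[of va] Q[of vb] px E_sym by blast+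
      have n2: "\<not> E q q3" using f(4)[of q3] n3 f(1) by blast
      have n4: "\<not> E va q" "\<not> E vb q" "\<not> E va vb"
        using triangle_free[of va u q] triangle_free[of vb u q] triangle_free[of va u vb]
          f(7,8,11) E_sym[OF f(7)] E_sym[OF f(8)] by auto
      have n5: "\<not> E z va" "\<not> E z vb" "\<not> E z q" "\<not> E z q3"
        using triangle_free[of z a va] triangle_free[of z b vb] triangle_free[of z k q3] E_sym[OF Ez(1)] E_sym[OF Ez(2)] E_sym[OF Ez(3)]
          f(9,10) hf(3) f(4)[of z] nz E_sym[of z q] zI f(1) by auto
      have qV: "q \<in> V - I" using cc(6) priv_sub[of u] by blast
      have sw: "swappable {a, u, b, k} {va, vb, q, q3}"
        using n1 n2 n4 cc(1,2) f(1,2,3,16,17,18) hf(1,9) I qV by (simp add: swappable_def independent_simps)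
      \<comment> \<open>\<open>qa\<close> and \<open>qb\<close> are replaced by \<open>va\<close>
        and \<open>vb\<close>, at a loss of the two private weights minus the two excesses, one
        eighth of the two bonuses.\<close>
      have "w z + sum w {va, vb, q, q3} \<le> sum w {a, u, b, k}"
        by (rule triple_star[OF sw]) (use z zV nz n3 n5 in \<open>simp_all add: nonadj_simps\<close>)
      moreover have "q \<noteq> va" "q \<noteq> vb" using f(18) cc by auto
      ultimately have "w z + w va + w vb + w q + w q3 \<le> w a + w u + w b + w k" using cc(3-5) z uk n3 by simp
      moreover have "w u = slack u + w q" "w a = slack a + w qa" "w b = slack b + w qb" "w k = slack k + w q3"
        using p cc(6) p3 by (simp_all add: slack_def)
      moreover have "excess va = w va - slack u - slack a" "excess vb = w vb - slack u - slack b"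
        using excess_eq[OF cc(1,4)] excess_eq[OF cc(2,5)] by auto
      moreover have "bonus a = 8 * w qa - 8 * excess va" "bonus b = 8 * w qb - 8 * excess vb" using K(1) by (auto simp: twin_config_def)
      ultimately show ?thesis using bn slack_nonneg[OF I(3)] by linarith
    qed
  qed
qed

lemma triple_twins:
  assumes z: "nbI z = {a, b, k}" "a \<noteq> b" "a \<noteq> k" "b \<noteq> k" and K: "twins a b"
  shows "3 * w z \<le> (3 * slack a + bonus a) + (3 * slack b + bonus b) + (3 * slack k + bonus k)"
proof -
  have c3: "card (nbI z) = 3" using z by simp
  have uI: "u \<in> I \<and> slots u \<noteq> {}" if "u \<in> {a, b, k}" for u
  proof -
    have "u \<in> nbI z" using that z by simp
    then have "E u z" "u \<in> I" using nbI_E by auto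
    then show ?thesis using c3 by (auto simp: slots_def trp_def)
  qed
  obtain u va vb q qa qb where k: "twin_config a b u va vb q qa qb"
    using twins_twin_config[of a b] uI z(2) K by (metis insertI1 insertI2)
  show ?thesis
  proof (cases "E va qb")
    case True show ?thesis by (rule triple_twin_config[OF z k True])
  next
    case False
    then have e: "E vb qa" using twin_config_conflict[OF k] by simp
    have z': "nbI z = {b, a, k}" using z(1) by auto
    from triple_twin_config[OF z' z(2)[symmetric] z(4,3) twin_config_sym[OF k] e] show ?thesis by simp
  qed
qed

lemma triple:
  assumes z: "nbI z = {u1, u2, u3}" "u1 \<noteq> u2" "u1 \<noteq> u3" "u2 \<noteq> u3"
  shows "3 * w z \<le> (3 * slack u1 + bonus u1) + (3 * slack u2 + bonus u2) + (3 * slack u3 + bonus u3)"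
proof -
  have z': "nbI z = {u1, u3, u2}" "nbI z = {u2, u3, u1}" using z(1) by auto
  show ?thesis
    using triple_free[OF z] triple_twins[OF z] triple_twins[OF z'(1) z(3,2) z(4)[symmetric]]
      triple_twins[OF z'(2) z(4) z(2)[symmetric] z(3)[symmetric]] by argo
qed

section \<open>The weighted inequality\<close>

text \<open>A neighbour leading to another hub is raised, if necessary, to whatever the other two
  base credits leave open; \<open>credit_edge\<close> shows that both hubs can do so.\<close>

definition credit :: "'a \<Rightarrow> 'a \<Rightarrow> real" where
  "credit y f = (if hub (other y f) then max (5 * gap y f) (7 * w y - sum (base_credit y) (dbl y - {f})) else base_credit y f)"

lemma hub_spokes: assumes "y \<in> I" "hub y" "f1 \<in> dbl y"
  obtains f2 f3 where "dbl y = {f1, f2, f3}" "f1 \<noteq> f2" "f1 \<noteq> f3" "f2 \<noteq> f3"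
    "spoke y f1 (other y f1)" "spoke y f2 (other y f2)" "spoke y f3 (other y f3)"
proof -
  obtain g1 g2 g3 where g: "dbl y = {g1, g2, g3}" "g1 \<noteq> g2" "g1 \<noteq> g3" "g2 \<noteq> g3"
    using assms(2) unfolding hub_def card_3_iff by blast
  have "\<exists>f2 f3. dbl y = {f1, f2, f3} \<and> f1 \<noteq> f2 \<and> f1 \<noteq> f3 \<and> f2 \<noteq> f3"
  proof -
    consider "f1 = g1" | "f1 = g2" | "f1 = g3" using assms(3) g(1) by auto
    then show ?thesis
    proof cases
      case 1 then show ?thesis using g by blast
    next
      case 2 then have "dbl y = {f1, g1, g3}" using g(1) by auto
      then show ?thesis using g 2 by metis
    next
      case 3 then have "dbl y = {f1, g1, g2}" using g(1) by auto
      then show ?thesis using g 3 by metis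
    qed
  qed
  then show ?thesis using that assms by (auto simp: spoke_def)
qed

text \<open>Since \<open>f\<close> leads to a hub, only the exception charged to \<open>f\<close>
  itself can occur, and then the neighbour \<open>g\<close> already contributes
  \<open>7 * gap y g\<close>.\<close>

lemma credit_cases: assumes i: "spoke y f b" and A: "hub b"
  shows "credit y f \<le> 5 * gap y f \<or> (\<exists>g b' q. weird y f g b' q \<and> credit y f \<le> 7 * w y - 7 * gap y g)"
proof -
  have y: "y \<in> I" "hub y" "f \<in> dbl y" using i by (auto simp: spoke_def)
  obtain f2 f3 where f: "dbl y = {f, f2, f3}" "f \<noteq> f2" "f \<noteq> f3" "f2 \<noteq> f3" and
    it: "spoke y f (other y f)" "spoke y f2 (other y f2)" "spoke y f3 (other y f3)" using hub_spokes[OF y] .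
  have ob: "other y f = b" using spoke(17)[OF i] .
  have "dbl y - {f} = {f2, f3}" using f by auto
  then have credit: "credit y f = max (5 * gap y f) (7 * w y - (base_credit y f2 + base_credit y f3))" using A ob f by (simp add: credit_def)
  have cf: "base_credit y f = 5 * gap y f" using A ob by (simp add: base_credit_def)
  consider "7 * w y \<le> base_credit y f + base_credit y f2 + base_credit y f3" | "exceptional y f f2 f3" | "exceptional y f3 f f2" | "exceptional y f2 f f3"
    using hub_credit[OF it f(2-4)] by blast
  then show ?thesis
  proof cases
    case 1 then show ?thesis using credit cf by simp
  next
    case 2
    then obtain g b' q where g: "weird y f g b' q" "g \<in> {f2, f3}" "12 * gap y g \<le> base_credit y g" unfolding exceptional_def by blast
    have "7 * gap y g \<le> base_credit y f2 + base_credit y f3" using g base_credit_ge[OF it(2)] base_credit_ge[OF it(3)] by auto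
    then have "credit y f \<le> 5 * gap y f \<or> credit y f \<le> 7 * w y - 7 * gap y g" using credit by auto
    then show ?thesis using g by blast
  next
    case 3 then show ?thesis using A ob by (simp add: exceptional_def)
  next
    case 4 then show ?thesis using A ob by (simp add: exceptional_def)
  qed
qed

text \<open>If one hub stays at 5, the other takes at most 7, because
  \<open>w y \<le> gap y g + gap y f\<close> at a weird hub. If both rise, \<open>weird_edge\<close>
  bounds the sum by \<open>7 * gap y f\<close>.\<close>

lemma credit_edge: assumes i: "spoke y f y'" "spoke y' f y"
  shows "credit y f + credit y' f \<le> 12 * gap y f"
proof -
  have A: "hub y'" "hub y" using i by (auto simp: spoke_def)
  have t: "gap y' f = gap y f" using spoke(17,19)[OF i(1)] spoke(17,19)[OF i(2)] by (simp add: gap_def)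
  have t0: "0 \<le> gap y f" by (rule gap_nonneg[OF i(1)])
  have W7: "credit y f \<le> 5 * gap y f \<or> credit y f \<le> 7 * gap y f" "credit y' f \<le> 5 * gap y f \<or> credit y' f \<le> 7 * gap y f"
    using credit_cases[OF i(1) A(1)] credit_cases[OF i(2) A(2)] t by (auto simp: weird_def)
  show ?thesis
  proof (cases "credit y f \<le> 5 * gap y f \<or> credit y' f \<le> 5 * gap y f")
    case True then show ?thesis using W7 t0 by linarith
  next
    case False
    then obtain g b q g' b' q' where W: "weird y f g b q" "credit y f \<le> 7 * w y - 7 * gap y g"
       "weird y' f g' b' q'" "credit y' f \<le> 7 * w y' - 7 * gap y' g'"
      using credit_cases[OF i(1) A(1)] credit_cases[OF i(2) A(2)] t by auto
    show ?thesis using weird_edge[OF i W(1,3)] W(2,4) t0 by linarith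
  qed
qed

lemma credit_sum: assumes y: "y \<in> I" "hub y" shows "7 * w y \<le> sum (credit y) (dbl y)"
proof -
  have ge: "base_credit y f \<le> credit y f" for f by (simp add: credit_def base_credit_def)
  show ?thesis
  proof (cases "\<exists>f\<in>dbl y. hub (other y f)")
    case True
    then obtain f where f: "f \<in> dbl y" "hub (other y f)" by blast
    have "sum (base_credit y) (dbl y - {f}) \<le> sum (credit y) (dbl y - {f})" by (rule sum_mono) (rule ge)
    moreover have "7 * w y - sum (base_credit y) (dbl y - {f}) \<le> credit y f" using f by (simp add: credit_def)
    ultimately show ?thesis using f by (simp add: sum.remove[OF finite_dbl f(1)])
  next
    case False
    have "dbl y \<noteq> {}" using y(2) by (auto simp: hub_def)
    then obtain f1 where "f1 \<in> dbl y" by blast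
    then obtain f2 f3 where f: "dbl y = {f1, f2, f3}" "f1 \<noteq> f2" "f1 \<noteq> f3" "f2 \<noteq> f3"
      "spoke y f1 (other y f1)" "spoke y f2 (other y f2)" "spoke y f3 (other y f3)" using hub_spokes[OF y] by metis
    have "7 * w y \<le> base_credit y f1 + base_credit y f2 + base_credit y f3" using hub_credit[OF f(5-7,2-4)] False f(1) by (auto simp: exceptional_def)
    then have "7 * w y \<le> sum (base_credit y) (dbl y)" using f(1-4) by simp
    also have "\<dots> \<le> sum (credit y) (dbl y)" by (rule sum_mono) (rule ge)
    finally show ?thesis .
  qed
qed

section \<open>Payments and the budget of each vertex\<close>

definition pay :: "'a \<Rightarrow> 'a \<Rightarrow> real" where
  "pay u v = (if hub u then 12 * w u - credit u v else 12 * slack u + (if v \<in> bad u then share u v else bonus u))"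

lemma pay_dbl: assumes "card (nbI v) = 2" shows "12 * w v \<le> sum (\<lambda>u. pay u v) (nbI v)"
proof -
  obtain u u' where n: "nbI v = {u, u'}" "u \<noteq> u'" using assms unfolding card_2_iff by blast
  have n': "nbI v = {u', u}" "u' \<noteq> u" using n by auto
  have I: "u \<in> I" "u' \<in> I" using nbI2_E[OF n(1)] by auto
  have sum: "sum (\<lambda>u. pay u v) (nbI v) = pay u v + pay u' v" using n by simp
  note o = other_eq[OF n] and o' = other_eq[OF n']
  have bn: "0 \<le> bonus u" "0 \<le> bonus u'" using bonus_nonneg I by auto
  have nA: "12 * w v \<le> pay u v + pay u' v" if "hub u" "\<not> hub u'" "nbI v = {u, u'}" "u \<noteq> u'" for u u'
  proof -
    note oo = other_eq[OF that(3,4)]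
    have it: "spoke u v u'" using oo that by (simp add: spoke_def)
    have nb: "v \<notin> bad u'" using spoke(6)[OF it] by (auto simp: bad_def)
    have "credit u v = 12 * gap u v + bonus u'" using that oo by (simp add: credit_def base_credit_def)
    then show ?thesis using that nb oo by (simp add: pay_def gap_def)
  qed
  consider "hub u" "hub u'" | "hub u" "\<not> hub u'" | "\<not> hub u" "hub u'" | "\<not> hub u" "\<not> hub u'" by blast
  then show ?thesis
  proof cases
    case 1
    have it: "spoke u v u'" "spoke u' v u" using o o' I 1 by (auto simp: spoke_def)
    have "slack u' = w u'" using spoke(19)[OF it(2)] .
    then show ?thesis using credit_edge[OF it] 1 sum o(2) by (simp add: pay_def gap_def)
  next
    case 2 then show ?thesis using nA n sum by simp
  next
    case 3 then show ?thesis using nA[OF 3(2,1) n'] sum by simp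
  next
    case 4
    note ex = excess_eq[OF n]
    show ?thesis
    proof (cases "excess v > 0")
      case True
      then have "v \<in> bad u" "v \<in> bad u'" using badI[OF n] by auto
      then show ?thesis using 4 sum ex share_pair[OF n True] by (simp add: pay_def)
    next
      case False
      then have "v \<notin> bad u" "v \<notin> bad u'" by (auto simp: bad_def)
      then show ?thesis using 4 sum ex False bn by (simp add: pay_def)
    qed
  qed
qed

lemma budget: assumes u: "u \<in> I"
  shows "sum (pay u) (dbl u) + sum (\<lambda>z. 3 * slack u + bonus u) (trp u) \<le> 29 * slack u + 8 * sum w (priv u)"
proof (cases "hub u")
  case True
  note A = hub[OF u True]
  \<comment> \<open>Three payments of \<open>12 * w u\<close>, of which \<open>credit_sum\<close>
    returns \<open>7 * w u\<close>: 36 - 7 = 29.\<close>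
  have "sum (pay u) (dbl u) = 36 * w u - sum (credit u) (dbl u)"
    using True by (simp add: pay_def sum_subtractf hub_def)
  then show ?thesis using credit_sum[OF u True] A by simp
next
  case False
  note N = card_N[OF u]
  have s: "0 \<le> slack u" using slack_nonneg[OF u] .
  have bs: "sum (\<lambda>v. if v \<in> bad u then share u v else bonus u) (dbl u)
     = sum (share u) (bad u) + card (dbl u - bad u) * bonus u"
  proof -
    have "dbl u \<inter> {v. v \<in> bad u} = bad u" "dbl u \<inter> - {v. v \<in> bad u} = dbl u - bad u" using bad_sub by auto
    then show ?thesis by (simp add: sum.If_cases)
  qed
  have split: "sum (pay u) (dbl u) = 12 * card (dbl u) * slack u + (sum (share u) (bad u) + card (dbl u - bad u) * bonus u)"
    using False by (simp add: pay_def sum.distrib bs[symmetric])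
  have t: "sum (\<lambda>z. 3 * slack u + bonus u) (trp u) = 3 * card (trp u) * slack u + card (trp u) * bonus u"
    by (simp add: algebra_simps)
  have k2: "card (dbl u) \<le> 2" using N False by (simp add: hub_def)
  \<comment> \<open>The maximum is 27, for two neighbours in \<open>dbl u\<close> and one in
    \<open>trp u\<close>.\<close>
  have "12 * card (dbl u) + 3 * card (trp u) \<le> 29" using N k2 by linarith
  then have "real (12 * card (dbl u) + 3 * card (trp u)) \<le> 29" by linarith
  then have S: "12 * card (dbl u) * slack u + 3 * card (trp u) * slack u \<le> 29 * slack u"
    using mult_right_mono[OF _ s, of "real (12 * card (dbl u) + 3 * card (trp u))" 29] by (simp add: algebra_simps)
  let ?m = "card (dbl u - bad u) + card (trp u)"
  have B: "sum (share u) (bad u) + real ?m * bonus u \<le> 8 * sum w (priv u)"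
  proof (cases "bad u = {}")
    case True
    show ?thesis
    proof (cases "priv u = {}")
      case True then show ?thesis using \<open>bad u = {}\<close> by (simp add: bonus_def)
    next
      case False
      then have "card (priv u) \<ge> 1" by (simp add: Suc_leI card_gt_0_iff)
      then have "?m \<le> 2" using N \<open>bad u = {}\<close> by simp
      then have "real ?m * bonus u \<le> 2 * bonus u" using bonus_nonneg[OF u] by (intro mult_right_mono) auto
      then show ?thesis using \<open>bad u = {}\<close> by (simp add: bonus_def)
    qed
  next
    case False
    have m: "?m \<le> 1"
    proof (cases "slots u = {}")
      case True
      then have "dbl u - bad u = {}" "trp u = {}" by (auto simp: slots_def)
      then show ?thesis by (simp only: card.empty)
    next
      case F: False
      then obtain f where f: "f \<in> (dbl u - bad u) \<union> trp u" by (auto simp: slots_def)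
      have "(dbl u - bad u) \<inter> trp u = {}" by (auto simp: dbl_def trp_def)
      then have "?m = card ((dbl u - bad u) \<union> trp u)" by (simp add: card_Un_disjoint)
      then show ?thesis using end_slot(3)[OF u False f] by simp
    qed
    then have "real ?m * bonus u \<le> 1 * bonus u" using bonus_nonneg[OF u] by (intro mult_right_mono) auto
    then show ?thesis using False by (simp add: bonus_def)
  qed
  show ?thesis unfolding split t using S B by (simp add: algebra_simps)
qed

theorem weighted_inequality:
  "0 \<le> (\<Sum>v\<in>V. w v * (59 * (if v \<in> I then 1 else 0) + 9 * real (card (nbI v)) - 30))"
proof -
  define N where "N k = {v \<in> V. v \<notin> I \<and> card (nbI v) = k}" for k
  have fin: "finite (N k)" for k using finite_V by (simp add: N_def)
  have d: "dbl u = {v \<in> N 2. E v u}" "trp u = {v \<in> N 3. E v u}" for u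
    using nbI_I E_in_V E_sym by (fastforce simp: dbl_def trp_def N_def)+
  have p: "priv u = {v \<in> N 1. E v u}" if "u \<in> I" for u
  proof -
    have "nbI v = {u} \<longleftrightarrow> card (nbI v) = 1" if "E v u" for v
    proof -
      have "u \<in> nbI v" using that \<open>u \<in> I\<close> by (simp add: nbI_def)
      then show ?thesis by (metis One_nat_def card_1_singleton_iff singletonD)
    qed
    then show ?thesis using nbI_I E_in_V E_sym unfolding priv_def N_def by fastforce
  qed
  have sw: "(\<Sum>v\<in>N k. \<Sum>u\<in>nbI v. h u v) = (\<Sum>u\<in>I. \<Sum>v\<in>{v \<in> N k. E v u}. h u v)" for k and h :: "'a \<Rightarrow> 'a \<Rightarrow> real"
    unfolding nbI_def by (rule sum.swap_restrict) (auto simp: fin)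
  have 1: "sum w (N 1) = (\<Sum>u\<in>I. sum w (priv u))"
  proof -
    have "sum w (N 1) = (\<Sum>v\<in>N 1. \<Sum>u\<in>nbI v. w v)" by (rule sum.cong) (auto simp: N_def)
    also have "\<dots> = (\<Sum>u\<in>I. sum w (priv u))" unfolding sw by (rule sum.cong) (simp_all add: p)
    finally show ?thesis .
  qed
  have 2: "12 * sum w (N 2) \<le> (\<Sum>u\<in>I. sum (pay u) (dbl u))"
  proof -
    have "12 * sum w (N 2) \<le> (\<Sum>v\<in>N 2. \<Sum>u\<in>nbI v. pay u v)"
      unfolding sum_distrib_left by (rule sum_mono) (auto simp: N_def pay_dbl)
    then show ?thesis unfolding sw d .
  qed
  have 3: "3 * sum w (N 3) \<le> (\<Sum>u\<in>I. sum (\<lambda>z. 3 * slack u + bonus u) (trp u))"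
  proof -
    have "3 * w z \<le> (\<Sum>u\<in>nbI z. 3 * slack u + bonus u)" if "z \<in> N 3" for z
    proof -
      have "card (nbI z) = 3" using that by (simp add: N_def)
      then obtain a b c where "nbI z = {a, b, c}" "a \<noteq> b" "a \<noteq> c" "b \<noteq> c" unfolding card_3_iff by blast
      then show ?thesis using triple[of z a b c] by simp
    qed
    then have "3 * sum w (N 3) \<le> (\<Sum>v\<in>N 3. \<Sum>u\<in>nbI v. 3 * slack u + bonus u)"
      unfolding sum_distrib_left by (rule sum_mono)
    then show ?thesis unfolding sw d .
  qed
  have "12 * sum w (N 2) + 3 * sum w (N 3) \<le> (\<Sum>u\<in>I. 29 * slack u + 8 * sum w (priv u))"
    using 2 3 sum_mono[OF budget, of I "\<lambda>u. u"] unfolding sum.distrib by linarith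
  also have "\<dots> = 29 * sum w I - 21 * sum w (N 1)"
    unfolding 1 slack_def sum_distrib_left sum_subtractf[symmetric] by (intro sum.cong refl) (simp flip: sum_distrib_left)
  finally have main: "0 \<le> 29 * sum w I - 21 * sum w (N 1) - 12 * sum w (N 2) - 3 * sum w (N 3)" by simp
  define F where "F v = w v * (59 * (if v \<in> I then 1 else 0) + 9 * real (card (nbI v)) - 30)" for v
  have c: "card (nbI v) \<in> {1, 2, 3}" if "v \<in> V - I" for v
  proof -
    have "card (nbI v) \<le> card {y. E v y}" by (rule card_mono) (auto simp: nbI_def)
    moreover have "card (nbI v) \<noteq> 0" using nbI_nonempty[of v] that by simp
    ultimately have "card (nbI v) = 1 \<or> card (nbI v) = 2 \<or> card (nbI v) = 3" using subcubic[of v] by linarith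
    then show ?thesis by blast
  qed
  have V: "V = I \<union> (N 1 \<union> (N 2 \<union> N 3))" using c I_subset by (auto simp: N_def)
  have dis: "I \<inter> (N 1 \<union> (N 2 \<union> N 3)) = {}" "N 1 \<inter> (N 2 \<union> N 3) = {}" "N 2 \<inter> N 3 = {}" by (auto simp: N_def)
  have "sum F V = sum F I + (sum F (N 1) + (sum F (N 2) + sum F (N 3)))"
    unfolding V using dis fin by (simp add: sum.union_disjoint)
  also have "sum F I = 29 * sum w I" unfolding sum_distrib_left by (rule sum.cong) (auto simp: F_def nbI_I)
  also have "sum F (N 1) = - 21 * sum w (N 1)" unfolding sum_distrib_left by (rule sum.cong) (auto simp: F_def N_def)
  also have "sum F (N 2) = - 12 * sum w (N 2)" unfolding sum_distrib_left by (rule sum.cong) (auto simp: F_def N_def)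
  also have "sum F (N 3) = - 3 * sum w (N 3)" unfolding sum_distrib_left by (rule sum.cong) (auto simp: F_def N_def)
  finally show ?thesis using main unfolding F_def by linarith
qed

end

section \<open>From the inequality to multicolourings\<close>

lemma compact_weight_functions:
  fixes C :: "'b set"
  assumes "finite C"
  shows "compact {\<mu> :: 'b \<Rightarrow> real. (\<forall>J\<in>C. 0 \<le> \<mu> J) \<and> (\<forall>J. J \<notin> C \<longrightarrow> \<mu> J = 0) \<and> sum \<mu> C = 1}"
proof -
  \<comment> \<open>Forcing \<open>\<mu>\<close> to vanish outside \<open>C\<close> makes every
    coordinate range compact, so Tychonoff applies on the full function space.\<close>
  let ?B = "PiE UNIV (\<lambda>J. if J \<in> C then {0..1::real} else {0})"
  have "compactin (product_topology (\<lambda>_. euclidean) UNIV) ?B"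
    unfolding compactin_PiE by auto
  then have "compact ?B" by (simp add: euclidean_product_topology)
  moreover have "continuous_on UNIV (\<lambda>\<mu> :: 'b \<Rightarrow> real. sum \<mu> C)"
    by (intro continuous_intros continuous_on_product_coordinates)
  then have "closed {\<mu> :: 'b \<Rightarrow> real. sum \<mu> C = 1}"
    by (intro closed_Collect_eq) auto
  ultimately have "compact (?B \<inter> {\<mu>. sum \<mu> C = 1})" by blast
  moreover have "?B \<inter> {\<mu>. sum \<mu> C = 1} = {\<mu>. (\<forall>J\<in>C. 0 \<le> \<mu> J) \<and> (\<forall>J. J \<notin> C \<longrightarrow> \<mu> J = 0) \<and> sum \<mu> C = 1}"
  proof -
    have "\<mu> J \<le> 1" if "\<forall>J\<in>C. 0 \<le> \<mu> J" "sum \<mu> C = 1" "J \<in> C" for \<mu> :: "'b \<Rightarrow> real" and J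
      using member_le_sum[of J C \<mu>] that assms by auto
    then show ?thesis by (auto simp: PiE_iff split: if_splits)
  qed
  ultimately show ?thesis by simp
qed

text \<open>First-order expansion of the square of \<open>max 0 r\<close>, whose derivative
  \<open>2 * max 0 r\<close> has Lipschitz constant 2; hence the error \<open>t^2\<close>.\<close>

lemma max0_square_shift: "(max 0 (r - t))\<^sup>2 \<le> (max 0 r)\<^sup>2 - 2 * t * max 0 r + t\<^sup>2" for r t :: real
proof (cases "r \<ge> 0")
  case True
  have "(max 0 (r - t))\<^sup>2 \<le> (r - t)\<^sup>2" by (auto simp: max_def)
  then show ?thesis using True by (simp add: power2_diff algebra_simps)
next
  case False
  then have "\<bar>max 0 (r - t)\<bar> \<le> \<bar>t\<bar>" by (auto simp: max_def)
  then have "(max 0 (r - t))\<^sup>2 \<le> t\<^sup>2" by (rule abs_le_square_iff[THEN iffD1])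
  then show ?thesis using False by simp
qed

text \<open>Moving mass \<open>\<delta>\<close> from \<open>J\<close> to \<open>J'\<close> changes
  the objective by at most \<open>-2 * \<delta>\<close> times the weight difference plus
  \<open>card V * \<delta>^2\<close>. A positive difference would make this negative for small
  \<open>\<delta>\<close>.\<close>

lemma optimal_distribution:
  fixes C :: "'a set set" and a :: real
  assumes C: "finite C" "C \<noteq> {}" and V: "finite V"
  obtains \<mu> where "\<And>J. J \<in> C \<Longrightarrow> 0 \<le> \<mu> J" "sum \<mu> C = 1"
    "\<And>J J'. J \<in> C \<Longrightarrow> J' \<in> C \<Longrightarrow> 0 < \<mu> J \<Longrightarrow>
      (\<Sum>v\<in>V \<inter> J'. max 0 (a - (\<Sum>J\<in>{J \<in> C. v \<in> J}. \<mu> J))) \<le> (\<Sum>v\<in>V \<inter> J. max 0 (a - (\<Sum>J\<in>{J \<in> C. v \<in> J}. \<mu> J)))"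
proof -
  define K where "K = {\<mu> :: 'a set \<Rightarrow> real. (\<forall>J\<in>C. 0 \<le> \<mu> J) \<and> (\<forall>J. J \<notin> C \<longrightarrow> \<mu> J = 0) \<and> sum \<mu> C = 1}"
  define x where "x \<mu> v = (\<Sum>J\<in>{J \<in> C. v \<in> J}. \<mu> J)" for \<mu> :: "'a set \<Rightarrow> real" and v
  define \<Phi> where "\<Phi> \<mu> = (\<Sum>v\<in>V. (max 0 (a - x \<mu> v))\<^sup>2)" for \<mu>
  have "compact K" unfolding K_def by (rule compact_weight_functions[OF C(1)])
  moreover obtain J0 where J0: "J0 \<in> C" using C by blast
  have "(\<lambda>J. if J = J0 then 1 else 0) \<in> K" using J0 C by (auto simp: K_def)
  then have "K \<noteq> {}" by blast
  moreover have "continuous_on K \<Phi>" unfolding \<Phi>_def x_def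
    by (intro continuous_intros continuous_on_subset[OF continuous_on_product_coordinates]) auto
  ultimately obtain \<mu> where \<mu>: "\<mu> \<in> K" "\<And>\<nu>. \<nu> \<in> K \<Longrightarrow> \<Phi> \<mu> \<le> \<Phi> \<nu>"
    using continuous_attains_inf by metis
  define w where "w v = max 0 (a - x \<mu> v)" for v
  have "sum w (V \<inter> J') \<le> sum w (V \<inter> J)" if J: "J \<in> C" "J' \<in> C" "0 < \<mu> J" for J J'
  proof (cases "J = J'")
    case False
    have step: "2 * (sum w (V \<inter> J') - sum w (V \<inter> J)) \<le> \<delta> * card V" if \<delta>: "0 < \<delta>" "\<delta> \<le> \<mu> J" for \<delta>
    proof -
      define \<nu> where "\<nu> = \<mu>(J := \<mu> J - \<delta>, J' := \<mu> J' + \<delta>)"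
      define d where "d v = (if v \<in> J' then 1 else 0) - (if v \<in> J then 1 else (0::real))" for v
      have \<nu>: "\<nu> L = \<mu> L + (if L = J' then \<delta> else 0) - (if L = J then \<delta> else 0)" for L
        using False by (simp add: \<nu>_def)
      have sum\<nu>: "sum \<nu> A = sum \<mu> A + (if J' \<in> A then \<delta> else 0) - (if J \<in> A then \<delta> else 0)" if "finite A" for A
        using that by (simp add: \<nu> sum.distrib sum_subtractf)
      have "\<nu> \<in> K" using \<mu>(1) J \<delta> C(1) by (auto simp: K_def sum\<nu>) (auto simp: \<nu>)
      then have "\<Phi> \<mu> \<le> \<Phi> \<nu>" by (rule \<mu>(2))
      also have "\<Phi> \<nu> \<le> (\<Sum>v\<in>V. (max 0 (a - x \<mu> v))\<^sup>2 - 2 * (\<delta> * d v) * w v + \<delta>\<^sup>2)"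
        unfolding \<Phi>_def
      proof (rule sum_mono)
        fix v assume "v \<in> V"
        have "x \<nu> v = x \<mu> v + \<delta> * d v" using C(1) J by (simp add: x_def sum\<nu> d_def)
        then have "(max 0 (a - x \<nu> v))\<^sup>2 = (max 0 (a - x \<mu> v - \<delta> * d v))\<^sup>2" by (simp add: algebra_simps)
        also have "\<dots> \<le> (max 0 (a - x \<mu> v))\<^sup>2 - 2 * (\<delta> * d v) * w v + (\<delta> * d v)\<^sup>2"
          using max0_square_shift[of "a - x \<mu> v" "\<delta> * d v"] by (simp add: w_def)
        also have "(\<delta> * d v)\<^sup>2 \<le> \<delta>\<^sup>2" by (auto simp: d_def power_mult_distrib)
        finally show "(max 0 (a - x \<nu> v))\<^sup>2 \<le> (max 0 (a - x \<mu> v))\<^sup>2 - 2 * (\<delta> * d v) * w v + \<delta>\<^sup>2" by simp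
      qed
      also have "\<dots> = \<Phi> \<mu> - 2 * \<delta> * (\<Sum>v\<in>V. d v * w v) + card V * \<delta>\<^sup>2"
        by (simp add: \<Phi>_def sum.distrib sum_subtractf sum_distrib_left mult.assoc)
      also have "(\<Sum>v\<in>V. d v * w v) = sum w (V \<inter> J') - sum w (V \<inter> J)"
        unfolding sum.inter_restrict[OF V] sum_subtractf[symmetric] by (rule sum.cong) (auto simp: d_def)
      finally have "\<delta> * (2 * (sum w (V \<inter> J') - sum w (V \<inter> J))) \<le> \<delta> * (\<delta> * card V)"
        by (simp add: algebra_simps power2_eq_square)
      then show ?thesis using \<delta>(1) by simp
    qed
    show ?thesis
    proof (rule ccontr)
      assume n: "\<not> ?thesis"
      define g where "g = sum w (V \<inter> J') - sum w (V \<inter> J)"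
      have g: "g > 0" using n by (simp add: g_def)
      \<comment> \<open>Ensures \<open>\<delta> * card V \<le> g\<close>, against the bound
        \<open>2 * g\<close> from \<open>step\<close>; the \<open>+ 1\<close> avoids division by
        zero.\<close>
      define \<delta> where "\<delta> = min (\<mu> J) (g / (card V + 1))"
      have \<delta>: "0 < \<delta>" "\<delta> \<le> \<mu> J" "\<delta> \<le> g / (card V + 1)" using g J(3) by (auto simp: \<delta>_def)
      have "2 * g \<le> \<delta> * card V" using step[OF \<delta>(1,2)] by (simp add: g_def)
      also have "\<dots> \<le> g / (card V + 1) * (card V + 1)" using \<delta> g by (intro mult_mono) auto
      also have "\<dots> = g" by simp
      finally show False using g by simp
    qed
  qed simp
  then show ?thesis using that[of \<mu>] \<mu>(1) by (simp add: K_def w_def x_def)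
qed

theorem independent_distribution:
  fixes V :: "'a set" and E :: "'a \<Rightarrow> 'a \<Rightarrow> bool"
  assumes V: "finite V" and EV: "\<And>x y. E x y \<Longrightarrow> x \<in> V" and sym: "\<And>x y. E x y \<Longrightarrow> E y x"
    and tf: "\<And>x y z. E x y \<Longrightarrow> E y z \<Longrightarrow> \<not> E x z" and deg: "\<And>x. card {y. E x y} \<le> 3"
  defines "C \<equiv> {J. J \<subseteq> V \<and> (\<forall>x\<in>J. \<forall>y\<in>J. \<not> E x y)}"
  shows "\<exists>\<mu> :: 'a set \<Rightarrow> real. (\<forall>J\<in>C. 0 \<le> \<mu> J) \<and> sum \<mu> C = 1
    \<and> (\<forall>v\<in>V. 15 / 43 \<le> (\<Sum>J\<in>{J \<in> C. v \<in> J}. \<mu> J))"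
proof -
  have finC: "finite C" unfolding C_def using V by (simp add: finite_subset[of _ "Pow V"] subset_iff)
  have "{} \<in> C" by (simp add: C_def)
  then have "C \<noteq> {}" by blast
  define a :: real where "a = 15 / 43"
  obtain \<mu> where \<mu>: "\<And>J. J \<in> C \<Longrightarrow> 0 \<le> \<mu> J" "sum \<mu> C = 1" and
    opt: "\<And>J J'. J \<in> C \<Longrightarrow> J' \<in> C \<Longrightarrow> 0 < \<mu> J \<Longrightarrow>
      (\<Sum>v\<in>V \<inter> J'. max 0 (a - (\<Sum>J\<in>{J \<in> C. v \<in> J}. \<mu> J))) \<le> (\<Sum>v\<in>V \<inter> J. max 0 (a - (\<Sum>J\<in>{J \<in> C. v \<in> J}. \<mu> J)))"
    using optimal_distribution[OF finC \<open>C \<noteq> {}\<close> V, of a] by blast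
  define x where "x v = (\<Sum>J\<in>{J \<in> C. v \<in> J}. \<mu> J)" for v
  define w where "w v = max 0 (a - x v)" for v
  define V' where "V' = {v \<in> V. 0 < w v}"
  define E' where "E' u v \<longleftrightarrow> E u v \<and> u \<in> V' \<and> v \<in> V'" for u v
  have finV': "finite V'" using V by (simp add: V'_def)
  have fE: "finite {y. E u y}" for u by (rule finite_subset[OF _ V]) (use EV sym in blast)
  have V'_sum: "sum w (V \<inter> J) = sum w (J \<inter> V')" for J
    by (rule sum.mono_neutral_right) (use V in \<open>auto simp: V'_def w_def\<close>)
  have swap: "(\<Sum>J\<in>C. \<mu> J * real (card {u \<in> J \<inter> V'. P u})) = (\<Sum>u\<in>{u \<in> V'. P u}. x u)" for P
  proof -
    have "(\<Sum>u\<in>{u \<in> V'. P u}. x u) = (\<Sum>J\<in>C. \<Sum>u\<in>{u \<in> {u \<in> V'. P u}. u \<in> J}. \<mu> J)"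
      unfolding x_def by (rule sum.swap_restrict) (use finV' finC in auto)
    also have "\<dots> = (\<Sum>J\<in>C. \<mu> J * real (card {u \<in> J \<inter> V'. P u}))"
      by (rule sum.cong) (auto simp: mult.commute intro!: arg_cong[where f = card])
    finally show ?thesis by simp
  qed
  have each: "0 \<le> (\<Sum>v\<in>V'. w v * (59 * (if v \<in> J then 1 else 0) + 9 * real (card {u \<in> J \<inter> V'. E' v u}) - 30))"
    if J: "J \<in> C" "0 < \<mu> J" for J
  proof -
    \<comment> \<open>The restriction to \<open>V'\<close> provides strictly positive weights. It
      preserves maximality: an independent set of the restricted graph is a member of
      \<open>C\<close>, and vertices of \<open>V\<close> outside \<open>V'\<close> weigh
      nothing.\<close>
    interpret max_weight_independent V' E' w "J \<inter> V'"
    proof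
      show "card {y. E' u y} \<le> 3" for u
        by (rule order_trans[OF card_mono[OF fE[of u]] deg]) (auto simp: E'_def)
      show "sum w L \<le> sum w (J \<inter> V')" if L: "L \<subseteq> V'" "\<And>x y. x \<in> L \<Longrightarrow> y \<in> L \<Longrightarrow> \<not> E' x y" for L
      proof -
        have "L \<in> C" using L by (force simp: C_def V'_def E'_def)
        then have "sum w (V \<inter> L) \<le> sum w (V \<inter> J)" using opt[OF J(1) _ J(2)] by (simp add: w_def x_def)
        moreover have "L \<inter> V' = L" using L(1) by blast
        ultimately show ?thesis by (simp add: V'_sum)
      qed
      show "\<not> E' u v" if "u \<in> J \<inter> V'" "v \<in> J \<inter> V'" for u v using that J by (auto simp: C_def E'_def)
      show "E' v u" if "E' u v" for u v using that sym[of u v] by (simp add: E'_def)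
      show "\<not> E' u z" if "E' u v" "E' v z" for u v z using that tf[of u v z] by (simp add: E'_def)
    qed (simp_all add: V E'_def V'_def)
    have "nbI v = {u \<in> J \<inter> V'. E' v u}" for v by (simp add: nbI_def)
    moreover have "v \<in> J \<inter> V' \<longleftrightarrow> v \<in> J" if "v \<in> V'" for v using that by simp
    ultimately show ?thesis using weighted_inequality by (simp cong: sum.cong)
  qed
  have "V' = {}"
  proof (rule ccontr)
    assume ne: "V' \<noteq> {}"
    have xa: "x v < a" "0 < w v" if "v \<in> V'" for v using that by (auto simp: V'_def w_def max_def split: if_splits)
    have "0 \<le> (\<Sum>J\<in>C. \<mu> J * (\<Sum>v\<in>V'. w v * (59 * (if v \<in> J then 1 else 0) + 9 * real (card {u \<in> J \<inter> V'. E' v u}) - 30)))"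
    proof (rule sum_nonneg)
      fix J assume "J \<in> C"
      then show "0 \<le> \<mu> J * (\<Sum>v\<in>V'. w v * (59 * (if v \<in> J then 1 else 0) + 9 * real (card {u \<in> J \<inter> V'. E' v u}) - 30))"
        using each[of J] \<mu>(1)[of J] by (cases "\<mu> J = 0") (auto intro!: mult_nonneg_nonneg)
    qed
    also have "\<dots> = (\<Sum>v\<in>V'. w v * (\<Sum>J\<in>C. \<mu> J * (59 * (if v \<in> J then 1 else 0) + 9 * real (card {u \<in> J \<inter> V'. E' v u}) - 30)))"
      unfolding sum_distrib_left by (subst sum.swap) (simp add: mult.left_commute)
    also have "\<dots> = (\<Sum>v\<in>V'. w v * (59 * x v + 9 * (\<Sum>u\<in>{u \<in> V'. E' v u}. x u) - 30))"
    proof (intro sum.cong refl arg_cong2[where f = "(*)"])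
      fix v assume "v \<in> V'"
      have "(\<Sum>J\<in>C. \<mu> J * (59 * (if v \<in> J then 1 else 0) + 9 * real (card {u \<in> J \<inter> V'. E' v u}) - 30))
        = 59 * (\<Sum>J\<in>C. if v \<in> J then \<mu> J else 0) + 9 * (\<Sum>J\<in>C. \<mu> J * real (card {u \<in> J \<inter> V'. E' v u})) - 30 * sum \<mu> C"
        unfolding sum_distrib_left sum.distrib[symmetric] sum_subtractf[symmetric]
        by (intro sum.cong refl) (simp add: algebra_simps)
      also have "(\<Sum>J\<in>C. if v \<in> J then \<mu> J else 0) = x v"
        unfolding x_def by (rule sum.inter_filter[OF finC, symmetric])
      finally show "(\<Sum>J\<in>C. \<mu> J * (59 * (if v \<in> J then 1 else 0) + 9 * real (card {u \<in> J \<inter> V'. E' v u}) - 30))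
        = 59 * x v + 9 * (\<Sum>u\<in>{u \<in> V'. E' v u}. x u) - 30" using \<mu>(2) unfolding swap by simp
    qed
    also have "\<dots> < (\<Sum>v\<in>V'. 0)"
    proof (rule sum_strict_mono[OF finV' ne])
      fix v assume v: "v \<in> V'"
      have "(\<Sum>u\<in>{u \<in> V'. E' v u}. x u) \<le> (\<Sum>u\<in>{u \<in> V'. E' v u}. a)"
        by (rule sum_mono) (use xa in \<open>auto simp: less_imp_le\<close>)
      also have "\<dots> \<le> 3 * a"
      proof -
        have "card {u \<in> V'. E' v u} \<le> 3"
          by (rule order_trans[OF card_mono[OF fE[of v]] deg]) (auto simp: E'_def)
        then show ?thesis by (simp add: a_def)
      qed
      finally have "59 * x v + 9 * (\<Sum>u\<in>{u \<in> V'. E' v u}. x u) - 30 < 0" using xa(1)[OF v] by (simp add: a_def)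
      then show "w v * (59 * x v + 9 * (\<Sum>u\<in>{u \<in> V'. E' v u}. x u) - 30) < 0" using xa(2)[OF v] by (simp add: mult_pos_neg)
    qed
    finally show False by simp
  qed
  then have "a \<le> x v" if "v \<in> V" for v using that by (auto simp: V'_def w_def)
  then show ?thesis using \<mu> unfolding a_def x_def by blast
qed

lemma colour_classes:
  fixes \<mu> :: "'a set \<Rightarrow> real"
  assumes C: "finite C" "\<And>J. J \<in> C \<Longrightarrow> 0 \<le> \<mu> J" "sum \<mu> C = 1"
    and cover: "\<And>v. v \<in> V \<Longrightarrow> real b \<le> real m * (\<Sum>J\<in>{J \<in> C. v \<in> J}. \<mu> J)"
  obtains A f where "real A \<le> real m + real (card C)" "m \<le> A"
    "\<And>v. v \<in> V \<Longrightarrow> f v \<subseteq> {1..A} \<and> card (f v) = b"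
    "\<And>u v. u \<in> V \<Longrightarrow> v \<in> V \<Longrightarrow> (\<And>J. J \<in> C \<Longrightarrow> \<not> (u \<in> J \<and> v \<in> J)) \<Longrightarrow> f u \<inter> f v = {}"
proof -
  \<comment> \<open>Rounding up gives every vertex enough colours and costs at most one extra colour
    per member of \<open>C\<close>.\<close>
  define n where "n J = nat \<lceil>real m * \<mu> J\<rceil>" for J
  define P where "P = (SIGMA J:C. {..<n J})"
  have finP: "finite P" using C(1) by (simp add: P_def)
  have n: "real m * \<mu> J \<le> real (n J)" "real (n J) \<le> real m * \<mu> J + 1" if "J \<in> C" for J
  proof -
    have "0 \<le> real m * \<mu> J" using C(2)[OF that] by simp
    then show "real m * \<mu> J \<le> real (n J)" "real (n J) \<le> real m * \<mu> J + 1" unfolding n_def by linarith+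
  qed
  have cardP: "card P = sum n C" using C(1) by (simp add: P_def)
  obtain h where h: "bij_betw h P {1..card P}"
    using ex_bij_betw_nat_finite_1[OF finP] bij_betw_inv by blast
  define D where "D v = h ` (P \<inter> {p. v \<in> fst p})" for v
  have D: "D v \<subseteq> {1..card P}" for v using h by (auto simp: D_def bij_betw_def)
  have cD: "b \<le> card (D v)" if "v \<in> V" for v
  proof -
    have "card (D v) = card (P \<inter> {p. v \<in> fst p})"
      unfolding D_def using h by (intro card_image) (auto simp: bij_betw_def inj_on_def)
    also have "P \<inter> {p. v \<in> fst p} = (SIGMA J:{J \<in> C. v \<in> J}. {..<n J})" by (auto simp: P_def)
    also have "card \<dots> = sum n {J \<in> C. v \<in> J}" using C(1) by simp
    finally have e: "real (card (D v)) = (\<Sum>J\<in>{J \<in> C. v \<in> J}. real (n J))" by simp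
    have "real b \<le> (\<Sum>J\<in>{J \<in> C. v \<in> J}. real m * \<mu> J)" using cover[OF that] by (simp add: sum_distrib_left)
    also have "\<dots> \<le> (\<Sum>J\<in>{J \<in> C. v \<in> J}. real (n J))" by (rule sum_mono) (use n(1) in simp)
    finally show ?thesis using e by simp
  qed
  \<comment> \<open>Vertices covered too often are trimmed to exactly \<open>b\<close>
    colours.\<close>
  have "\<exists>S. S \<subseteq> D v \<and> card S = b" if "v \<in> V" for v
    using obtain_subset_with_card_n[OF cD[OF that]] by metis
  then obtain f where f: "\<And>v. v \<in> V \<Longrightarrow> f v \<subseteq> D v \<and> card (f v) = b" by metis
  show ?thesis
  proof (rule that)
    have "real (card P) \<le> (\<Sum>J\<in>C. real m * \<mu> J + 1)" unfolding cardP of_nat_sum by (rule sum_mono) (rule n(2))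
    also have "\<dots> = real m + real (card C)" using C(3) by (simp add: sum.distrib flip: sum_distrib_left)
    finally show "real (card P) \<le> real m + real (card C)" .
    have "real m = (\<Sum>J\<in>C. real m * \<mu> J)" using C(3) by (simp flip: sum_distrib_left)
    also have "\<dots> \<le> real (card P)" unfolding cardP of_nat_sum by (rule sum_mono) (rule n(1))
    finally show "m \<le> card P" by simp
    show "f v \<subseteq> {1..card P} \<and> card (f v) = b" if "v \<in> V" for v using f[OF that] D by blast
    show "f u \<inter> f v = {}" if "u \<in> V" "v \<in> V" and J: "\<And>J. J \<in> C \<Longrightarrow> \<not> (u \<in> J \<and> v \<in> J)" for u v
    proof -
      have "D u \<inter> D v = {}"
      proof (rule ccontr)
        assume "D u \<inter> D v \<noteq> {}"
        then obtain p p' where p: "p \<in> P" "u \<in> fst p" "p' \<in> P" "v \<in> fst p'" "h p = h p'" by (auto simp: D_def)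
        then have "p = p'" using h by (auto simp: bij_betw_def inj_on_def)
        then show False using p J[of "fst p"] by (auto simp: P_def)
      qed
      then show ?thesis using f[OF that(1)] f[OF that(2)] by blast
    qed
  qed
qed

theorem theorem1:
  fixes G :: "('a, 'b) pre_digraph"
  assumes "graph G"
    and "triangle_free G"
    and "\<forall>v\<in>verts G. out_degree G v \<le> 3"
  shows "fractional_chromatic_number G \<le> 43 / 15"
proof -
  interpret graph G by fact
  define E where "E u v \<longleftrightarrow> u \<rightarrow>\<^bsub>G\<^esub> v" for u v
  define C where "C = {J. J \<subseteq> verts G \<and> (\<forall>x\<in>J. \<forall>y\<in>J. \<not> E x y)}"
  have E_verts: "x \<in> verts G" "y \<in> verts G" if "E x y" for x y
    using adj_in_verts[of x y] that by (auto simp: E_def)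
  have sym: "E y x" if "E x y" for x y
    using that arcs_ends_symmetric[OF sym_arcs] by (simp add: E_def)
  have tf: "\<not> E x z" if "E x y" "E y z" for x y z
  proof
    assume "E x z"
    then have "E z x" by (rule sym)
    then show False using that assms(2) unfolding triangle_free_def E_def by blast
  qed
  have deg: "card {y. E x y} \<le> 3" for x
  proof (cases "x \<in> verts G")
    case True
    have "{y. E x y} = head G ` out_arcs G x" by (auto simp: E_def arcs_ends_conv out_arcs_def)
    then have "card {y. E x y} \<le> out_degree G x"
      using card_image_le[OF finite_out_arcs] by (simp add: out_degree_def)
    then show ?thesis using assms(3) True by fastforce
  next
    case False
    then have "{y. E x y} = {}" using E_verts by blast
    then show ?thesis by simp
  qed
  have "\<exists>\<mu> :: 'a set \<Rightarrow> real. (\<forall>J\<in>C. 0 \<le> \<mu> J) \<and> sum \<mu> C = 1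
    \<and> (\<forall>v\<in>verts G. 15 / 43 \<le> (\<Sum>J\<in>{J \<in> C. v \<in> J}. \<mu> J))"
    unfolding C_def by (rule independent_distribution) (fact finite_verts E_verts(1) sym tf deg)+
  then obtain \<mu> :: "'a set \<Rightarrow> real" where \<mu>: "\<And>J. J \<in> C \<Longrightarrow> 0 \<le> \<mu> J" "sum \<mu> C = 1"
    "\<And>v. v \<in> verts G \<Longrightarrow> 15 / 43 \<le> (\<Sum>J\<in>{J \<in> C. v \<in> J}. \<mu> J)" by blast
  have finC: "finite C" unfolding C_def by (rule finite_subset[of _ "Pow (verts G)"]) auto
  \<comment> \<open>The rounding error \<open>card C\<close> does not depend on \<open>k\<close>, so
    its share of the ratio vanishes as \<open>k\<close> grows.\<close>
  have bound: "fractional_chromatic_number G \<le> 43 / 15 + real (card C) / real (15 * k)" if k: "k > 0" for k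
  proof -
    have cover: "real (15 * k) \<le> real (43 * k) * (\<Sum>J\<in>{J \<in> C. v \<in> J}. \<mu> J)" if "v \<in> verts G" for v
      using mult_left_mono[OF \<mu>(3)[OF that], of "43 * real k"] by simp
    obtain A f where A: "real A \<le> real (43 * k) + real (card C)" "43 * k \<le> A"
      and f: "\<And>v. v \<in> verts G \<Longrightarrow> f v \<subseteq> {1..A} \<and> card (f v) = 15 * k"
      "\<And>u v. u \<in> verts G \<Longrightarrow> v \<in> verts G \<Longrightarrow> (\<And>J. J \<in> C \<Longrightarrow> \<not> (u \<in> J \<and> v \<in> J)) \<Longrightarrow> f u \<inter> f v = {}"
      using colour_classes[OF finC \<mu>(1,2) cover] by blast
    have "f u \<inter> f v = {}" if "u \<rightarrow>\<^bsub>G\<^esub> v" for u v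
      by (rule f(2)) (use that adj_in_verts[OF that] in \<open>auto simp: C_def E_def\<close>)
    then have "multicoloring G A (15 * k) f" using f(1) by (simp add: multicoloring_def)
    moreover have "0 < A" "0 < 15 * k" using A(2) k by auto
    ultimately have "real A / real (15 * k) \<in> coloring_ratios G" unfolding coloring_ratios_def by blast
    then have "fractional_chromatic_number G \<le> real A / real (15 * k)"
      unfolding fractional_chromatic_number_def by (rule cInf_lower[OF _ bdd_below_coloring_ratios])
    also have "\<dots> \<le> (real (43 * k) + real (card C)) / real (15 * k)" by (rule divide_right_mono[OF A(1)]) simp
    also have "\<dots> = 43 / 15 + real (card C) / real (15 * k)" using k by (simp add: add_divide_distrib)
    finally show ?thesis .
  qed
  show ?thesis
  proof (rule field_le_epsilon)
    fix \<epsilon> :: real assume "0 < \<epsilon>"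
    obtain k where k: "real (card C) / \<epsilon> < real k" using reals_Archimedean2 by blast
    have "0 \<le> real (card C) / \<epsilon>" using \<open>0 < \<epsilon>\<close> by simp
    then have "0 < k" using k by (cases k) auto
    have "real (card C) < \<epsilon> * real k" using k \<open>0 < \<epsilon>\<close> by (simp add: field_simps)
    also have "\<dots> \<le> \<epsilon> * real (15 * k)" using \<open>0 < \<epsilon>\<close> by simp
    finally have "real (card C) / real (15 * k) \<le> \<epsilon>" using \<open>0 < k\<close> by (simp add: field_simps)
    then show "fractional_chromatic_number G \<le> 43 / 15 + \<epsilon>" using bound[OF \<open>0 < k\<close>] by linarith
  qed
qed

end
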